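(* Let $q=(q_n)$ and $q'=(q'_n)$ be offspring distributions with $\sum_n n q_n = m = \sum_n n q_n'$. Assume that $q_0=q_0'=0$, that $q_1\neq 1$ and $q_1'\neq 1$, and that $\sum_n n^2 q_n$ and $\sum_n n^2 q_n'$ are both finite. Then for $\mathbf{P}_q\times\mathbf{P}_{q'}$-almost every pair of trees $(\Gamma,\Gamma')$, the trees $\Gamma$ and $\Gamma'$ are equipolar.
   Context: An offspring distribution is a probability vector $(q_n)$ on the nonnegative integers. If $q_0=0$, $\mathbf{P}_q$ denotes the (Galton-Watson) probability measure on infinite rooted trees under which the numbers of children of the vertices are IID, each equal to $n$ with probability $q_n$. Under $\mathbf{P}_q\times\mathbf{P}_{q'}$ the trees $\Gamma$ and $\Gamma'$ are picked independently from $\mathbf{P}_q$ and $\mathbf{P}_{q'}$. For an infinite, locally finite tree $\Gamma$ with root $\rho$, let $\{X(v)\}$ be IID real random variables with common distribution $F$ indexed by the vertices $v$ of $\Gamma$. For a closed set $B\subseteq\mathbb{R}^\infty$ (product topology), let $P(\Gamma;B)=P(\Gamma;B;F)$ be the probability that there exists an infinite non-self-intersecting path $\rho,v_1,v_2,\ldots$ in $\Gamma$ from the root with $(X(v_1),X(v_2),\ldots)\in B$. The set $B$ is polar for $\Gamma$ (with label distribution $F$) if $P(\Gamma;B;F)=0$. Two trees $\Gamma^{(1)},\Gamma^{(2)}$ are equipolar if for every closed set $B$ (and every label distribution $F$), $B$ is polar for $\Gamma^{(1)}$ if and only if $B$ is polar for $\Gamma^{(2)}$. Note the order of quantifiers: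 the almost sure event does not depend on $B$ or $F$. *)

theory Defs
  imports "HOL-Probability.Probability"
begin

text \<open>
  Rooted trees are encoded in Ulam-Harris form: a vertex is a finite sequence of naturals, the root
  is \<open>[]\<close>, the children of \<open>v\<close> are of the form \<open>v @ [i]\<close>, and a tree is the set of its vertices.
\<close>

definition inf_tree :: "nat list set \<Rightarrow> bool" where
  "inf_tree T \<longleftrightarrow>
     [] \<in> T \<and> (\<forall>v i. v @ [i] \<in> T \<longrightarrow> v \<in> T) \<and> (\<forall>v. finite {i. v @ [i] \<in> T}) \<and> infinite T"

definition adjacent :: "nat list \<Rightarrow> nat list \<Rightarrow> bool" where
  "adjacent u v \<longleftrightarrow> (\<exists>i. v = u @ [i] \<or> u = v @ [i])"

definition root_path :: "nat list set \<Rightarrow> (nat \<Rightarrow> nat list) \<Rightarrow> bool" where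
  "root_path T \<xi> \<longleftrightarrow>
     \<xi> 0 = [] \<and> (\<forall>n. \<xi> n \<in> T) \<and> (\<forall>n. adjacent (\<xi> n) (\<xi> (Suc n))) \<and> inj \<xi>"

text \<open>
  \<open>path_prob T B F\<close> is \<open>P(T; B; F)\<close>. The label of the root plays no role. If \<open>T\<close> is a locally finite
  tree and \<open>B\<close> is closed, the event is measurable: it is the projection of a closed set along the
  compact space of paths from the root, hence closed.
\<close>

definition path_prob :: "nat list set \<Rightarrow> (nat \<Rightarrow> real) set \<Rightarrow> real measure \<Rightarrow> real" where
  "path_prob T B F =
     \<P>(X in (\<Pi>\<^sub>M v\<in>T. F). \<exists>\<xi>. root_path T \<xi> \<and> (\<lambda>n. X (\<xi> (Suc n))) \<in> B)"

definition polar :: "nat list set \<Rightarrow> (nat \<Rightarrow> real) set \<Rightarrow> real measure \<Rightarrow> bool" where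
  "polar T B F \<longleftrightarrow> path_prob T B F = 0"

text \<open>The library topology on \<^typ>\<open>nat \<Rightarrow> real\<close> is the product topology.\<close>

definition equipolar :: "nat list set \<Rightarrow> nat list set \<Rightarrow> bool" where
  "equipolar T T' \<longleftrightarrow>
     (\<forall>F B. real_distribution F \<longrightarrow> closed B \<longrightarrow> (polar T B F \<longleftrightarrow> polar T' B F))"

text \<open>
  The Galton-Watson law is a measure on trees, with the \<open>\<sigma>\<close>-algebra generated by the events that a
  given vertex belongs to the tree. It is the law of the tree in which each vertex \<open>v\<close> has children
  \<open>v @ [0], \<dots>, v @ [N v - 1]\<close>, for IID numbers \<open>N v\<close> indexed by all finite sequences.
\<close>

definition tree_space :: "nat list set measure" where
  "tree_space = sigma UNIV (range (\<lambda>v. {T. v \<in> T}))"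

definition tree_of :: "(nat list \<Rightarrow> nat) \<Rightarrow> nat list set" where
  "tree_of N = {v. \<forall>k < length v. v ! k < N (take k v)}"

definition galton_watson :: "nat pmf \<Rightarrow> nat list set measure" where
  "galton_watson q = distr (\<Pi>\<^sub>M v\<in>UNIV. measure_pmf q) tree_space tree_of"

lemma Nil_in_tree_of: "[] \<in> tree_of N"
  by (simp add: tree_of_def)

lemma snoc_in_tree_of_iff: "v @ [i] \<in> tree_of N \<longleftrightarrow> v \<in> tree_of N \<and> i < N v"
  by (auto simp: tree_of_def nth_append less_Suc_eq)

lemma space_tree_space [simp]: "space tree_space = UNIV"
  by (simp add: tree_space_def)

lemma measurable_tree_of [measurable]:
  "tree_of \<in> measurable (\<Pi>\<^sub>M v\<in>UNIV. measure_pmf q) tree_space"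
  unfolding tree_space_def
proof (rule measurable_sigma_sets[OF sets_measure_of])
  fix A :: "nat list set set" assume "A \<in> range (\<lambda>v. {T. v \<in> T})"
  then obtain v where A: "A = {T. v \<in> T}" by auto
  have "{N \<in> space (\<Pi>\<^sub>M v\<in>UNIV. measure_pmf q). \<forall>k < length v. v ! k < N (take k v)}
        \<in> sets (\<Pi>\<^sub>M v\<in>UNIV. measure_pmf q)"
    by measurable
  then show "tree_of -` A \<inter> space (\<Pi>\<^sub>M v\<in>UNIV. measure_pmf q) \<in> sets (\<Pi>\<^sub>M v\<in>UNIV. measure_pmf q)"
    unfolding A by (rule back_subst[of "\<lambda>S. S \<in> _"]) (auto simp: tree_of_def)
qed auto

lemma prob_space_galton_watson: "prob_space (galton_watson q)"
  unfolding galton_watson_def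
  by (intro prob_space.prob_space_distr prob_space_PiM measurable_tree_of prob_space_measure_pmf)

lemma inf_tree_tree_of:
  assumes "\<And>v. N v \<noteq> 0"
  shows "inf_tree (tree_of N)"
proof -
  have "replicate k 0 \<in> tree_of N" for k
    using assms by (auto simp: tree_of_def)
  then have "range (\<lambda>k. replicate k (0::nat)) \<subseteq> tree_of N" by auto
  moreover have "infinite (range (\<lambda>k. replicate k (0::nat)))"
    by (rule range_inj_infinite) (metis injI length_replicate)
  ultimately have "infinite (tree_of N)" using finite_subset by blast
  then show ?thesis
    by (auto simp: inf_tree_def Nil_in_tree_of snoc_in_tree_of_iff)
qed

lemma AE_galton_watson_inf_tree:
  assumes "pmf q 0 = 0"
  shows "AE T in galton_watson q. inf_tree T"
proof -
  have mem: "Measurable.pred tree_space (\<lambda>T. v \<in> T)" for v :: "nat list"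
    by (auto simp: pred_def tree_space_def)
  have "inf_tree = (\<lambda>T. [] \<in> T \<and> (\<forall>v i. v @ [i] \<in> T \<longrightarrow> v \<in> T)
      \<and> (\<forall>v. \<exists>k. \<forall>i. v @ [i] \<in> T \<longrightarrow> i < k) \<and> (\<forall>vs. \<exists>v. v \<in> T \<and> v \<notin> set vs))"
  proof (intro ext)
    fix T :: "nat list set"
    have "infinite T \<longleftrightarrow> (\<forall>vs. \<exists>v. v \<in> T \<and> v \<notin> set vs)"
      by (metis finite_list finite_set subsetI finite_subset)
    then show "inf_tree T \<longleftrightarrow> ([] \<in> T \<and> (\<forall>v i. v @ [i] \<in> T \<longrightarrow> v \<in> T)
      \<and> (\<forall>v. \<exists>k. \<forall>i. v @ [i] \<in> T \<longrightarrow> i < k) \<and> (\<forall>vs. \<exists>v. v \<in> T \<and> v \<notin> set vs))"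
      by (simp add: inf_tree_def finite_nat_set_iff_bounded)
  qed
  also have "Measurable.pred tree_space \<dots>"
    using mem[measurable] by measurable
  finally have meas: "{T \<in> space tree_space. inf_tree T} \<in> sets tree_space"
    by (simp add: pred_def)
  have "AE n in measure_pmf q. n \<noteq> 0"
    using assms by (metis (mono_tags, lifting) AE_measure_pmf_iff set_pmf_iff)
  then have "AE N in \<Pi>\<^sub>M v\<in>(UNIV :: nat list set). measure_pmf q. N v \<noteq> 0" for v
    by (intro AE_PiM_component prob_space_measure_pmf) auto
  then have "AE N in \<Pi>\<^sub>M v\<in>(UNIV :: nat list set). measure_pmf q. \<forall>v. N v \<noteq> 0"
    by (subst AE_all_countable) auto
  then show ?thesis
    unfolding galton_watson_def AE_distr_iff[OF measurable_tree_of meas]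
    by eventually_elim (auto intro: inf_tree_tree_of)
qed

end

(* The hitting probability of a closed set B by the label paths of a tree satisfies a recursion over the
   levels: sections of B by the first label are averaged over F and combined over the children. Up to
   constants depending on the tree it is compared, uniformly in B, F and the level, with a reference
   recursion, the effective conductance S |-> m S / (1 + m S) at each level, which depends on the
   tree only through the mean offspring m.

   Lower bound: 1 - prod (1 - s_i) >= S / (1 + S) for S = sum s_i turns the recursion into an electrical
   network. Conductances are superadditive in the resistances (Rayleigh), so a flow on the tree with
   energy of order m^-k in generation k gives the comparison; the flow is uniform on generation n.
   Upper bound: the non-hitting probability dominates the one of a "spherically symmetric tree" with
   slightly larger, possibly fractional, generation sizes. By Hoelder's inequality the latter is
   submultiplicative in the sequence of generation sizes, which makes the induction work.

   A Galton-Watson tree with finite variance almost surely has generation sizes of order m^n and uniform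
   flows of the required energy. The latter follows from a law of large numbers for the sum over
   generation k of an integrable majorant of the squared normalized sizes of the subtrees. The exceptional
   set involves neither B nor F. *)

theory Submission
  imports Defs
begin

section \<open>Families of labels indexed by all finite sequences\<close>

text \<open>Paths with labels in a general \<open>B\<close> are not a percolation on the tree: what
  remains to be hit changes with every label. Each estimate is therefore proved for all targets
  simultaneously and has to survive the average over the first label. This is why superadditivity is
  used with weights, where it is linear in the conductances, and why Hoelder's inequality is used
  with exponents that do not depend on the label. A constant lost at each level would be fatal: the
  constants of the tree enter through resistances and generation sizes of the whole network, and
  \<open>K\<close> in \<open>one_minus_avoid_le_ref\<close> reproduces itself under the recursion.
  Stopping at level \<open>n\<close>, with a flow adapted to \<open>n\<close>, leaves only finite
  recursions; polarity is read off in the limit, since \<open>B\<close> is closed and the paths form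
  a compact set. Finite variance makes the supremum over \<open>n\<close> of
  \<open>(Z_n / m ^ n)^2\<close>, \<open>Z_n\<close> being the size of generation \<open>n\<close>,
  integrable but in general no better. Its sum over a generation is thus out of reach of a plain
  second moment bound, hence the truncation at \<open>m ^ k\<close> in
  \<open>AE_psum_bounded\<close>.\<close>

abbreviation labels :: "'a measure \<Rightarrow> (nat list \<Rightarrow> 'a) measure" where
  "labels M \<equiv> \<Pi>\<^sub>M v\<in>UNIV. M"

abbreviation label_seqs :: "'a measure \<Rightarrow> (nat \<Rightarrow> nat list \<Rightarrow> 'a) measure" where
  "label_seqs M \<equiv> \<Pi>\<^sub>M i\<in>UNIV. labels M"

definition graft :: "'a \<Rightarrow> (nat \<Rightarrow> nat list \<Rightarrow> 'a) \<Rightarrow> nat list \<Rightarrow> 'a" where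
  "graft x y v = (case v of [] \<Rightarrow> x | i # u \<Rightarrow> y i u)"

lemma graft_simps [simp]: "graft x y [] = x" "graft x y (i # u) = y i u"
  by (auto simp: graft_def)

lemma measurable_graft:
  "(\<lambda>(x, y). graft x y) \<in> measurable (M \<Otimes>\<^sub>M label_seqs M) (labels M)"
proof (rule measurable_PiM_single')
  fix v :: "nat list"
  show "(\<lambda>p. (case p of (x, y) \<Rightarrow> graft x y) v) \<in> measurable (M \<Otimes>\<^sub>M label_seqs M) M"
  proof (cases v)
    case (Cons i u)
    have "(\<lambda>p. snd p i u) \<in> measurable (M \<Otimes>\<^sub>M label_seqs M) M"
      by (rule measurable_compose[OF measurable_compose[OF measurable_snd
            measurable_component_singleton[of i UNIV]] measurable_component_singleton[of u UNIV]]) auto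
    then show ?thesis by (simp add: Cons split_beta)
  qed (simp add: split_beta)
qed (auto simp: space_PiM space_pair_measure graft_def PiE_iff split: list.split)

lemma measurable_graft' [measurable (raw)]:
  assumes "f \<in> measurable N M" "g \<in> measurable N (label_seqs M)"
  shows "(\<lambda>w. graft (f w) (g w)) \<in> measurable N (labels M)"
  using measurable_compose[OF measurable_Pair[OF assms] measurable_graft] by simp

text \<open>An IID field on all finite sequences is a root value together with independent IID
  fields, one for each child of the root. This is the source of every recursion below. It suffices
  to compare cylinder probabilities.\<close>

lemma distr_graft:
  assumes "prob_space M"
  shows "distr (M \<Otimes>\<^sub>M label_seqs M) (labels M) (\<lambda>(x, y). graft x y) = labels M"
proof -
  interpret M: prob_space M by fact
  interpret L: product_prob_space "\<lambda>_. M" "UNIV :: nat list set" by unfold_locales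
  interpret Lp: prob_space "labels M" by unfold_locales
  interpret S: product_prob_space "\<lambda>_. labels M" "UNIV :: nat set" by unfold_locales
  interpret Sp: prob_space "label_seqs M" by unfold_locales
  show ?thesis
  proof (rule L.PiM_eq)
    fix J :: "nat list set" and A :: "nat list \<Rightarrow> 'a set"
    assume J: "finite J" and A: "\<And>j. j \<in> J \<Longrightarrow> A j \<in> sets M"
    \<comment> \<open>Padding with the whole space allows the cylinder over \<open>J\<close> to be
      read over the larger index set \<open>J'\<close>, the root plus a full product of first
      letters and tails. There the event splits into one condition per child.\<close>
    define A' where "A' v = (if v \<in> J then A v else space M)" for v
    define I where "I = hd ` J"
    define K where "K = tl ` J"
    have fin: "finite I" "finite K" using J by (auto simp: I_def K_def)
    define J' where "J' = insert [] ((\<lambda>(i, u). i # u) ` (I \<times> K))"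
    have JJ': "J \<subseteq> J'"
    proof
      fix v assume v: "v \<in> J"
      show "v \<in> J'"
      proof (cases v)
        case (Cons i u)
        then have "i \<in> I" "u \<in> K" using v by (force simp: I_def K_def)+
        then show ?thesis by (auto simp: J'_def Cons)
      qed (simp add: J'_def)
    qed
    have A'[measurable]: "A' v \<in> sets M" for v using A by (auto simp: A'_def)
    let ?X = "prod_emb UNIV (\<lambda>_. M) J (\<Pi>\<^sub>E j\<in>J. A j)"
    have "?X = {X \<in> space (labels M). \<forall>v\<in>J. X v \<in> A v}"
      by (auto simp: prod_emb_def space_PiM Pi_iff PiE_iff)
    also have "\<dots> = {X \<in> space (labels M). \<forall>v\<in>J'. X v \<in> A' v}"
      using JJ' by (auto simp: A'_def space_PiM)
    finally have X: "?X = \<dots>" .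
    have Xm: "?X \<in> sets (labels M)"
      using J A by (intro sets_PiM_I) auto
    define C where "C i = {X \<in> space (labels M). \<forall>u\<in>K. X u \<in> A' (i # u)}" for i
    have C[measurable]: "C i \<in> sets (labels M)" for i
      unfolding C_def using fin by measurable
    have "(\<lambda>(x, y). graft x y) -` ?X \<inter> space (M \<Otimes>\<^sub>M label_seqs M)
       = A' [] \<times> {y \<in> space (label_seqs M). \<forall>i\<in>I. y i \<in> C i}"
      using sets.sets_into_space[OF A'[of "[]"]]
      by (auto simp: X J'_def space_pair_measure C_def space_PiM graft_def PiE_iff subset_eq
          split: list.splits)
    then have "emeasure (distr (M \<Otimes>\<^sub>M label_seqs M) (labels M) (\<lambda>(x, y). graft x y)) ?X
       = emeasure (M \<Otimes>\<^sub>M label_seqs M) (A' [] \<times> {y \<in> space (label_seqs M). \<forall>i\<in>I. y i \<in> C i})"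
      using Xm by (simp add: emeasure_distr measurable_graft)
    also have "\<dots> = emeasure M (A' []) * emeasure (label_seqs M) {y \<in> space (label_seqs M). \<forall>i\<in>I. y i \<in> C i}"
      using fin by (intro S.P.emeasure_pair_measure_Times) auto
    also have "emeasure (label_seqs M) {y \<in> space (label_seqs M). \<forall>i\<in>I. y i \<in> C i} = (\<Prod>i\<in>I. emeasure (labels M) (C i))"
      using fin by (intro S.emeasure_PiM_Collect) auto
    also have "\<dots> = (\<Prod>i\<in>I. \<Prod>u\<in>K. emeasure M (A' (i # u)))"
      unfolding C_def using fin by (intro prod.cong refl L.emeasure_PiM_Collect) auto
    also have "\<dots> = (\<Prod>v\<in>(\<lambda>(i, u). i # u) ` (I \<times> K). emeasure M (A' v))"
      by (subst prod.reindex) (auto simp: inj_on_def prod.cartesian_product split_beta)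
    also have "emeasure M (A' []) * \<dots> = (\<Prod>v\<in>J'. emeasure M (A' v))"
      unfolding J'_def using fin by (subst prod.insert) auto
    also have "\<dots> = (\<Prod>v\<in>J. emeasure M (A v))"
      using JJ' fin by (intro prod.mono_neutral_cong_right) (auto simp: J'_def A'_def M.emeasure_space_1)
    finally show "emeasure (distr (M \<Otimes>\<^sub>M label_seqs M) (labels M) (\<lambda>(x, y). graft x y)) ?X
       = (\<Prod>v\<in>J. emeasure M (A v))" .
  qed simp
qed

lemma nn_integral_labels:
  assumes "prob_space M" and [measurable]: "f \<in> borel_measurable (labels M)"
  shows "(\<integral>\<^sup>+X. f X \<partial>labels M) = (\<integral>\<^sup>+x. (\<integral>\<^sup>+y. f (graft x y) \<partial>label_seqs M) \<partial>M)"
proof -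
  interpret S: prob_space "label_seqs M"
    by (intro prob_space_PiM assms)
  have "(\<integral>\<^sup>+X. f X \<partial>labels M) = (\<integral>\<^sup>+X. f X \<partial>distr (M \<Otimes>\<^sub>M label_seqs M) (labels M) (\<lambda>(x, y). graft x y))"
    by (simp add: distr_graft assms)
  also have "\<dots> = (\<integral>\<^sup>+p. f (graft (fst p) (snd p)) \<partial>(M \<Otimes>\<^sub>M label_seqs M))"
    by (subst nn_integral_distr) (simp_all add: measurable_graft split_beta)
  also have "\<dots> = (\<integral>\<^sup>+x. (\<integral>\<^sup>+y. f (graft x y) \<partial>label_seqs M) \<partial>M)"
    by (subst S.nn_integral_fst[symmetric]) simp_all
  finally show ?thesis .
qed

lemma integral_labels:
  fixes f :: "_ \<Rightarrow> real"
  assumes "prob_space M" and f: "integrable (labels M) f"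
  shows "(\<integral>X. f X \<partial>labels M) = (\<integral>x. (\<integral>y. f (graft x y) \<partial>label_seqs M) \<partial>M)"
proof -
  interpret M: prob_space M by fact
  interpret S: prob_space "label_seqs M"
    by (intro prob_space_PiM assms)
  interpret pair_prob_space M "label_seqs M" by unfold_locales
  note [measurable] = borel_measurable_integrable[OF f]
  have D: "distr (M \<Otimes>\<^sub>M label_seqs M) (labels M) (\<lambda>(x, y). graft x y) = labels M"
    by (simp add: distr_graft assms)
  have i: "integrable (M \<Otimes>\<^sub>M label_seqs M) (\<lambda>p. f (graft (fst p) (snd p)))"
    using f by (subst (asm) D[symmetric]) (simp add: integrable_distr_eq measurable_graft split_beta)
  have "(\<integral>X. f X \<partial>labels M) = (\<integral>p. f (graft (fst p) (snd p)) \<partial>(M \<Otimes>\<^sub>M label_seqs M))"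
    by (subst D[symmetric], subst integral_distr) (simp_all add: measurable_graft split_beta)
  also have "\<dots> = (\<integral>x. (\<integral>y. f (graft x y) \<partial>label_seqs M) \<partial>M)"
    using integral_fst'[OF i] by simp
  finally show ?thesis .
qed

section \<open>Functionals of a target set\<close>

abbreviation seqs :: "(nat \<Rightarrow> real) measure" where
  "seqs \<equiv> \<Pi>\<^sub>M i\<in>UNIV. borel"

definition sec :: "((nat \<Rightarrow> real) \<Rightarrow> bool) \<Rightarrow> real \<Rightarrow> (nat \<Rightarrow> real) \<Rightarrow> bool" where
  "sec b x = (\<lambda>y. b (case_nat x y))"

lemma pred_sec [measurable]:
  assumes [measurable]: "Measurable.pred seqs b"
  shows "Measurable.pred seqs (sec b x)"
  unfolding sec_def by measurable

text \<open>Measurability uniformly in a parameter. The parameter is itself a sequence, so that a section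
  variable can be pushed onto it without changing its type.\<close>

definition measurable_functional :: "(((nat \<Rightarrow> real) \<Rightarrow> bool) \<Rightarrow> real) \<Rightarrow> bool" where
  "measurable_functional V \<longleftrightarrow>
     (\<forall>b. Measurable.pred (seqs \<Otimes>\<^sub>M seqs) (\<lambda>p. b (fst p) (snd p)) \<longrightarrow> (\<lambda>t. V (b t)) \<in> borel_measurable seqs)"

lemma measurable_functionalD:
  "measurable_functional V \<Longrightarrow> Measurable.pred (seqs \<Otimes>\<^sub>M seqs) (\<lambda>p. b (fst p) (snd p)) \<Longrightarrow>
    (\<lambda>t. V (b t)) \<in> borel_measurable seqs"
  by (auto simp: measurable_functional_def)

lemma measurable_functional_leaf: "measurable_functional (\<lambda>b. of_bool (b (\<lambda>_. 0)))"
  unfolding measurable_functional_def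
proof safe
  fix b :: "(nat \<Rightarrow> real) \<Rightarrow> (nat \<Rightarrow> real) \<Rightarrow> bool"
  assume [measurable]: "Measurable.pred (seqs \<Otimes>\<^sub>M seqs) (\<lambda>p. b (fst p) (snd p))"
  have "(\<lambda>t. (t, \<lambda>_. 0)) \<in> measurable seqs (seqs \<Otimes>\<^sub>M seqs)"
    by (intro measurable_Pair measurable_ident_sets refl measurable_const) (simp add: space_PiM)
  from measurable_compose[OF this, of "\<lambda>p. b (fst p) (snd p)" "count_space UNIV"]
  have "Measurable.pred seqs (\<lambda>t. b t (\<lambda>_. 0))" by simp
  then show "(\<lambda>t. of_bool (b t (\<lambda>_. 0)) :: real) \<in> borel_measurable seqs"
    by measurable
qed

lemma measurable_functional_sec:
  assumes V: "measurable_functional V" and [measurable]: "Measurable.pred seqs b"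
  shows "(\<lambda>x. V (sec b x)) \<in> borel_measurable borel"
proof -
  have "(\<lambda>t. V (sec b (t 0))) \<in> borel_measurable seqs"
    by (rule measurable_functionalD[OF V]) (simp add: sec_def)
  moreover have "(\<lambda>x _. x) \<in> measurable borel seqs"
    by (rule measurable_PiM_single') (auto simp: space_PiM)
  ultimately show ?thesis
    by (rule measurable_compose[where f = "\<lambda>x _. x" and g = "\<lambda>t. V (sec b (t 0))", rotated])
qed

lemma measurable_functional_integral:
  assumes "real_distribution F" and V: "measurable_functional V"
  shows "measurable_functional (\<lambda>b. \<integral>x. V (sec b x) \<partial>F)"
  unfolding measurable_functional_def
proof safe
  interpret real_distribution F by fact
  fix b :: "(nat \<Rightarrow> real) \<Rightarrow> (nat \<Rightarrow> real) \<Rightarrow> bool"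
  assume [measurable]: "Measurable.pred (seqs \<Otimes>\<^sub>M seqs) (\<lambda>p. b (fst p) (snd p))"
  have tl: "(\<lambda>p. \<lambda>n. fst p (Suc n)) \<in> measurable (seqs \<Otimes>\<^sub>M seqs) seqs"
    by (rule measurable_PiM_single') (auto simp: space_PiM space_pair_measure)
  \<comment> \<open>The pair of a parameter \<open>t\<close> and a label \<open>x\<close> is coded
    as one sequence with head \<open>x\<close> and tail \<open>t\<close>, so that the assumption on
    \<open>V\<close> applies to the family of sections.\<close>
  have "(\<lambda>p. (\<lambda>n. fst p (Suc n), case_nat (fst p 0) (snd p))) \<in> measurable (seqs \<Otimes>\<^sub>M seqs) (seqs \<Otimes>\<^sub>M seqs)"
    by (intro measurable_Pair tl) measurable
  from measurable_compose[OF this, of "\<lambda>p. b (fst p) (snd p)" "count_space UNIV"]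
  have "Measurable.pred (seqs \<Otimes>\<^sub>M seqs) (\<lambda>p. sec (b (\<lambda>n. fst p (Suc n))) (fst p 0) (snd p))"
    by (simp add: sec_def)
  from measurable_functionalD[OF V this]
  have "(\<lambda>t. V (sec (b (\<lambda>n. t (Suc n))) (t 0))) \<in> borel_measurable seqs" .
  then have "(\<lambda>p. V (sec (b (\<lambda>n. case_nat (snd p) (fst p) (Suc n))) (case_nat (snd p) (fst p) 0)))
      \<in> borel_measurable (seqs \<Otimes>\<^sub>M F)"
    by (rule measurable_compose[rotated]) measurable
  then have [measurable]: "(\<lambda>p. V (sec (b (fst p)) (snd p))) \<in> borel_measurable (seqs \<Otimes>\<^sub>M F)"
    by simp
  show "(\<lambda>t. \<integral>x. V (sec (b t) x) \<partial>F) \<in> borel_measurable seqs"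
    by (rule borel_measurable_lebesgue_integral) (simp add: split_beta)
qed

lemma measurable_functional_compose:
  assumes "measurable_functional V" "g \<in> borel_measurable borel"
  shows "measurable_functional (\<lambda>b. g (V b))"
  using assms measurable_compose unfolding measurable_functional_def by blast

lemma measurable_functional_prod:
  "(\<And>i. i \<in> I \<Longrightarrow> measurable_functional (V i)) \<Longrightarrow> measurable_functional (\<lambda>b. \<Prod>i\<in>I. V i b)"
  unfolding measurable_functional_def by (auto intro!: borel_measurable_prod)

lemma integrable_functional:
  assumes "real_distribution F" "measurable_functional V" "Measurable.pred seqs b"
    and "\<And>x. 0 \<le> V (sec b x)" "\<And>x. V (sec b x) \<le> K"
  shows "integrable F (\<lambda>x. V (sec b x))"
proof -
  interpret real_distribution F by fact
  have "(\<lambda>x. V (sec b x)) \<in> borel_measurable F"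
    using measurable_functional_sec[OF assms(2,3)] by simp
  then show ?thesis
    by (rule integrable_const_bound[where B = K, rotated]) (auto simp: assms(4,5))
qed

lemma integral_functional_range:
  assumes "real_distribution F" "measurable_functional V" "Measurable.pred seqs b"
    and "\<And>x. 0 \<le> V (sec b x)" "\<And>x. V (sec b x) \<le> K"
  shows "0 \<le> (\<integral>x. V (sec b x) \<partial>F)" "(\<integral>x. V (sec b x) \<partial>F) \<le> K"
proof -
  interpret real_distribution F by fact
  show "0 \<le> (\<integral>x. V (sec b x) \<partial>F)" using assms(4) by (simp add: integral_nonneg)
  have "(\<integral>x. V (sec b x) \<partial>F) \<le> (\<integral>x. K \<partial>F)"
    by (intro integral_mono integrable_functional[OF assms(1-5)] assms) auto
  then show "(\<integral>x. V (sec b x) \<partial>F) \<le> K" using prob_space by simp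
qed

section \<open>The reference functional and conductances\<close>

text \<open>This is \<open>conductance\<close> for the resistances \<open>1 / m ^ k\<close>:
  shifting these divides them by \<open>m\<close>, which multiplies the conductance by
  \<open>m\<close> and yields the factor in front of \<open>S\<close>.\<close>

primrec ref :: "real measure \<Rightarrow> real \<Rightarrow> nat \<Rightarrow> ((nat \<Rightarrow> real) \<Rightarrow> bool) \<Rightarrow> real" where
  "ref F m 0 = (\<lambda>b. of_bool (b (\<lambda>_. 0)))"
| "ref F m (Suc n) = (\<lambda>b. let S = (\<integral>x. ref F m n (sec b x) \<partial>F) in m * S / (1 + m * S))"

text \<open>Effective conductance of the tree of all label sequences of length \<open>n\<close>: the
  branches at a vertex are in parallel, weighted by \<open>F\<close>, the resistance
  \<open>r k\<close> is in series in generation \<open>k\<close>, and a leaf is connected to the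
  sink exactly if its sequence is in the target.\<close>

primrec conductance :: "real measure \<Rightarrow> nat \<Rightarrow> (nat \<Rightarrow> real) \<Rightarrow> ((nat \<Rightarrow> real) \<Rightarrow> bool) \<Rightarrow> real" where
  "conductance F 0 = (\<lambda>r b. of_bool (b (\<lambda>_. 0)) / r 0)"
| "conductance F (Suc n) = (\<lambda>r b. let S = (\<integral>x. conductance F n (\<lambda>k. r (Suc k)) (sec b x) \<partial>F) in S / (1 + r 0 * S))"

lemma measurable_functional_ref:
  assumes "real_distribution F" shows "measurable_functional (ref F m n)"
proof (induction n)
  case (Suc n)
  show ?case
    unfolding ref.simps Let_def
    by (rule measurable_functional_compose[OF measurable_functional_integral[OF assms Suc],
          of "\<lambda>S. m * S / (1 + m * S)"]) measurable
qed (simp add: measurable_functional_leaf)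

lemma measurable_functional_conductance:
  assumes "real_distribution F" shows "measurable_functional (conductance F n r)"
proof (induction n arbitrary: r)
  case 0
  show ?case
    using measurable_functional_compose[OF measurable_functional_leaf, of "\<lambda>S. S / r 0"] by simp
next
  case (Suc n)
  show ?case
    unfolding conductance.simps Let_def
    by (rule measurable_functional_compose[OF measurable_functional_integral[OF assms Suc],
          of "\<lambda>S. S / (1 + r 0 * S)"]) measurable
qed

lemma ref_range:
  assumes "m > 0" shows "0 \<le> ref F m n b" "ref F m n b \<le> 1"
proof -
  have "0 \<le> ref F m n b \<and> ref F m n b \<le> 1"
  proof (induction n arbitrary: b)
    case (Suc n)
    have "0 \<le> (\<integral>x. ref F m n (sec b x) \<partial>F)" using Suc by (simp add: integral_nonneg)
    then show ?case using assms by (simp add: Let_def divide_simps add_pos_nonneg)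
  qed auto
  then show "0 \<le> ref F m n b" "ref F m n b \<le> 1" by auto
qed

lemma conductance_range:
  assumes "\<And>k. r k > 0" shows "0 \<le> conductance F n r b" "conductance F n r b \<le> 1 / r 0"
proof -
  have "0 \<le> conductance F n r b \<and> conductance F n r b \<le> 1 / r 0"
    using assms
  proof (induction n arbitrary: r b)
    case 0
    then show ?case by (auto simp: less_imp_le)
  next
    case (Suc n)
    have "0 \<le> (\<integral>x. conductance F n (\<lambda>k. r (Suc k)) (sec b x) \<partial>F)"
      using Suc by (simp add: integral_nonneg)
    then have "0 < 1 + r 0 * (\<integral>x. conductance F n (\<lambda>k. r (Suc k)) (sec b x) \<partial>F)"
      using Suc.prems[of 0] by (intro add_pos_nonneg mult_nonneg_nonneg) auto
    then show ?case 
      using \<open>0 \<le> (\<integral>x. _ x \<partial>F)\<close> Suc.prems[of 0] by (auto simp add: Let_def field_simps)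
  qed
  then show "0 \<le> conductance F n r b" "conductance F n r b \<le> 1 / r 0" by auto
qed

lemma conductance_integral:
  assumes "real_distribution F" "\<And>k. r k > 0" "Measurable.pred seqs b"
  shows "integrable F (\<lambda>x. conductance F n r (sec b x))"
    and "0 \<le> (\<integral>x. conductance F n r (sec b x) \<partial>F)"
  using integrable_functional[OF assms(1) measurable_functional_conductance[OF assms(1)] assms(3)
      conductance_range[OF assms(2)]] conductance_range(1)[where r = r, OF assms(2)]
  by (auto simp: integral_nonneg)

lemma sum_square_over:
  fixes a b w w' :: real
  assumes "a > 0" "b > 0"
  shows "(w + w')\<^sup>2 / (a + b) \<le> w\<^sup>2 / a + w'\<^sup>2 / b"
proof -
  have "w\<^sup>2 / a + w'\<^sup>2 / b - (w + w')\<^sup>2 / (a + b) = (b * w - a * w')\<^sup>2 / (a * b * (a + b))"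
    using assms by (simp add: divide_simps) (simp add: power2_eq_square algebra_simps)
  also have "\<dots> \<ge> 0" using assms by simp
  finally show ?thesis by simp
qed

text \<open>The hypothesis says that \<open>P\<close> is at most the series conductance \<open>p q / (p + q)\<close>.\<close>

lemma series_step:
  fixes P p q r r' w w' :: real
  assumes "0 \<le> P" "0 \<le> p" "0 \<le> q" "r > 0" "r' > 0" "0 \<le> w" "0 \<le> w'"
    and le: "\<And>w w'. 0 \<le> w \<Longrightarrow> 0 \<le> w' \<Longrightarrow> (w + w')\<^sup>2 * P \<le> w\<^sup>2 * p + w'\<^sup>2 * q"
  shows "(w + w')\<^sup>2 * (P / (1 + (r + r') * P)) \<le> w\<^sup>2 * (p / (1 + r * p)) + w'\<^sup>2 * (q / (1 + r' * q))"
proof (cases "p = 0 \<or> q = 0")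
  case True
  then have "P = 0" using le[of 1 0] le[of 0 1] assms by auto
  then show ?thesis using assms by simp
next
  case False
  then have pq: "p > 0" "q > 0" using assms by auto
  \<comment> \<open>For a given sum of weights, the choice \<open>q\<close>, \<open>p\<close>
    minimizes the right side of the hypothesis.\<close>
  have "(p + q)\<^sup>2 * P \<le> (p + q) * (p * q)"
    using le[of q p] pq by (simp add: power2_eq_square algebra_simps)
  then have P: "(p + q) * P \<le> p * q" using pq by (simp add: power2_eq_square mult.assoc)
  \<comment> \<open>\<open>a\<close> and \<open>b\<close> are the resistances
    \<open>r + 1 / p\<close> and \<open>r' + 1 / q\<close> of the two networks after the new edge
    has been added.\<close>
  define a where "a = (1 + r * p) / p"
  define b where "b = (1 + r' * q) / q"
  have ab: "a > 0" "b > 0" using pq assms by (auto simp: a_def b_def intro!: divide_pos_pos add_pos_pos)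
  have "P * (a + b) = ((p + q) * P) / (p * q) + (r + r') * P"
    using pq by (simp add: a_def b_def field_simps)
  also have "\<dots> \<le> 1 + (r + r') * P" using P pq by simp
  finally have "P / (1 + (r + r') * P) \<le> 1 / (a + b)"
    using ab assms by (simp add: divide_simps add_pos_nonneg)
  then have "(w + w')\<^sup>2 * (P / (1 + (r + r') * P)) \<le> (w + w')\<^sup>2 * (1 / (a + b))"
    by (rule mult_left_mono) simp
  also have "\<dots> \<le> w\<^sup>2 / a + w'\<^sup>2 / b" using sum_square_over[OF ab] by simp
  finally show ?thesis by (simp add: a_def b_def)
qed

text \<open>With optimal weights this says that the effective resistance for \<open>r + r'\<close>
  is at least the sum of those for \<open>r\<close> and \<open>r'\<close>. For fixed weights the
  inequality is linear in the conductances, so integration over the first label preserves it, and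
  \<open>series_step\<close> adds the root edge.\<close>

lemma conductance_superadditive:
  assumes F: "real_distribution F" and "\<And>k. r k > 0" "\<And>k. r' k > 0" "Measurable.pred seqs b" "0 \<le> w" "0 \<le> w'"
  shows "(w + w')\<^sup>2 * conductance F n (\<lambda>k. r k + r' k) b \<le> w\<^sup>2 * conductance F n r b + w'\<^sup>2 * conductance F n r' b"
  using assms(2-)
proof (induction n arbitrary: r r' b w w')
  case 0
  then show ?case using sum_square_over[of "r 0" "r' 0" w w'] by simp
next
  case (Suc n)
  note [measurable] = Suc.prems(3)
  let ?c = "\<lambda>r x. conductance F n (\<lambda>k. r (Suc k)) (sec b x)"
  have int: "integrable F (?c r)" "integrable F (?c r')" "integrable F (?c (\<lambda>k. r k + r' k))"
    using Suc.prems by (auto intro!: conductance_integral F add_pos_pos)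
  have pos: "0 \<le> integral\<^sup>L F (?c r)" "0 \<le> integral\<^sup>L F (?c r')" "0 \<le> integral\<^sup>L F (?c (\<lambda>k. r k + r' k))"
    using Suc.prems by (auto intro!: conductance_integral F add_pos_pos)
  have "(u + u')\<^sup>2 * integral\<^sup>L F (?c (\<lambda>k. r k + r' k)) \<le> u\<^sup>2 * integral\<^sup>L F (?c r) + u'\<^sup>2 * integral\<^sup>L F (?c r')"
    if "0 \<le> u" "0 \<le> u'" for u u'
  proof -
    have "(\<integral>x. (u + u')\<^sup>2 * ?c (\<lambda>k. r k + r' k) x \<partial>F) \<le> (\<integral>x. u\<^sup>2 * ?c r x + u'\<^sup>2 * ?c r' x \<partial>F)"
      using that Suc.prems int
      by (intro integral_mono integrable_add integrable_mult_right Suc.IH) auto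
    then show ?thesis using int by simp
  qed
  from series_step[OF pos(3,1,2) Suc.prems(1,2,4,5) this, of 0 0]
  show ?case by (simp add: Let_def)
qed

lemma conductance_sum_superadditive:
  assumes F: "real_distribution F" and "finite I" "I \<noteq> {}" "\<And>i k. i \<in> I \<Longrightarrow> r i k > 0"
    "Measurable.pred seqs b" "\<And>i. i \<in> I \<Longrightarrow> 0 \<le> w i"
  shows "(\<Sum>i\<in>I. w i)\<^sup>2 * conductance F n (\<lambda>k. \<Sum>i\<in>I. r i k) b \<le> (\<Sum>i\<in>I. (w i)\<^sup>2 * conductance F n (r i) b)"
  using assms(2-)
proof (induction rule: finite_ne_induct)
  case (insert i I)
  have "(\<Sum>j\<in>insert i I. w j)\<^sup>2 * conductance F n (\<lambda>k. \<Sum>j\<in>insert i I. r j k) b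
     = (w i + (\<Sum>j\<in>I. w j))\<^sup>2 * conductance F n (\<lambda>k. r i k + (\<Sum>j\<in>I. r j k)) b"
    using insert by simp
  also have "\<dots> \<le> (w i)\<^sup>2 * conductance F n (r i) b + (\<Sum>j\<in>I. w j)\<^sup>2 * conductance F n (\<lambda>k. \<Sum>j\<in>I. r j k) b"
    using insert by (intro conductance_superadditive F sum_pos sum_nonneg) auto
  also have "\<dots> \<le> (\<Sum>j\<in>insert i I. (w j)\<^sup>2 * conductance F n (r j) b)"
    using insert by simp
  finally show ?case .
qed simp

text \<open>Rayleigh monotonicity against the network with resistances
  \<open>\<beta> / m ^ k\<close>, whose conductance is \<open>ref\<close> divided by
  \<open>\<beta>\<close>. The induction runs over all \<beta> because passing to the next level
  turns \<beta> into \<open>\<beta> / m\<close>.\<close>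

lemma ref_le_conductance:
  assumes F: "real_distribution F" and "m > 0" "\<And>k. r k > 0" "Measurable.pred seqs b"
    and "\<And>k. k \<le> n \<Longrightarrow> r k \<le> \<beta> / m ^ k"
  shows "ref F m n b \<le> \<beta> * conductance F n r b"
  using assms(3-)
proof (induction n arbitrary: r b \<beta>)
  case 0
  then show ?case by (simp add: divide_simps)
next
  case (Suc n)
  note [measurable] = Suc.prems(2)
  define P where "P = (\<integral>x. ref F m n (sec b x) \<partial>F)"
  define Q where "Q = (\<integral>x. conductance F n (\<lambda>k. r (Suc k)) (sec b x) \<partial>F)"
  have \<beta>: "0 < r 0" "r 0 \<le> \<beta>" using Suc.prems(1)[of 0] Suc.prems(3)[of 0] by auto
  have Q0: "0 \<le> Q" unfolding Q_def by (intro conductance_integral F Suc.prems)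
  have P0: "0 \<le> P" unfolding P_def using ref_range[OF \<open>m > 0\<close>] by (simp add: integral_nonneg)
  have "P \<le> (\<integral>x. \<beta> / m * conductance F n (\<lambda>k. r (Suc k)) (sec b x) \<partial>F)"
    unfolding P_def
  proof (intro integral_mono integrable_mult_right conductance_integral F Suc.IH)
    show "integrable F (\<lambda>x. ref F m n (sec b x))"
      using ref_range[OF \<open>m > 0\<close>] F Suc.prems(2)
      by (intro integrable_functional[where K = 1] measurable_functional_ref) auto
    show "r (Suc k) \<le> \<beta> / m / m ^ k" if "k \<le> n" for k
      using Suc.prems(3)[of "Suc k"] that by simp
  qed (use Suc.prems in auto)
  also have "\<dots> = \<beta> / m * Q" by (simp add: Q_def)
  finally have "m * P \<le> \<beta> * Q" using \<open>m > 0\<close> by (simp add: field_simps)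
  have "ref F m (Suc n) b = m * P / (1 + m * P)" by (simp add: Let_def P_def)
  also have "\<dots> \<le> \<beta> * Q / (1 + \<beta> * Q)"
  proof -
    have "0 \<le> m * P" using P0 \<open>m > 0\<close> by simp
    with \<open>m * P \<le> \<beta> * Q\<close> show ?thesis
      by (simp add: divide_simps add_pos_nonneg) (simp add: algebra_simps)
  qed
  also have "\<dots> \<le> \<beta> * Q / (1 + r 0 * Q)"
    using Q0 \<beta> by (intro divide_left_mono add_left_mono mult_right_mono mult_pos_pos add_pos_nonneg mult_nonneg_nonneg) auto
  finally show ?case by (simp add: Let_def Q_def)
qed

section \<open>Avoidance functionals\<close>

text \<open>\<open>avoid F n z\<close> plays the role of the probability that a spherically symmetric forest with
  generation sizes \<open>z 0, \<dots>, z (n - 1)\<close> has no path in the target, for generation sizes that need not be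
  integers. The quotient \<open>z 1 / z 0\<close> of the tree recursion is absorbed in the exponent.\<close>

primrec avoid :: "real measure \<Rightarrow> nat \<Rightarrow> (nat \<Rightarrow> real) \<Rightarrow> ((nat \<Rightarrow> real) \<Rightarrow> bool) \<Rightarrow> real" where
  "avoid F 0 = (\<lambda>z b. 1 - of_bool (b (\<lambda>_. 0)))"
| "avoid F (Suc n) =
     (\<lambda>z b. (\<integral>x. avoid F n (\<lambda>k. z (Suc k)) (sec b x) powr (1 / z 0) \<partial>F) powr z 0)"

lemma measurable_functional_avoid:
  assumes "real_distribution F" shows "measurable_functional (avoid F n z)"
proof (induction n arbitrary: z)
  case 0
  show ?case
    using measurable_functional_compose[OF measurable_functional_leaf, of "\<lambda>S. 1 - S"] by simp
next
  case (Suc n)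
  have "measurable_functional (\<lambda>b. avoid F n (\<lambda>k. z (Suc k)) b powr (1 / z 0))"
    by (rule measurable_functional_compose[OF Suc, of "\<lambda>u. u powr (1 / z 0)"]) measurable
  from measurable_functional_compose[OF measurable_functional_integral[OF assms this], of "\<lambda>u. u powr z 0"]
  show ?case by simp
qed

lemma powr_le_one_real: "0 \<le> (u :: real) \<Longrightarrow> u \<le> 1 \<Longrightarrow> 0 \<le> a \<Longrightarrow> u powr a \<le> 1"
  using powr_mono2[of a u 1] by simp

lemma avoid_range:
  assumes F: "real_distribution F" and "\<And>k. z k > 0" "Measurable.pred seqs b"
  shows "0 \<le> avoid F n z b" "avoid F n z b \<le> 1"
proof -
  have "0 \<le> avoid F n z b \<and> avoid F n z b \<le> 1"
    using assms(2-)
  proof (induction n arbitrary: z b)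
    case (Suc n)
    note [measurable] = Suc.prems(2)
    have mf: "measurable_functional (\<lambda>b. avoid F n (\<lambda>k. z (Suc k)) b powr (1 / z 0))"
      by (rule measurable_functional_compose[OF measurable_functional_avoid[OF F], of "\<lambda>u. u powr (1 / z 0)"]) measurable
    have "0 \<le> avoid F n (\<lambda>k. z (Suc k)) (sec b x) \<and> avoid F n (\<lambda>k. z (Suc k)) (sec b x) \<le> 1" for x
      using Suc by simp
    then have "avoid F n (\<lambda>k. z (Suc k)) (sec b x) powr (1 / z 0) \<le> 1" for x
      using Suc.prems(1)[of 0] by (intro powr_le_one_real) auto
    then have "(\<integral>x. avoid F n (\<lambda>k. z (Suc k)) (sec b x) powr (1 / z 0) \<partial>F) \<le> 1"
      using integral_functional_range(2)[OF F mf Suc.prems(2)] by simp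
    then show ?case
      using Suc.prems(1)[of 0] by (auto intro!: powr_le_one_real simp: integral_nonneg)
  qed auto
  then show "0 \<le> avoid F n z b" "avoid F n z b \<le> 1" by auto
qed

lemma powr_mult_le_weighted_sum:
  fixes a b \<theta> :: real
  assumes "0 \<le> a" "0 \<le> b" "0 < \<theta>" "\<theta> < 1"
  shows "a powr \<theta> * b powr (1 - \<theta>) \<le> \<theta> * a + (1 - \<theta>) * b"
proof (cases "a = 0 \<or> b = 0")
  case False
  then show ?thesis using assms by (intro Youngs_inequality_0) auto
qed (use assms in auto)

lemma (in prob_space) Hoelder_powr:
  fixes f g :: "'a \<Rightarrow> real"
  assumes [measurable]: "f \<in> borel_measurable M" "g \<in> borel_measurable M"
    and f: "\<And>x. 0 \<le> f x" "\<And>x. f x \<le> 1" and g: "\<And>x. 0 \<le> g x" "\<And>x. g x \<le> 1"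
    and \<theta>: "0 < \<theta>" "\<theta> < 1"
  shows "(\<integral>x. f x powr \<theta> * g x powr (1 - \<theta>) \<partial>M) \<le> (\<integral>x. f x \<partial>M) powr \<theta> * (\<integral>x. g x \<partial>M) powr (1 - \<theta>)"
    (is "?L \<le> ?I powr _ * ?J powr _")
proof -
  have int: "integrable M f" "integrable M g"
    using f g by (auto intro!: integrable_const_bound[where B = 1])
  have nn: "0 \<le> ?I" "0 \<le> ?J" using f g by (auto intro!: integral_nonneg)
  have "integrable M (\<lambda>x. f x powr \<theta> * g x powr (1 - \<theta>))"
    using f g \<theta> by (intro integrable_const_bound[where B = 1])
      (auto intro!: AE_I2 mult_le_one powr_le_one_real simp: abs_mult)
  note int = int this
  show ?thesis
  \<comment> \<open>The main case normalizes by both integrals. If one of them vanishes, that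
    function is zero almost everywhere, and so is the product because \<open>0 powr \<theta>\<close>
    is 0.\<close>
  proof (cases "?I = 0 \<or> ?J = 0")
    case True
    then have "(AE x in M. f x = 0) \<or> (AE x in M. g x = 0)"
      using int f g integral_nonneg_eq_0_iff_AE by blast
    then have "AE x in M. f x powr \<theta> * g x powr (1 - \<theta>) = 0" by auto
    then have "?L = 0" by (rule integral_eq_zero_AE)
    then show ?thesis by simp
  next
    case False
    then have pos: "?I > 0" "?J > 0" using nn by auto
    have le: "f x powr \<theta> * g x powr (1 - \<theta>) \<le> ?I powr \<theta> * ?J powr (1 - \<theta>) * (\<theta> / ?I * f x + (1 - \<theta>) / ?J * g x)" for x
    proof -
      have "f x powr \<theta> * g x powr (1 - \<theta>) = ?I powr \<theta> * ?J powr (1 - \<theta>) * ((f x / ?I) powr \<theta> * (g x / ?J) powr (1 - \<theta>))"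
        using pos f g by (simp add: powr_divide)
      also have "\<dots> \<le> ?I powr \<theta> * ?J powr (1 - \<theta>) * (\<theta> * (f x / ?I) + (1 - \<theta>) * (g x / ?J))"
        using pos f g \<theta> by (intro mult_left_mono powr_mult_le_weighted_sum) auto
      finally show ?thesis by simp
    qed
    have "?L \<le> (\<integral>x. ?I powr \<theta> * ?J powr (1 - \<theta>) * (\<theta> / ?I * f x + (1 - \<theta>) / ?J * g x) \<partial>M)"
      using int le by (intro integral_mono) auto
    also have "\<dots> = ?I powr \<theta> * ?J powr (1 - \<theta>)"
      using int pos by simp
    finally show ?thesis .
  qed
qed

text \<open>Merging two independent forests into one symmetric forest can only lower the chance of
  avoiding the target. With \<open>s = z 0 + z' 0\<close>, the root \<open>1 / s\<close> of a
  product is a geometric mean, with weights \<open>z 0 / s\<close> and \<open>z' 0 / s\<close>, of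
  the roots belonging to the two forests; Hoelder's inequality separates them under the integral,
  and the power \<open>s\<close> restores the outer exponents.\<close>

lemma avoid_submultiplicative:
  assumes F: "real_distribution F" and "\<And>k. z k > 0" "\<And>k. z' k > 0" "Measurable.pred seqs b"
  shows "avoid F n (\<lambda>k. z k + z' k) b \<le> avoid F n z b * avoid F n z' b"
  using assms(2-)
proof (induction n arbitrary: z z' b)
  case (Suc n)
  interpret real_distribution F by fact
  note [measurable] = Suc.prems(3)
  let ?u = "\<lambda>z x. avoid F n (\<lambda>k. z (Suc k)) (sec b x)"
  define s where "s = z 0 + z' 0"
  have z0: "z 0 > 0" "z' 0 > 0" "s > 0" using Suc.prems(1,2)[of 0] by (auto simp: s_def)
  have r: "0 \<le> ?u z x" "?u z x \<le> 1" "0 \<le> ?u z' x" "?u z' x \<le> 1" for x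
    using Suc.prems by (auto intro!: avoid_range F)
  have [measurable]: "?u z \<in> borel_measurable F" for z
    using measurable_functional_sec[OF measurable_functional_avoid[OF F] Suc.prems(3)] by simp
  have \<theta>: "0 < z 0 / s" "z 0 / s < 1" "1 - z 0 / s = z' 0 / s"
    using z0 by (auto simp: s_def field_simps)
  have "(\<integral>x. ?u (\<lambda>k. z k + z' k) x powr (1 / s) \<partial>F)
      \<le> (\<integral>x. (?u z x powr (1 / z 0)) powr (z 0 / s) * (?u z' x powr (1 / z' 0)) powr (1 - z 0 / s) \<partial>F)"
  proof (rule integral_mono)
    show "integrable F (\<lambda>x. ?u (\<lambda>k. z k + z' k) x powr (1 / s))"
      using Suc.prems(1,2) z0
      by (intro integrable_const_bound[where B = 1] AE_I2)
        (auto intro!: powr_le_one_real avoid_range F add_pos_pos)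
    show "integrable F (\<lambda>x. (?u z x powr (1 / z 0)) powr (z 0 / s) * (?u z' x powr (1 / z' 0)) powr (1 - z 0 / s))"
      using r z0 \<theta> by (intro integrable_const_bound[where B = 1] AE_I2)
        (auto simp: abs_mult intro!: powr_le_one_real mult_le_one)
    fix x
    have "?u (\<lambda>k. z k + z' k) x powr (1 / s) \<le> (?u z x * ?u z' x) powr (1 / s)"
      using Suc.prems z0 by (intro powr_mono2 Suc.IH avoid_range F) (auto intro!: add_pos_pos)
    also have "\<dots> = (?u z x powr (1 / z 0)) powr (z 0 / s) * (?u z' x powr (1 / z' 0)) powr (1 - z 0 / s)"
      unfolding \<theta>(3) using r z0 by (simp add: powr_mult powr_powr)
    finally show "?u (\<lambda>k. z k + z' k) x powr (1 / s) \<le> \<dots>" .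
  qed
  also have "\<dots> \<le> (\<integral>x. ?u z x powr (1 / z 0) \<partial>F) powr (z 0 / s) * (\<integral>x. ?u z' x powr (1 / z' 0) \<partial>F) powr (1 - z 0 / s)"
    using r z0 \<theta> by (intro Hoelder_powr) (auto intro!: powr_le_one_real)
  finally have "(\<integral>x. ?u (\<lambda>k. z k + z' k) x powr (1 / s) \<partial>F) powr s
     \<le> ((\<integral>x. ?u z x powr (1 / z 0) \<partial>F) powr (z 0 / s) * (\<integral>x. ?u z' x powr (1 / z' 0) \<partial>F) powr (1 - z 0 / s)) powr s"
    using z0 by (intro powr_mono2 integral_nonneg) auto
  also have "\<dots> = (\<integral>x. ?u z x powr (1 / z 0) \<partial>F) powr z 0 * (\<integral>x. ?u z' x powr (1 / z' 0) \<partial>F) powr z' 0"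
    unfolding \<theta>(3) using z0 by (simp add: powr_mult powr_powr integral_nonneg)
  finally show ?case by (simp add: s_def)
qed auto

text \<open>The extra summand \<open>y\<close> anchors the induction at the empty index set. In
  \<open>avoid_le_not_hit\<close> it takes up the excess of the given sizes over those of the
  tree.\<close>

lemma avoid_sum_submultiplicative:
  assumes F: "real_distribution F" and "finite I" "\<And>k. y k > 0" "\<And>i k. i \<in> I \<Longrightarrow> z i k > 0" "Measurable.pred seqs b"
  shows "avoid F n (\<lambda>k. y k + (\<Sum>i\<in>I. z i k)) b \<le> avoid F n y b * (\<Prod>i\<in>I. avoid F n (z i) b)"
  using assms(2,4)
proof (induction rule: finite_induct)
  case (insert i I)
  have "avoid F n (\<lambda>k. y k + (\<Sum>j\<in>insert i I. z j k)) b = avoid F n (\<lambda>k. z i k + (y k + (\<Sum>j\<in>I. z j k))) b"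
    using insert by (simp add: ac_simps)
  also have "\<dots> \<le> avoid F n (z i) b * avoid F n (\<lambda>k. y k + (\<Sum>j\<in>I. z j k)) b"
    using insert.prems assms by (intro avoid_submultiplicative F add_pos_nonneg sum_nonneg) (auto intro: less_imp_le)
  also have "\<dots> \<le> avoid F n (z i) b * (avoid F n y b * (\<Prod>i\<in>I. avoid F n (z i) b))"
    using insert.prems assms by (intro mult_left_mono insert.IH avoid_range F) auto
  finally show ?case using insert by (simp add: ac_simps)
qed simp

text \<open>Multiplying all sizes by \<open>c\<close> amounts to \<open>c\<close> independent copies
  of the forest, also for fractional \<open>c\<close>: the factor cancels in the inner exponent and
  survives only in the outer one.\<close>

lemma avoid_scale:
  assumes F: "real_distribution F" and "\<And>k. z k > 0" "Measurable.pred seqs b" and c: "c > 0"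
  shows "avoid F n (\<lambda>k. c * z k) b = avoid F n z b powr c"
  using assms(2,3)
proof (induction n arbitrary: z b)
  case (Suc n)
  have "avoid F n (\<lambda>k. c * z (Suc k)) (sec b x) powr (1 / (c * z 0)) = avoid F n (\<lambda>k. z (Suc k)) (sec b x) powr (1 / z 0)" for x
    using Suc c Suc.prems(1)[of 0] by (simp add: powr_powr)
  then show ?case using c by (simp add: powr_powr mult.commute)
qed auto

section \<open>Bernoulli inequalities and the comparison of avoidance with the reference
  functional\<close>

lemma Bernoulli_powr_le:
  fixes u \<beta> :: real
  assumes "0 \<le> u" "u \<le> 1" "0 < \<beta>" "\<beta> < 1"
  shows "(1 - u) powr \<beta> \<le> 1 - \<beta> * u"
  using powr_mult_le_weighted_sum[of "1 - u" 1 \<beta>] assms by (simp add: algebra_simps)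

lemma Bernoulli_powr_ge:
  fixes u \<beta> :: real
  assumes u: "0 \<le> u" "u \<le> 1" and \<beta>: "1 \<le> \<beta>"
  shows "1 - \<beta> * u \<le> (1 - u) powr \<beta>"
proof (cases "\<beta> = 1 \<or> 1 - \<beta> * u \<le> 0")
  case True
  then show ?thesis
  proof
    assume "1 - \<beta> * u \<le> 0"
    also have "0 \<le> (1 - u) powr \<beta>" by simp
    finally show ?thesis .
  qed (use u in simp)
next
  case False
  then have "(1 - \<beta> * u) powr (1 / \<beta>) \<le> 1 - u"
    using Bernoulli_powr_le[of "\<beta> * u" "1 / \<beta>"] u \<beta> by auto
  then have "((1 - \<beta> * u) powr (1 / \<beta>)) powr \<beta> \<le> (1 - u) powr \<beta>"
    using \<beta> by (intro powr_mono2) auto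
  then show ?thesis using False \<beta> by (simp add: powr_powr)
qed

lemma divide_le_divideI:
  fixes x y d e :: real
  assumes "0 < d" "0 < e" "x * e \<le> y * d"
  shows "x / d \<le> y / e"
  using assms by (simp add: divide_simps)

text \<open>The second-order bound separates offspring means above 1 from the critical case: the denominator
  is the resistance contributed by branching.\<close>

lemma one_minus_powr_le:
  fixes m :: real
  assumes m: "m > 1"
  obtains a where "a > 0" "\<And>s. 0 \<le> s \<Longrightarrow> s \<le> 1 \<Longrightarrow> 1 - (1 - s) powr m \<le> m * s / (1 + a * s)"
proof (cases "m \<ge> 2")
  case True
  show ?thesis
  proof (rule that)
    show "(m - 1) / m > 0" using m by simp
    fix s :: real assume s: "0 \<le> s" "s \<le> 1"
    have "(1 - s) * (1 - (m - 1) * s) \<le> (1 - s) * (1 - s) powr (m - 1)"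
      using s True by (intro mult_left_mono Bernoulli_powr_ge) auto
    also have "\<dots> = (1 - s) powr m"
      using s by (cases "s = 1") (auto simp: powr_mult_base)
    finally have "1 - (1 - s) powr m \<le> m * s - (m - 1) * s\<^sup>2"
      by (simp add: power2_eq_square algebra_simps)
    also have "\<dots> = m * s * (1 - (m - 1) / m * s)" using m by (simp add: power2_eq_square field_simps)
    also have "\<dots> \<le> m * s * (1 / (1 + (m - 1) / m * s))"
    proof (intro mult_left_mono)
      let ?a = "(m - 1) / m * s"
      have "0 \<le> ?a" using s m by simp
      have "(1 - ?a) * (1 + ?a) = 1 - ?a\<^sup>2" by (simp only: power2_eq_square) algebra
      then have "(1 - ?a) * (1 + ?a) \<le> 1" by simp
      then show "1 - ?a \<le> 1 / (1 + ?a)" using \<open>0 \<le> ?a\<close> by (simp add: pos_le_divide_eq)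
    qed (use s m in auto)
    finally show "1 - (1 - s) powr m \<le> m * s / (1 + (m - 1) / m * s)" by simp
  qed
next
  case False
  show ?thesis
  proof (rule that)
    \<comment> \<open>Here \<open>2 - m\<close> lies strictly between 0 and 1, so the concave
      Bernoulli inequality applies to that exponent. The constant makes the terms linear in
      \<open>s\<close> agree in the last estimate.\<close>
    show "(m - 1)\<^sup>2 / m > 0" using m by simp
    fix s :: real assume s: "0 \<le> s" "s \<le> 1"
    let ?a = "(m - 1)\<^sup>2 / m"
    have d: "1 - (2 - m) * s > 0"
    proof -
      have "(2 - m) * s \<le> (2 - m) * 1" using s False by (intro mult_left_mono) auto
      then show ?thesis using m by simp
    qed
    have a: "?a * s \<ge> 0" using m s by simp
    have "(1 - s)\<^sup>2 \<le> (1 - s) powr m * (1 - (2 - m) * s)"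
    proof (cases "s = 1")
      case False
      have "(1 - s)\<^sup>2 = (1 - s) powr m * (1 - s) powr (2 - m)"
        using s False by (simp flip: powr_add powr_numeral)
      also have "\<dots> \<le> (1 - s) powr m * (1 - (2 - m) * s)"
        using s \<open>\<not> m \<ge> 2\<close> m by (intro mult_left_mono Bernoulli_powr_le) auto
      finally show ?thesis .
    qed simp
    then have "(1 - (1 - s) powr m) * (1 - (2 - m) * s) \<le> m * s - s\<^sup>2"
      by (simp add: power2_eq_square algebra_simps)
    then have "1 - (1 - s) powr m \<le> (m * s - s\<^sup>2) / (1 - (2 - m) * s)"
      using d by (simp add: pos_le_divide_eq)
    also have "\<dots> \<le> m * s / (1 + ?a * s)"
    proof -
      have "(m - s) * (1 + ?a * s) = m - s + (m - 1)\<^sup>2 * s - ?a * s\<^sup>2"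
        using m by (simp add: field_simps power2_eq_square)
      also have "\<dots> \<le> m - s + (m - 1)\<^sup>2 * s" using m by simp
      also have "\<dots> = m * (1 - (2 - m) * s)" by (simp add: power2_eq_square algebra_simps)
      finally have "s * ((m - s) * (1 + ?a * s)) \<le> s * (m * (1 - (2 - m) * s))"
        using s by (intro mult_left_mono)
      then have "(m * s - s\<^sup>2) * (1 + ?a * s) \<le> m * s * (1 - (2 - m) * s)"
        by (simp add: power2_eq_square algebra_simps)
      then show ?thesis using d a by (intro divide_le_divideI add_pos_nonneg) auto
    qed
    finally show "1 - (1 - s) powr m \<le> m * s / (1 + ?a * s)" .
  qed
qed

text \<open>For sizes \<open>m ^ Suc k\<close> a shift is a scaling by \<open>m\<close>, so by
  \<open>avoid_scale\<close> the exponents combine and one level acts as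
  \<open>1 - (1 - s) powr m\<close> on the averaged hitting probability \<open>s\<close>. The bound
  of \<open>one_minus_powr_le\<close> has the shape of the step of \<open>ref\<close>, with
  \<open>a\<close> in place of \<open>m\<close> in the denominator.\<close>

lemma one_minus_avoid_le_ref:
  assumes m: "m > 1"
  obtains K where "K \<ge> 1"
    "\<And>F n b. real_distribution F \<Longrightarrow> Measurable.pred seqs b \<Longrightarrow> 1 - avoid F n (\<lambda>k. m ^ Suc k) b \<le> K * ref F m n b"
proof -
  obtain a where a: "a > 0" and le: "\<And>s. 0 \<le> s \<Longrightarrow> s \<le> 1 \<Longrightarrow> 1 - (1 - s) powr m \<le> m * s / (1 + a * s)"
    using one_minus_powr_le[OF m] by blast
  \<comment> \<open>\<open>K \<ge> 1\<close> serves level 0. \<open>a * K \<ge> m\<close> makes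
    \<open>1 + a * (K * S)\<close> at least \<open>1 + m * S\<close>, so that the same
    \<open>K\<close> comes out of each step.\<close>
  define K where "K = max 1 (m / a)"
  have K: "K \<ge> 1" "m \<le> a * K"
  proof -
    have "a * (m / a) \<le> a * K" using a by (intro mult_left_mono) (auto simp: K_def)
    then show "m \<le> a * K" using a by simp
  qed (simp add: K_def)
  show ?thesis
  proof (rule that[OF K(1)])
    fix F n b assume F: "real_distribution F" and b: "Measurable.pred seqs b"
    from b show "1 - avoid F n (\<lambda>k. m ^ Suc k) b \<le> K * ref F m n b"
    proof (induction n arbitrary: b)
      case 0 then show ?case using K by simp
    next
      case (Suc n)
      note [measurable] = Suc.prems
      interpret real_distribution F by fact
      define V where "V x = avoid F n (\<lambda>k. m ^ Suc k) (sec b x)" for x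
      have V: "0 \<le> V x" "V x \<le> 1" for x
        unfolding V_def using m by (auto intro!: avoid_range F)
      have [measurable]: "V \<in> borel_measurable F"
        unfolding V_def using measurable_functional_sec[OF measurable_functional_avoid[OF F] Suc.prems] by simp
      have intV: "integrable F V" using V by (intro integrable_const_bound[where B = 1]) auto
      have "avoid F n (\<lambda>k. m ^ Suc (Suc k)) (sec b x) powr (1 / m) = V x" for x
        using avoid_scale[OF F, of "\<lambda>k. m ^ Suc k" "sec b x" m n] V[of x] m
        by (simp add: V_def powr_powr)
      then have "avoid F (Suc n) (\<lambda>k. m ^ Suc k) b = (\<integral>x. V x \<partial>F) powr m"
        by simp
      define s where "s = (\<integral>x. 1 - V x \<partial>F)"
      define S where "S = (\<integral>x. ref F m n (sec b x) \<partial>F)"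
      have s_eq: "s = 1 - (\<integral>x. V x \<partial>F)"
        unfolding s_def using intV prob_space by simp
      have s: "0 \<le> s" "s \<le> 1"
        using V by (auto simp: s_def intro!: integral_nonneg) (simp add: s_eq[unfolded s_def] integral_nonneg)
      have "s \<le> (\<integral>x. K * ref F m n (sec b x) \<partial>F)"
        unfolding s_def
      proof (intro integral_mono integrable_mult_right)
        show "integrable F (\<lambda>x. ref F m n (sec b x))"
          using ref_range[of m] m F Suc.prems
          by (intro integrable_functional[where K = 1] measurable_functional_ref) auto
        show "1 - V x \<le> K * ref F m n (sec b x)" for x
          unfolding V_def by (rule Suc.IH) simp
      qed (use intV in auto)
      then have sS: "s \<le> K * S" by (simp add: S_def)
      then have S: "0 \<le> S" using s K by (meson dual_order.trans le_cases mult_le_0_iff not_one_le_zero zero_le_mult_iff)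
      have "1 - avoid F (Suc n) (\<lambda>k. m ^ Suc k) b = 1 - (1 - s) powr m"
        by (simp only: \<open>avoid F (Suc n) _ b = _\<close> s_eq) simp
      also have "\<dots> \<le> m * s / (1 + a * s)" by (rule le[OF s])
      also have "\<dots> \<le> m * (K * S) / (1 + a * (K * S))"
      proof -
        have "m * s * (1 + a * (K * S)) \<le> m * (K * S) * (1 + a * s)"
          using sS m by (simp add: algebra_simps)
        then show ?thesis using s sS a by (simp add: divide_simps add_pos_nonneg)
      qed
      also have "\<dots> \<le> m * (K * S) / (1 + m * S)"
      proof (intro divide_left_mono)
        have "m * S \<le> a * K * S" using K S by (intro mult_right_mono) auto
        then show "1 + m * S \<le> 1 + a * (K * S)" by (simp add: mult.assoc)
      qed (use K S m a in \<open>auto intro!: mult_pos_pos add_pos_nonneg mult_nonneg_nonneg\<close>)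
      finally show ?case by (simp add: S_def Let_def mult_ac)
    qed
  qed
qed

section \<open>Deterministic trees\<close>

definition ch :: "nat list set \<Rightarrow> nat set" where
  "ch T = {i. [i] \<in> T}"

definition sub :: "nat list set \<Rightarrow> nat \<Rightarrow> nat list set" where
  "sub T i = {u. i # u \<in> T}"

text \<open>The class is closed under passing to the subtrees of children and keeps all generation
  sizes positive, hence the resistances built from them as well.\<close>

definition leafless_tree :: "nat list set \<Rightarrow> bool" where
  "leafless_tree T \<longleftrightarrow> [] \<in> T \<and> (\<forall>v i. v @ [i] \<in> T \<longrightarrow> v \<in> T) \<and> (\<forall>v. finite {i. v @ [i] \<in> T})
     \<and> (\<forall>v\<in>T. \<exists>i. v @ [i] \<in> T)"

lemma leafless_treeD:
  assumes "leafless_tree T"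
  shows "[] \<in> T" "v @ [i] \<in> T \<Longrightarrow> v \<in> T" "finite {i. v @ [i] \<in> T}" "v \<in> T \<Longrightarrow> \<exists>i. v @ [i] \<in> T"
  using assms unfolding leafless_tree_def by blast+

lemma leafless_tree_ch:
  assumes "leafless_tree T" shows "finite (ch T)" "ch T \<noteq> {}"
  using leafless_treeD(3)[OF assms, of "[]"] leafless_treeD(4)[OF assms leafless_treeD(1)[OF assms]]
  by (simp_all add: ch_def)

lemma leafless_tree_sub:
  assumes T: "leafless_tree T" and "i \<in> ch T" shows "leafless_tree (sub T i)"
  unfolding leafless_tree_def
proof (intro conjI allI impI ballI)
  show "[] \<in> sub T i" using assms by (simp add: sub_def ch_def)
  show "v \<in> sub T i" if "v @ [j] \<in> sub T i" for v j
    using that leafless_treeD(2)[OF T, of "i # v" j] by (simp add: sub_def)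
  show "finite {j. v @ [j] \<in> sub T i}" for v
    using leafless_treeD(3)[OF T, of "i # v"] by (simp add: sub_def)
  show "\<exists>j. v @ [j] \<in> sub T i" if "v \<in> sub T i" for v
    using that leafless_treeD(4)[OF T, of "i # v"] by (simp add: sub_def)
qed

primrec lsum :: "nat \<Rightarrow> (nat list set \<Rightarrow> real) \<Rightarrow> nat list set \<Rightarrow> real" where
  "lsum 0 g = g"
| "lsum (Suc k) g = (\<lambda>T. \<Sum>i\<in>ch T. lsum k g (sub T i))"

abbreviation gen_size :: "nat \<Rightarrow> nat list set \<Rightarrow> real" where
  "gen_size n \<equiv> lsum n (\<lambda>_. 1)"

text \<open>The flow that delivers one unit to each vertex of generation \<open>n\<close> carries
  through a vertex of generation \<open>k\<close> the number of its descendants in generation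
  \<open>n\<close>. The sum of the squares of these numbers is the energy in generation
  \<open>k\<close>, not normalized by the squared strength of the flow.\<close>

abbreviation flow_energy :: "nat \<Rightarrow> nat list set \<Rightarrow> nat \<Rightarrow> real" where
  "flow_energy n T k \<equiv> lsum k (\<lambda>T. (gen_size (n - k) T)\<^sup>2) T"

lemma lsum_pos:
  assumes g: "\<And>T. leafless_tree T \<Longrightarrow> g T > 0" and "leafless_tree T" shows "lsum k g T > 0"
  using assms(2)
proof (induction k arbitrary: T)
  case (Suc k)
  then show ?case by (simp add: sum_pos leafless_tree_ch leafless_tree_sub)
qed (simp add: g)

lemma gen_size_pos: "leafless_tree T \<Longrightarrow> gen_size n T > 0"
  by (rule lsum_pos) simp_all

lemma flow_energy_pos: "leafless_tree T \<Longrightarrow> flow_energy n T k > 0"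
  by (rule lsum_pos) (simp_all add: gen_size_pos less_imp_neq[OF gen_size_pos, symmetric])

text \<open>Defined by the recursion rather than as a measure, so that the comparisons only involve
  integrals over one label; \<open>prob_reach\<close> supplies the probabilistic meaning.\<close>

primrec hit :: "real measure \<Rightarrow> nat \<Rightarrow> nat list set \<Rightarrow> ((nat \<Rightarrow> real) \<Rightarrow> bool) \<Rightarrow> real" where
  "hit F 0 = (\<lambda>T b. of_bool (b (\<lambda>_. 0)))"
| "hit F (Suc n) = (\<lambda>T b. 1 - (\<Prod>i\<in>ch T. 1 - (\<integral>x. hit F n (sub T i) (sec b x) \<partial>F)))"

lemma measurable_functional_hit:
  assumes "real_distribution F" shows "measurable_functional (hit F n T)"
proof (induction n arbitrary: T)
  case (Suc n)
  have "measurable_functional (\<lambda>b. 1 - (\<integral>x. hit F n (sub T i) (sec b x) \<partial>F))" for i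
    by (rule measurable_functional_compose[OF measurable_functional_integral[OF assms Suc], of "\<lambda>u. 1 - u"]) measurable
  from measurable_functional_compose[OF measurable_functional_prod[OF this], of "\<lambda>u. 1 - u"]
  show ?case by simp
qed (simp add: measurable_functional_leaf)

lemma hit_range:
  assumes F: "real_distribution F" and "Measurable.pred seqs b"
  shows "0 \<le> hit F n T b" "hit F n T b \<le> 1"
proof -
  have "0 \<le> hit F n T b \<and> hit F n T b \<le> 1"
    using assms(2)
  proof (induction n arbitrary: T b)
    case (Suc n)
    have "0 \<le> (\<integral>x. hit F n (sub T i) (sec b x) \<partial>F) \<and> (\<integral>x. hit F n (sub T i) (sec b x) \<partial>F) \<le> 1" for i
      using Suc.IH[OF pred_sec[OF Suc.prems]]
        integral_functional_range[OF F measurable_functional_hit[OF F] Suc.prems, where K = 1] by blast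
    then show ?case by (auto intro!: prod_le_1 prod_nonneg)
  qed auto
  then show "0 \<le> hit F n T b" "hit F n T b \<le> 1" by auto
qed

lemma hit_integral:
  assumes F: "real_distribution F" and b: "Measurable.pred seqs b"
  shows "integrable F (\<lambda>x. hit F n T (sec b x))"
    and "0 \<le> (\<integral>x. hit F n T (sec b x) \<partial>F)" "(\<integral>x. hit F n T (sec b x) \<partial>F) \<le> 1"
  by (rule integrable_functional[OF F measurable_functional_hit[OF F] b hit_range[OF F pred_sec[OF b]]]
    integral_functional_range[OF F measurable_functional_hit[OF F] b hit_range[OF F pred_sec[OF b]]])+

lemma prod_one_minus_mult_le:
  fixes s :: "'i \<Rightarrow> real"
  assumes "finite I" "\<And>i. i \<in> I \<Longrightarrow> 0 \<le> s i \<and> s i \<le> 1"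
  shows "(\<Prod>i\<in>I. 1 - s i) * (1 + (\<Sum>i\<in>I. s i)) \<le> 1"
  using assms
proof (induction rule: finite_induct)
  case (insert i I)
  define P where "P = (\<Prod>i\<in>I. 1 - s i)"
  define S where "S = (\<Sum>i\<in>I. s i)"
  have P: "0 \<le> P" and S: "0 \<le> S" and s: "0 \<le> s i" "s i \<le> 1"
    using insert.prems by (auto simp: P_def S_def intro!: prod_nonneg sum_nonneg)
  have "(1 - s i) * (1 + (s i + S)) = 1 + S - s i * S - (s i)\<^sup>2"
    by (simp add: power2_eq_square algebra_simps)
  also have "\<dots> \<le> 1 + S" using mult_nonneg_nonneg[OF s(1) S] zero_le_power2[of "s i"] by linarith
  finally have "P * ((1 - s i) * (1 + (s i + S))) \<le> P * (1 + S)" using P by (intro mult_left_mono)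
  also have "\<dots> \<le> 1" using insert by (simp add: P_def S_def)
  finally show ?case using insert.hyps by (simp add: P_def S_def mult_ac)
qed simp

lemma ge_one_minus_prod:
  fixes s :: "'i \<Rightarrow> real"
  assumes "finite I" "\<And>i. i \<in> I \<Longrightarrow> 0 \<le> s i \<and> s i \<le> 1"
  shows "(\<Sum>i\<in>I. s i) / (1 + (\<Sum>i\<in>I. s i)) \<le> 1 - (\<Prod>i\<in>I. 1 - s i)"
proof -
  have "0 < 1 + (\<Sum>i\<in>I. s i)" using assms by (intro add_pos_nonneg sum_nonneg) auto
  moreover have "(\<Prod>i\<in>I. 1 - s i) * (1 + (\<Sum>i\<in>I. s i)) \<le> 1"
    by (rule prod_one_minus_mult_le[OF assms])
  ultimately have "(\<Sum>i\<in>I. s i) \<le> (1 - (\<Prod>i\<in>I. 1 - s i)) * (1 + (\<Sum>i\<in>I. s i))"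
    by (simp add: algebra_simps)
  with \<open>0 < _\<close> show ?thesis by (simp add: pos_divide_le_eq del: right_diff_distrib)
qed

lemma divide_one_plus_mono: "0 \<le> x \<Longrightarrow> x \<le> y \<Longrightarrow> x / (1 + x) \<le> y / (1 + y :: real)"
  by (rule divide_le_divideI) (auto simp: algebra_simps)

text \<open>The flow on the first \<open>n\<close> generations that is uniform on generation \<open>n\<close> is a test flow
  for the effective conductance.\<close>

lemma conductance_le_hit:
  assumes F: "real_distribution F" and "leafless_tree T" "Measurable.pred seqs b"
  shows "(gen_size n T)\<^sup>2 * conductance F n (flow_energy n T) b \<le> hit F n T b"
  using assms(2-)
proof (induction n arbitrary: T b)
  case (Suc n)
  note [measurable] = Suc.prems(2)
  note T = leafless_tree_ch[OF Suc.prems(1)] leafless_tree_sub[OF Suc.prems(1)]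
  define w where "w i = gen_size n (sub T i)" for i
  define c where "c i = (\<integral>x. conductance F n (flow_energy n (sub T i)) (sec b x) \<partial>F)" for i
  define c' where "c' = (\<integral>x. conductance F n (\<lambda>k. \<Sum>i\<in>ch T. flow_energy n (sub T i) k) (sec b x) \<partial>F)"
  define s where "s i = (\<integral>x. hit F n (sub T i) (sec b x) \<partial>F)" for i
  have int: "integrable F (\<lambda>x. conductance F n (flow_energy n (sub T i)) (sec b x))" if "i \<in> ch T" for i
    using that by (intro conductance_integral F Suc.prems flow_energy_pos T)
  have int': "integrable F (\<lambda>x. conductance F n (\<lambda>k. \<Sum>i\<in>ch T. flow_energy n (sub T i) k) (sec b x))"
    by (intro conductance_integral F Suc.prems flow_energy_pos T sum_pos)
  have c': "0 \<le> c'" unfolding c'_def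
    by (intro conductance_integral F Suc.prems flow_energy_pos T sum_pos)
  have s: "0 \<le> s i \<and> s i \<le> 1" for i
    unfolding s_def using hit_integral[OF F Suc.prems(2)] by blast
  let ?W = "\<Sum>i\<in>ch T. w i"
  \<comment> \<open>Superadditivity over the children, each weighted by the strength of its part of
    the flow. The resistances add up because the energy of the flow in a generation is the sum of
    its energies in the subtrees.\<close>
  have "?W\<^sup>2 * c' \<le> (\<Sum>i\<in>ch T. (w i)\<^sup>2 * c i)"
  proof -
    have "(\<integral>x. ?W\<^sup>2 * conductance F n (\<lambda>k. \<Sum>i\<in>ch T. flow_energy n (sub T i) k) (sec b x) \<partial>F)
       \<le> (\<integral>x. (\<Sum>i\<in>ch T. (w i)\<^sup>2 * conductance F n (flow_energy n (sub T i)) (sec b x)) \<partial>F)"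
      using int int' T gen_size_pos[THEN less_imp_le]
      by (intro integral_mono integrable_sum integrable_mult_right conductance_sum_superadditive F flow_energy_pos)
        (auto simp: w_def)
    then show ?thesis using int by (simp add: c_def c'_def)
  qed
  also have "\<dots> \<le> (\<Sum>i\<in>ch T. s i)"
  proof (intro sum_mono)
    fix i assume i: "i \<in> ch T"
    have "(\<integral>x. (w i)\<^sup>2 * conductance F n (flow_energy n (sub T i)) (sec b x) \<partial>F) \<le> s i"
      unfolding s_def w_def using i int T
      by (intro integral_mono integrable_mult_right Suc.IH hit_integral F) auto
    then show "(w i)\<^sup>2 * c i \<le> s i" by (simp add: c_def)
  qed
  finally have le: "?W\<^sup>2 * c' \<le> (\<Sum>i\<in>ch T. s i)" .
  \<comment> \<open>In generation 0 the energy is the squared strength \<open>?W\<^sup>2\<close>.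
    This is the root resistance, and also the prefactor, so the quotient has the form
    \<open>x / (1 + x)\<close>.\<close>
  have "(gen_size (Suc n) T)\<^sup>2 * conductance F (Suc n) (flow_energy (Suc n) T) b = ?W\<^sup>2 * c' / (1 + ?W\<^sup>2 * c')"
    by (simp add: Let_def c'_def w_def)
  also have "\<dots> \<le> (\<Sum>i\<in>ch T. s i) / (1 + (\<Sum>i\<in>ch T. s i))"
    using c' by (intro divide_one_plus_mono le) auto
  also have "\<dots> \<le> hit F (Suc n) T b"
    using ge_one_minus_prod[of "ch T" s] s T by (simp add: s_def)
  finally show ?case .
qed simp

text \<open>Submultiplicativity compares one symmetric forest with the product over the subtrees of
  the children, to which the induction hypothesis applies. The strict inequality between the sizes
  leaves something positive for the spare forest and for each child.\<close>

lemma avoid_le_not_hit: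
  assumes F: "real_distribution F" and "leafless_tree T" "Measurable.pred seqs b"
    and "\<And>j. gen_size (Suc j) T < z j"
  shows "avoid F n z b \<le> 1 - hit F n T b"
  using assms(2-)
proof (induction n arbitrary: T b z)
  case (Suc n)
  interpret real_distribution F by fact
  note [measurable] = Suc.prems(2)
  note T = leafless_tree_ch[OF Suc.prems(1)] leafless_tree_sub[OF Suc.prems(1)]
  define k where "k = real (card (ch T))"
  have k: "k > 0" using T by (simp add: k_def card_gt_0_iff)
  \<comment> \<open>Beyond the first generation one half of the excess goes to the spare forest
    \<open>y\<close>; the other half is shared equally by the \<open>k\<close> children and keeps
    their inequalities strict.\<close>
  define \<delta> where "\<delta> j = (z j - gen_size (Suc j) T) / (2 * k)" for j
  have \<delta>: "\<delta> j > 0" "2 * k * \<delta> j = z j - gen_size (Suc j) T" for j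
    using k Suc.prems(3)[of j] by (auto simp: \<delta>_def)
  define y where "y j = (case j of 0 \<Rightarrow> z 0 - k | Suc j \<Rightarrow> k * \<delta> (Suc j))" for j
  define zz where "zz i j = (case j of 0 \<Rightarrow> 1 | Suc l \<Rightarrow> gen_size (Suc l) (sub T i) + \<delta> (Suc l))" for i j
  have z: "z = (\<lambda>j. y j + (\<Sum>i\<in>ch T. zz i j))"
  proof
    fix j show "z j = y j + (\<Sum>i\<in>ch T. zz i j)"
      using \<delta>(2)[of j] by (cases j) (simp_all add: y_def zz_def k_def sum.distrib algebra_simps)
  qed
  have y: "y j > 0" for j
    using Suc.prems(3)[of 0] k \<delta> by (cases j) (auto simp: y_def k_def)
  have zz: "zz i j > 0" if "i \<in> ch T" for i j
    using gen_size_pos[OF T(3)[OF that]] \<delta> by (cases j) (auto simp: zz_def intro!: add_pos_pos simp del: lsum.simps)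
  have rng: "0 \<le> avoid F n (\<lambda>j. zz i (Suc j)) (sec b x)" "avoid F n (\<lambda>j. zz i (Suc j)) (sec b x) \<le> 1" if "i \<in> ch T" for i x
    using zz[OF that] by (auto intro!: avoid_range F)
  have "avoid F (Suc n) z b \<le> avoid F (Suc n) y b * (\<Prod>i\<in>ch T. avoid F (Suc n) (zz i) b)"
    unfolding z using T(1) y zz Suc.prems(2) by (rule avoid_sum_submultiplicative[OF F])
  also have "\<dots> \<le> 1 * (\<Prod>i\<in>ch T. avoid F (Suc n) (zz i) b)"
    using y zz Suc.prems(2) by (intro mult_right_mono prod_nonneg avoid_range F) auto
  also have "\<dots> \<le> (\<Prod>i\<in>ch T. 1 - (\<integral>x. hit F n (sub T i) (sec b x) \<partial>F))"
    unfolding mult_1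
  proof (intro prod_mono conjI)
    fix i assume i: "i \<in> ch T"
    show "0 \<le> avoid F (Suc n) (zz i) b" using zz[OF i] Suc.prems(2) by (intro avoid_range F)
    have h: "integrable F (\<lambda>x. hit F n (sub T i) (sec b x))"
      by (intro hit_integral F Suc.prems)
    have v: "integrable F (\<lambda>x. avoid F n (\<lambda>j. zz i (Suc j)) (sec b x))"
      using rng[OF i] Suc.prems(2)
      by (intro integrable_functional[where K = 1] measurable_functional_avoid F) auto
    \<comment> \<open>The forest \<open>zz i\<close> starts with a single vertex, so both exponents
      are 1 and the label of child \<open>i\<close> is simply averaged.\<close>
    have "avoid F (Suc n) (zz i) b = (\<integral>x. avoid F n (\<lambda>j. zz i (Suc j)) (sec b x) \<partial>F)"
      using rng[OF i] by (simp add: zz_def integral_nonneg del: lsum.simps)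
    also have "\<dots> \<le> (\<integral>x. 1 - hit F n (sub T i) (sec b x) \<partial>F)"
      using T(3)[OF i] \<delta> v h by (intro integral_mono Suc.IH) (auto simp: zz_def simp del: lsum.simps)
    also have "\<dots> = 1 - (\<integral>x. hit F n (sub T i) (sec b x) \<partial>F)" using h prob_space by simp
    finally show "avoid F (Suc n) (zz i) b \<le> \<dots>" .
  qed
  finally show ?case by simp
qed simp

text \<open>A natural number as constant keeps the event a countable union. Divided by the squared
  strength of the flow, the second condition bounds the energy in generation \<open>k\<close> by a
  multiple of \<open>1 / m ^ k\<close>, uniformly in \<open>n\<close>; for \<open>k = 0\<close> it
  contains the upper bound on the generation sizes.\<close>

definition regular_growth :: "real \<Rightarrow> nat list set \<Rightarrow> bool" where
  "regular_growth m T \<longleftrightarrow> (\<exists>C. (0::nat) < C \<and> (\<forall>n. m ^ n \<le> C * gen_size n T)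
     \<and> (\<forall>n k. k \<le> n \<longrightarrow> flow_energy n T k * m ^ k \<le> C * m ^ (2 * n)))"

lemma hit_comparable_ref:
  assumes m: "m > 1" and T: "leafless_tree T" and "regular_growth m T"
  obtains K where "K > 0"
    "\<And>F n b. real_distribution F \<Longrightarrow> Measurable.pred seqs b \<Longrightarrow> ref F m n b \<le> K * hit F n T b"
    "\<And>F n b. real_distribution F \<Longrightarrow> Measurable.pred seqs b \<Longrightarrow> hit F n T b \<le> K * ref F m n b"
proof -
  obtain C where H: "(0::nat) < C \<and> (\<forall>n. m ^ n \<le> C * gen_size n T)
     \<and> (\<forall>n k. k \<le> n \<longrightarrow> flow_energy n T k * m ^ k \<le> C * m ^ (2 * n))"
    using assms(3) unfolding regular_growth_def by (rule exE)
  note C = H[THEN conjunct1] and low = H[THEN conjunct2, THEN conjunct1, rule_format]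
    and en = H[THEN conjunct2, THEN conjunct2, rule_format]
  obtain K where K: "K \<ge> 1"
    "\<And>F n b. real_distribution F \<Longrightarrow> Measurable.pred seqs b \<Longrightarrow> 1 - avoid F n (\<lambda>k. m ^ Suc k) b \<le> K * ref F m n b"
    using one_minus_avoid_le_ref[OF m] by blast
  \<comment> \<open>In \<open>C ^ 3\<close> one factor comes from the energy bound and two from
    replacing \<open>m ^ (2 * n)\<close> by the squared generation size. The sizes are at most
    \<open>sqrt C * m ^ j\<close>, hence strictly below \<open>(C + 1) * m ^ j\<close>; by
    \<open>avoid_scale\<close> and Bernoulli this costs the factor \<open>C + 1\<close>.\<close>
  let ?K = "max (real C ^ 3) ((real C + 1) * K)"
  show ?thesis
  proof (rule that[of ?K])
    show "?K > 0" using C by (simp add: less_max_iff_disj)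
  next
    fix F n b assume F: "real_distribution F" and b: "Measurable.pred seqs b"
    let ?c = "conductance F n (flow_energy n T) b"
    have c: "0 \<le> ?c" by (intro conductance_range flow_energy_pos T)
    have "ref F m n b \<le> (C * m ^ (2 * n)) * ?c"
      using m T en b by (intro ref_le_conductance F flow_energy_pos) (auto simp: pos_le_divide_eq)
    also have "m ^ (2 * n) \<le> (C * gen_size n T)\<^sup>2"
      unfolding power_even_eq using m by (intro power_mono low) simp
    then have "(C * m ^ (2 * n)) * ?c \<le> C * (C * gen_size n T)\<^sup>2 * ?c"
      using c by (intro mult_right_mono mult_left_mono) auto
    also have "\<dots> = real C ^ 3 * ((gen_size n T)\<^sup>2 * ?c)"
      by (simp add: power_mult_distrib power2_eq_square power3_eq_cube)
    also have "\<dots> \<le> real C ^ 3 * hit F n T b"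
      by (intro mult_left_mono conductance_le_hit F T b) auto
    also have "\<dots> \<le> ?K * hit F n T b"
      by (intro mult_right_mono hit_range F b) auto
    finally show "ref F m n b \<le> ?K * hit F n T b" .
    have "gen_size (Suc j) T < (real C + 1) * m ^ Suc j" for j
    proof -
      have "(gen_size (Suc j) T)\<^sup>2 \<le> C * (m ^ Suc j)\<^sup>2"
        using en[of 0 "Suc j"] unfolding power_even_eq by (simp del: lsum.simps(2) power_Suc)
      also have "\<dots> < ((real C + 1) * m ^ Suc j)\<^sup>2"
      proof -
        have "real C < (real C + 1)\<^sup>2" by (simp add: power2_eq_square algebra_simps add_pos_nonneg)
        then show ?thesis using m by (simp add: power_mult_distrib del: power_Suc)
      qed
      finally show ?thesis by (rule power2_less_imp_less) (use m in simp)
    qed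
    then have "avoid F n (\<lambda>j. (real C + 1) * m ^ Suc j) b \<le> 1 - hit F n T b"
      by (rule avoid_le_not_hit[OF F T b])
    then have "hit F n T b \<le> 1 - avoid F n (\<lambda>j. (real C + 1) * m ^ Suc j) b" by linarith
    also have "\<dots> = 1 - avoid F n (\<lambda>j. m ^ Suc j) b powr (real C + 1)"
      using m by (subst avoid_scale[OF F _ b]) auto
    also have "\<dots> \<le> (real C + 1) * (1 - avoid F n (\<lambda>j. m ^ Suc j) b)"
      using Bernoulli_powr_ge[of "1 - avoid F n (\<lambda>j. m ^ Suc j) b" "real C + 1"]
        avoid_range[OF F, of "\<lambda>j. m ^ Suc j" b n] m b by simp
    also have "\<dots> \<le> (real C + 1) * (K * ref F m n b)"
      by (intro mult_left_mono K F b) auto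
    also have "\<dots> = (real C + 1) * K * ref F m n b" by simp
    also have "\<dots> \<le> ?K * ref F m n b"
      using m by (intro mult_right_mono ref_range) auto
    finally show "hit F n T b \<le> ?K * ref F m n b" .
  qed
qed

section \<open>Hitting probabilities of labelled trees\<close>

text \<open>A finite path is coded as a sequence padded with zeros, in agreement with the leaf value
  \<open>b (\<lambda>_. 0)\<close> of all recursions. The prefixes of length at least 1 leave out
  the root.\<close>

definition lab :: "(nat list \<Rightarrow> real) \<Rightarrow> nat list \<Rightarrow> nat \<Rightarrow> real" where
  "lab X v = (\<lambda>k. if k < length v then X (take (Suc k) v) else 0)"

definition reach :: "nat \<Rightarrow> nat list set \<Rightarrow> ((nat \<Rightarrow> real) \<Rightarrow> bool) \<Rightarrow> (nat list \<Rightarrow> real) \<Rightarrow> bool" where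
  "reach n T b X \<longleftrightarrow> (\<exists>v\<in>T. length v = n \<and> b (lab X v))"

lemma lab_Cons: "lab X (i # v) = case_nat (X [i]) (lab (\<lambda>u. X (i # u)) v)"
  by (auto simp: lab_def fun_eq_iff split: nat.split)

lemma reach_0: "[] \<in> T \<Longrightarrow> reach 0 T b X \<longleftrightarrow> b (\<lambda>_. 0)"
  by (auto simp: reach_def lab_def)

lemma reach_Suc:
  assumes "\<And>v i. v @ [i] \<in> T \<Longrightarrow> v \<in> T"
  shows "reach (Suc n) T b X \<longleftrightarrow> (\<exists>i\<in>ch T. reach n (sub T i) (sec b (X [i])) (\<lambda>u. X (i # u)))"
proof
  assume "reach (Suc n) T b X"
  then obtain v where v: "v \<in> T" "length v = Suc n" "b (lab X v)" by (auto simp: reach_def)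
  then obtain i u where iu: "v = i # u" by (cases v) auto
  have "[i] \<in> T" if "i # u \<in> T" for u
    using that
  proof (induction u rule: rev_induct)
    case (snoc j u)
    then show ?case using assms[of "i # u" j] by simp
  qed
  then show "\<exists>i\<in>ch T. reach n (sub T i) (sec b (X [i])) (\<lambda>u. X (i # u))"
    using v by (auto simp: iu reach_def ch_def sub_def sec_def lab_Cons)
next
  assume "\<exists>i\<in>ch T. reach n (sub T i) (sec b (X [i])) (\<lambda>u. X (i # u))"
  then obtain i u where "i # u \<in> T" "length u = n" "b (lab X (i # u))"
    by (auto simp: reach_def sub_def sec_def lab_Cons)
  then show "reach (Suc n) T b X" unfolding reach_def by force
qed

lemma pred_reach [measurable]:
  assumes [measurable]: "Measurable.pred seqs b" and T: "\<And>v k. v \<in> T \<Longrightarrow> k < length v \<Longrightarrow> take (Suc k) v \<in> V"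
  shows "Measurable.pred (\<Pi>\<^sub>M v\<in>V. borel) (reach n T b)"
proof -
  have "(\<lambda>X. lab X v) \<in> measurable (\<Pi>\<^sub>M v\<in>V. borel) seqs" if "v \<in> T" for v
    unfolding lab_def
  proof (rule measurable_PiM_single')
    fix k
    show "(\<lambda>X. if k < length v then X (take (Suc k) v) else 0) \<in> borel_measurable (\<Pi>\<^sub>M v\<in>V. borel)"
      using T[OF that] by (cases "k < length v") auto
  qed (auto simp: space_PiM)
  then have "Measurable.pred (\<Pi>\<^sub>M v\<in>V. borel) (\<lambda>X. b (lab X v))" if "v \<in> T" for v
    using that measurable_compose[OF _ assms(1)] by blast
  then have "Measurable.pred (\<Pi>\<^sub>M v\<in>V. borel) (\<lambda>X. \<exists>v\<in>T. length v = n \<and> b (lab X v))"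
    by (intro pred_intros_countable_bounded pred_intros_logic) auto
  then show ?thesis by (simp only: reach_def[abs_def])
qed

lemma pred_reach_sec:
  assumes [measurable]: "Measurable.pred seqs b"
  shows "Measurable.pred (\<Pi>\<^sub>M v\<in>UNIV. borel) (\<lambda>X. reach n T (sec b (X [])) X)"
proof -
  have "(\<lambda>X. case_nat (X []) (lab X v)) \<in> measurable (\<Pi>\<^sub>M v\<in>UNIV. borel) seqs" for v
    unfolding lab_def
  proof (rule measurable_PiM_single')
    fix k
    show "(\<lambda>X. case k of 0 \<Rightarrow> X [] | Suc k \<Rightarrow> (if k < length v then X (take (Suc k) v) else 0)) \<in> borel_measurable (\<Pi>\<^sub>M v\<in>UNIV. borel)"
      by (cases k) auto
  qed (auto simp: space_PiM)
  then have "Measurable.pred (\<Pi>\<^sub>M v\<in>UNIV. borel) (\<lambda>X. b (case_nat (X []) (lab X v)))" for v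
    using measurable_compose[OF _ assms(1)] by blast
  then have "Measurable.pred (\<Pi>\<^sub>M v\<in>UNIV. borel) (\<lambda>X. \<exists>v\<in>T. length v = n \<and> b (case_nat (X []) (lab X v)))"
    by (intro pred_intros_countable_bounded pred_intros_logic) auto
  then show ?thesis by (simp only: reach_def sec_def)
qed

lemma reach_graft: "reach n T b (graft x y) \<longleftrightarrow> reach n T b (graft x' y)"
proof -
  have "lab (graft x y) v = lab (graft x' y) v" for v
    by (cases v) (auto simp: lab_def fun_eq_iff)
  then show ?thesis by (simp add: reach_def)
qed

lemma prob_Bex_PiM:
  assumes M: "prob_space M" and I: "finite I" and meas: "\<And>i. i \<in> I \<Longrightarrow> Measurable.pred M (P i)"
  shows "measure (\<Pi>\<^sub>M i\<in>UNIV. M) {y \<in> space (\<Pi>\<^sub>M i\<in>UNIV. M). \<exists>i\<in>I. P i (y i)}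
     = 1 - (\<Prod>i\<in>I. 1 - measure M {x \<in> space M. P i x})"
proof -
  interpret M: prob_space M by fact
  interpret product_prob_space "\<lambda>_. M" "UNIV :: 'b set" by unfold_locales
  define A where "A i = {x \<in> space M. \<not> P i x}" for i
  have A: "A i \<in> sets M" if "i \<in> I" for i using meas[OF that] by (simp add: A_def)
  have "measure (\<Pi>\<^sub>M i\<in>UNIV. M) {y \<in> space (\<Pi>\<^sub>M i\<in>UNIV. M). \<forall>i\<in>I. y i \<in> A i} = (\<Prod>i\<in>I. measure M (A i))"
  proof (cases "I = {}")
    case False
    then show ?thesis
      using emeasure_PiM_Collect[of I A] I A
      by (simp add: P.emeasure_eq_measure M.emeasure_eq_measure prod_ennreal prod_nonneg)
  qed (simp add: P.prob_space)
  moreover have "measure M (A i) = 1 - measure M {x \<in> space M. P i x}" if "i \<in> I" for i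
    using M.prob_neg[of "P i"] meas[OF that] by (simp add: A_def)
  moreover have "measure (\<Pi>\<^sub>M i\<in>UNIV. M) {y \<in> space (\<Pi>\<^sub>M i\<in>UNIV. M). \<exists>i\<in>I. P i (y i)}
     = 1 - measure (\<Pi>\<^sub>M i\<in>UNIV. M) {y \<in> space (\<Pi>\<^sub>M i\<in>UNIV. M). \<forall>i\<in>I. y i \<in> A i}"
  proof -
    have m: "{y \<in> space (\<Pi>\<^sub>M i\<in>UNIV. M). \<forall>i\<in>I. y i \<in> A i} \<in> sets (\<Pi>\<^sub>M i\<in>UNIV. M)"
      using I A by (intro sets.sets_Collect_finite_All) (auto intro!: measurable_sets_Collect simp: sets_Collect_single)
    have "{y \<in> space (\<Pi>\<^sub>M i\<in>UNIV. M). \<exists>i\<in>I. P i (y i)}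
       = space (\<Pi>\<^sub>M i\<in>UNIV. M) - {y \<in> space (\<Pi>\<^sub>M i\<in>UNIV. M). \<forall>i\<in>I. y i \<in> A i}"
      by (auto simp: A_def space_PiM PiE_iff)
    then show ?thesis using P.prob_compl[OF m] by simp
  qed
  ultimately show ?thesis by simp
qed

lemma emeasure_labels_Collect:
  assumes M: "prob_space M" and [measurable]: "Measurable.pred (labels M) P"
  shows "emeasure (labels M) {X \<in> space (labels M). P X}
     = (\<integral>\<^sup>+x. emeasure (label_seqs M) {y \<in> space (label_seqs M). P (graft x y)} \<partial>M)"
proof -
  interpret S: prob_space "label_seqs M" by (intro prob_space_PiM M)
  have "emeasure (labels M) {X \<in> space (labels M). P X} = (\<integral>\<^sup>+X. indicator {X \<in> space (labels M). P X} X \<partial>labels M)"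
    by simp
  also have "\<dots> = (\<integral>\<^sup>+x. \<integral>\<^sup>+y. indicator {X \<in> space (labels M). P X} (graft x y) \<partial>label_seqs M \<partial>M)"
    by (rule nn_integral_labels[OF M]) simp
  also have "\<dots> = (\<integral>\<^sup>+x. emeasure (label_seqs M) {y \<in> space (label_seqs M). P (graft x y)} \<partial>M)"
  proof (intro nn_integral_cong)
    fix x assume [measurable]: "x \<in> space M"
    have "graft x y \<in> space (labels M)" if "y \<in> space (label_seqs M)" for y
      using that \<open>x \<in> space M\<close> by (auto simp: space_PiM graft_def PiE_iff split: list.split)
    then have "(\<integral>\<^sup>+y. indicator {X \<in> space (labels M). P X} (graft x y) \<partial>label_seqs M)
       = (\<integral>\<^sup>+y. indicator {y \<in> space (label_seqs M). P (graft x y)} y \<partial>label_seqs M)"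
      by (intro nn_integral_cong) (auto simp: indicator_def)
    also have "\<dots> = emeasure (label_seqs M) {y \<in> space (label_seqs M). P (graft x y)}"
      by (rule nn_integral_indicator) measurable
    finally show "(\<integral>\<^sup>+y. indicator {X \<in> space (labels M). P X} (graft x y) \<partial>label_seqs M)
       = emeasure (label_seqs M) {y \<in> space (label_seqs M). P (graft x y)}" .
  qed
  finally show ?thesis .
qed

text \<open>The root is split off twice: in the whole field, which makes the fields of the children
  independent, and in the field of each child, where the value at its root is the label by which the
  target is sectioned.\<close>

lemma prob_reach:
  assumes F: "real_distribution F" and "leafless_tree T" "Measurable.pred seqs b"
  shows "measure (labels F) {X \<in> space (labels F). reach n T b X} = hit F n T b"
  using assms(2-)
proof (induction n arbitrary: T b)
  case 0
  interpret F: real_distribution F by fact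
  interpret L: prob_space "labels F" by (intro prob_space_PiM F.prob_space_axioms)
  show ?case
    using leafless_treeD(1)[OF 0(1)] L.prob_space by (cases "b (\<lambda>_. 0)") (simp_all add: reach_0)
next
  case (Suc n)
  interpret F: real_distribution F by fact
  interpret L: prob_space "labels F" by (intro prob_space_PiM F.prob_space_axioms)
  interpret S: prob_space "label_seqs F" by (intro prob_space_PiM L.prob_space_axioms F.prob_space_axioms)
  have sets_eq[measurable_cong]: "sets (labels F) = sets (\<Pi>\<^sub>M v\<in>UNIV. borel)"
    by (intro sets_PiM_cong) auto
  have R[measurable]: "Measurable.pred (labels F) (reach k T' b')" if "Measurable.pred seqs b'" for k T' b'
    using pred_reach[OF that, of T' UNIV k] by (simp cong: measurable_cong_sets add: sets_eq)
  \<comment> \<open>The event for one child in terms of its own field: \<open>X []\<close> is the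
    first label on the path.\<close>
  define R' where "R' T' X = reach n T' (sec b (X [])) X" for T' X
  have R'[measurable]: "Measurable.pred (labels F) (R' T')" for T'
    unfolding R'_def[abs_def] measurable_cong_sets[OF sets_eq refl] by (rule pred_reach_sec[OF Suc.prems(2)])
  \<comment> \<open>Since \<open>lab\<close> reads only labels below the root, the integrand in the
    decomposition is constant in the root label, so the probability is the same for each fixed
    \<open>x\<close>.\<close>
  have root: "emeasure (label_seqs F) {y \<in> space (label_seqs F). reach n T' b' (graft x y)} = hit F n T' b'"
    if T': "leafless_tree T'" and b': "Measurable.pred seqs b'" for T' b' x
  proof -
    have "emeasure (labels F) {X \<in> space (labels F). reach n T' b' X}
       = (\<integral>\<^sup>+x'. emeasure (label_seqs F) {y \<in> space (label_seqs F). reach n T' b' (graft x' y)} \<partial>F)"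
      by (rule emeasure_labels_Collect[OF F.prob_space_axioms R[OF b']])
    also have "\<dots> = (\<integral>\<^sup>+x'. emeasure (label_seqs F) {y \<in> space (label_seqs F). reach n T' b' (graft x y)} \<partial>F)"
      by (intro nn_integral_cong arg_cong[where f = "emeasure _"] Collect_cong conj_cong refl reach_graft)
    also have "\<dots> = emeasure (label_seqs F) {y \<in> space (label_seqs F). reach n T' b' (graft x y)}"
      using F.emeasure_space_1 by simp
    finally show ?thesis
      using Suc.IH[OF T' b'] by (simp add: L.emeasure_eq_measure)
  qed
  have step: "measure (labels F) {X \<in> space (labels F). R' T' X} = (\<integral>x. hit F n T' (sec b x) \<partial>F)"
    if T': "leafless_tree T'" for T'
  proof -
    have "emeasure (labels F) {X \<in> space (labels F). R' T' X}
       = (\<integral>\<^sup>+x. emeasure (label_seqs F) {y \<in> space (label_seqs F). R' T' (graft x y)} \<partial>F)"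
      by (rule emeasure_labels_Collect[OF F.prob_space_axioms R'])
    also have "\<dots> = (\<integral>\<^sup>+x. ennreal (hit F n T' (sec b x)) \<partial>F)"
      by (simp only: R'_def graft_simps root[OF T' pred_sec[OF Suc.prems(2)]])
    also have "\<dots> = ennreal (\<integral>x. hit F n T' (sec b x) \<partial>F)"
      using hit_range(1)[OF F pred_sec[OF Suc.prems(2)]]
      by (intro nn_integral_eq_integral hit_integral F Suc.prems) auto
    finally show ?thesis
      using hit_integral(2)[OF F Suc.prems(2)] by (simp add: L.emeasure_eq_measure)
  qed
  note T = leafless_tree_ch[OF Suc.prems(1)] leafless_tree_sub[OF Suc.prems(1)]
  have "emeasure (labels F) {X \<in> space (labels F). reach (Suc n) T b X}
     = (\<integral>\<^sup>+x. emeasure (label_seqs F) {y \<in> space (label_seqs F). reach (Suc n) T b (graft x y)} \<partial>F)"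
    by (rule emeasure_labels_Collect[OF F.prob_space_axioms R[OF Suc.prems(2)]])
  also have "\<dots> = (\<integral>\<^sup>+x. emeasure (label_seqs F) {y \<in> space (label_seqs F). \<exists>i\<in>ch T. R' (sub T i) (y i)} \<partial>F)"
    by (simp add: reach_Suc[OF leafless_treeD(2)[OF Suc.prems(1)]] R'_def)
  also have "\<dots> = emeasure (label_seqs F) {y \<in> space (label_seqs F). \<exists>i\<in>ch T. R' (sub T i) (y i)}"
    using F.emeasure_space_1 by simp
  finally have "measure (labels F) {X \<in> space (labels F). reach (Suc n) T b X}
      = measure (label_seqs F) {y \<in> space (label_seqs F). \<exists>i\<in>ch T. R' (sub T i) (y i)}"
    by (simp add: L.emeasure_eq_measure S.emeasure_eq_measure)
  also have "\<dots> = 1 - (\<Prod>i\<in>ch T. 1 - measure (labels F) {X \<in> space (labels F). R' (sub T i) X})"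
    by (rule prob_Bex_PiM[OF L.prob_space_axioms T(1)]) measurable
  also have "\<dots> = hit F (Suc n) T b"
    using T by (simp add: step)
  finally show ?case .
qed

section \<open>Paths in locally finite trees\<close>

text \<open>A step toward the root would return to the vertex just left, since a vertex has only one
  parent; injectivity excludes this. Conversely, the lengths along a descending path are all
  different.\<close>

lemma root_path_iff:
  "root_path T \<xi> \<longleftrightarrow> \<xi> 0 = [] \<and> (\<forall>n. \<xi> n \<in> T \<and> (\<exists>i. \<xi> (Suc n) = \<xi> n @ [i]))"
proof
  assume \<xi>: "root_path T \<xi>"
  have "\<exists>i. \<xi> (Suc n) = \<xi> n @ [i]" for n
  proof (induction n)
    case 0
    have "adjacent (\<xi> 0) (\<xi> (Suc 0))" using \<xi> unfolding root_path_def by blast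
    moreover have "\<xi> 0 = []" using \<xi> unfolding root_path_def by blast
    ultimately show ?case by (auto simp: adjacent_def)
  next
    case (Suc n)
    then obtain i where i: "\<xi> (Suc n) = \<xi> n @ [i]" by blast
    have "adjacent (\<xi> (Suc n)) (\<xi> (Suc (Suc n)))" using \<xi> unfolding root_path_def by blast
    moreover have False if "\<xi> (Suc n) = \<xi> (Suc (Suc n)) @ [j]" for j
    proof -
      have "\<xi> (Suc (Suc n)) = \<xi> n" using that i by simp
      moreover have "inj \<xi>" using \<xi> unfolding root_path_def by blast
      ultimately show False by (auto dest: injD)
    qed
    ultimately show ?case unfolding adjacent_def by blast
  qed
  then show "\<xi> 0 = [] \<and> (\<forall>n. \<xi> n \<in> T \<and> (\<exists>i. \<xi> (Suc n) = \<xi> n @ [i]))"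
    using \<xi> by (simp add: root_path_def)
next
  assume \<xi>: "\<xi> 0 = [] \<and> (\<forall>n. \<xi> n \<in> T \<and> (\<exists>i. \<xi> (Suc n) = \<xi> n @ [i]))"
  have "length (\<xi> n) = n" for n
  proof (induction n)
    case (Suc n)
    obtain i where "\<xi> (Suc n) = \<xi> n @ [i]" using \<xi> by blast
    with Suc show ?case by simp
  qed (use \<xi> in simp)
  then have "inj \<xi>" by (metis injI)
  then show "root_path T \<xi>"
    using \<xi> unfolding root_path_def adjacent_def by blast
qed

lemma take_mem_tree:
  assumes T: "\<And>v i. v @ [i] \<in> T \<Longrightarrow> v \<in> T" and "v \<in> T"
  shows "take k v \<in> T"
proof -
  have "u \<in> T" if "u @ w \<in> T" for u w
    using that
  proof (induction w rule: rev_induct)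
    case (snoc i w)
    then show ?case using T[of "u @ w" i] by simp
  qed simp
  from this[of "take k v" "drop k v"] show ?thesis using assms(2) by simp
qed

lemma Koenig:
  assumes T: "\<And>v i. v @ [i] \<in> T \<Longrightarrow> v \<in> T" and fin: "\<And>v. finite {i. v @ [i] \<in> T}"
    and ex: "\<And>n. \<exists>v\<in>T. length v = n"
  shows "\<exists>\<xi>. \<xi> 0 = [] \<and> (\<forall>n. \<xi> n \<in> T \<and> (\<exists>i. \<xi> (Suc n) = \<xi> n @ [i]))"
proof -
  \<comment> \<open>Good vertices have descendants of every length. If no child of a good vertex
    were good, each child \<open>i\<close> would miss some length \<open>n i\<close>, and a
    descendant at a level beyond all these lengths would have a prefix that contradicts
    this.\<close>
  define Q where "Q v \<longleftrightarrow> (\<forall>n \<ge> length v. \<exists>u. v @ u \<in> T \<and> length (v @ u) = n)" for v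
  have step: "\<exists>w. Q w \<and> (\<exists>i. w = v @ [i])" if v: "Q v" for v
  proof (rule ccontr)
    assume no: "\<not> ?thesis"
    have "\<exists>n. n > length v \<and> (\<forall>u. v @ [i] @ u \<in> T \<longrightarrow> length (v @ [i] @ u) \<noteq> n)" for i
    proof -
      have "\<not> Q (v @ [i])" using no by blast
      then obtain n where "n \<ge> Suc (length v)" "\<forall>u. v @ [i] @ u \<in> T \<longrightarrow> length (v @ [i] @ u) \<noteq> n"
        unfolding Q_def by auto
      then show ?thesis by (intro exI[of _ n]) auto
    qed
    then obtain n where n: "\<And>i. n i > length v" "\<And>i u. v @ [i] @ u \<in> T \<Longrightarrow> length (v @ [i] @ u) \<noteq> n i"
      by metis
    define N where "N = Suc (length v) + (\<Sum>i\<in>{i. v @ [i] \<in> T}. n i)"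
    obtain u where u: "v @ u \<in> T" "length (v @ u) = N"
      using v[unfolded Q_def, rule_format, of N] by (auto simp: N_def)
    then obtain i u' where u': "u = i # u'" by (cases u) (auto simp: N_def)
    have "take (Suc (length v)) (v @ u) \<in> T" using take_mem_tree[OF T u(1)] .
    then have i: "v @ [i] \<in> T" by (simp add: u')
    then have "n i \<le> (\<Sum>i\<in>{i. v @ [i] \<in> T}. n i)"
      by (intro member_le_sum fin) auto
    then have le: "n i \<le> N" by (simp add: N_def)
    have "take (n i) (v @ u) \<in> T" using take_mem_tree[OF T u(1)] .
    moreover have "take (n i) (v @ u) = v @ [i] @ take (n i - Suc (length v)) u'"
      using n(1)[of i] by (simp add: u' take_Cons')
    ultimately have "length (take (n i) (v @ u)) \<noteq> n i" using n(2) by metis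
    then show False using le u by simp
  qed
  have "\<exists>\<xi>. \<forall>n. (Q (\<xi> n) \<and> (n = 0 \<longrightarrow> \<xi> n = [])) \<and> (\<exists>i. \<xi> (Suc n) = \<xi> n @ [i])"
  proof (rule dependent_nat_choice)
    show "\<exists>v. Q v \<and> (0 = (0::nat) \<longrightarrow> v = [])" using ex by (auto simp: Q_def)
  qed (use step in auto)
  then obtain \<xi> where \<xi>: "\<And>n. Q (\<xi> n)" "\<xi> 0 = []" "\<And>n. \<exists>i. \<xi> (Suc n) = \<xi> n @ [i]" by metis
  have "\<xi> n \<in> T" for n
  proof -
    obtain u where "\<xi> n @ u \<in> T" "length (\<xi> n @ u) = length (\<xi> n)"
      using \<xi>(1)[of n] unfolding Q_def by blast
    then show ?thesis by simp
  qed
  with \<xi> show ?thesis by blast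
qed

section \<open>Finite-level targets and compactness\<close>

definition trunc :: "nat \<Rightarrow> (nat \<Rightarrow> real) \<Rightarrow> nat \<Rightarrow> real" where
  "trunc n y = (\<lambda>k. if k < n then y k else 0)"

text \<open>The projection of a closed set to finitely many coordinates need not be closed; the
  closure makes the target measurable. By \<open>mem_closed_if_trunc\<close> the closures still
  determine \<open>B\<close>.\<close>

definition target :: "(nat \<Rightarrow> real) set \<Rightarrow> nat \<Rightarrow> (nat \<Rightarrow> real) \<Rightarrow> bool" where
  "target B n y \<longleftrightarrow> y \<in> closure (trunc n ` B)"

lemma pred_target [measurable]: "Measurable.pred seqs (target B n)"
proof -
  have "closure (trunc n ` B) \<in> sets seqs"
    unfolding sets_PiM_equal_borel by simp
  then show ?thesis by (simp add: target_def pred_def space_PiM)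
qed

lemma target_trunc:
  assumes "target B (Suc n) y" shows "target B n (trunc n y)"
proof -
  have "continuous_on UNIV (trunc n)"
    unfolding trunc_def
  proof (intro continuous_on_coordinatewise_then_product)
    show "continuous_on UNIV (\<lambda>x. if i < n then x i else 0 :: real)" for i
      by (cases "i < n") auto
  qed
  then have "trunc n ` closure (trunc (Suc n) ` B) \<subseteq> closure (trunc n ` B)"
  proof (intro image_closure_subset)
    have "trunc n (trunc (Suc n) y) = trunc n y" for y by (auto simp: trunc_def)
    then show "trunc n ` trunc (Suc n) ` B \<subseteq> closure (trunc n ` B)"
      using closure_subset by (fastforce simp: image_image)
  qed (auto intro: continuous_on_subset)
  then show ?thesis using assms by (auto simp: target_def)
qed

text \<open>A point outside \<open>B\<close> has a basic open neighbourhood disjoint from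
  \<open>B\<close> that restricts only finitely many coordinates. Membership in it is unaffected by
  \<open>trunc N\<close> for large \<open>N\<close>, so it would separate \<open>trunc N y\<close>
  from the truncations of \<open>B\<close>.\<close>

lemma mem_closed_if_trunc:
  assumes B: "closed B" and y: "\<And>n. target B n (trunc n y)"
  shows "y \<in> B"
proof (rule ccontr)
  assume "y \<notin> B"
  moreover have "open (- B)" using B by auto
  ultimately obtain X where X: "y \<in> Pi\<^sub>E UNIV X" "\<And>i. open (X i)" "finite {i. X i \<noteq> UNIV}" "Pi\<^sub>E UNIV X \<subseteq> - B"
    using product_topology_open_contains_basis[of "\<lambda>_. euclidean" UNIV "- B" y]
    by (auto simp: open_fun_def)
  obtain N where N: "\<And>i. X i \<noteq> UNIV \<Longrightarrow> i < N"
    using finite_nat_set_iff_bounded[THEN iffD1, OF X(3)] by auto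
  have eq: "w \<in> Pi\<^sub>E UNIV X \<longleftrightarrow> trunc N w \<in> Pi\<^sub>E UNIV X" for w
    using N by (force simp: PiE_iff trunc_def)
  have "trunc N y \<in> Pi\<^sub>E UNIV X \<inter> closure (trunc N ` B)"
    using eq X(1) y[of N] by (auto simp: target_def)
  moreover have "open (Pi\<^sub>E UNIV X)" using X by (intro open_PiE)
  ultimately have "Pi\<^sub>E UNIV X \<inter> trunc N ` B \<noteq> {}"
    using open_Int_closure_eq_empty by blast
  then obtain w where "w \<in> B" "trunc N w \<in> Pi\<^sub>E UNIV X" by auto
  then show False using eq X(4) by blast
qed

lemma reach_Suc_imp_reach:
  assumes T: "leafless_tree T" and "reach (Suc n) T (target B (Suc n)) X"
  shows "reach n T (target B n) X"
proof -
  obtain v where v: "v \<in> T" "length v = Suc n" "target B (Suc n) (lab X v)"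
    using assms(2) by (auto simp: reach_def)
  have "trunc n (lab X v) = lab X (take n v)"
    using v(2) by (auto simp: trunc_def lab_def fun_eq_iff min_def)
  with target_trunc[OF v(3)] have "target B n (lab X (take n v))" by simp
  moreover have "take n v \<in> T" using take_mem_tree[OF leafless_treeD(2)[OF T] v(1)] .
  ultimately show ?thesis using v(2) by (auto simp: reach_def intro!: bexI[of _ "take n v"])
qed

text \<open>The vertices whose labels so far lie in the target of their level form a locally finite
  tree with vertices in every generation. An infinite path in it, from \<open>Koenig\<close>, has
  all its truncations in the targets, hence its labels in \<open>B\<close>.\<close>

lemma ex_path_iff_reach:
  assumes T: "leafless_tree T" and B: "closed B"
  shows "(\<exists>\<xi>. root_path T \<xi> \<and> (\<lambda>n. X (\<xi> (Suc n))) \<in> B) \<longleftrightarrow> (\<forall>n. reach n T (target B n) X)"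
proof -
  have len: "length (\<xi> n) = n" and lab: "lab X (\<xi> n) = trunc n (\<lambda>k. X (\<xi> (Suc k)))"
    if "\<xi> 0 = []" "\<And>n. \<exists>i. \<xi> (Suc n) = \<xi> n @ [i]" for \<xi> n
  proof -
    show len: "length (\<xi> n) = n" for n
    proof (induction n)
      case (Suc n) then show ?case using that(2)[of n] by auto
    qed (simp add: that)
    have tk: "take k (\<xi> n) = \<xi> k" if "k \<le> n" for k n
      using that
    proof (induction n)
      case (Suc n)
      obtain i where "\<xi> (Suc n) = \<xi> n @ [i]" using \<open>\<And>n. \<exists>i. \<xi> (Suc n) = \<xi> n @ [i]\<close> by blast
      with Suc show ?case using len[of n] by (cases "k = Suc n") auto
    qed (use len[of 0] in simp)
    show "lab X (\<xi> n) = trunc n (\<lambda>k. X (\<xi> (Suc k)))"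
      by (auto simp: lab_def trunc_def len tk fun_eq_iff)
  qed
  show ?thesis
  proof
    assume "\<exists>\<xi>. root_path T \<xi> \<and> (\<lambda>n. X (\<xi> (Suc n))) \<in> B"
    then obtain \<xi> where \<xi>: "root_path T \<xi>" "(\<lambda>n. X (\<xi> (Suc n))) \<in> B" by blast
    then have *: "\<xi> 0 = []" "\<And>n. \<exists>i. \<xi> (Suc n) = \<xi> n @ [i]" "\<And>n. \<xi> n \<in> T"
      by (auto simp: root_path_iff)
    show "\<forall>n. reach n T (target B n) X"
    proof
      fix n
      have "target B n (lab X (\<xi> n))"
        unfolding lab[OF *(1,2)] target_def using \<xi>(2) by (intro subsetD[OF closure_subset]) auto
      then show "reach n T (target B n) X"
        using len[OF *(1,2)] *(3) by (auto simp: reach_def)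
    qed
  next
    assume r: "\<forall>n. reach n T (target B n) X"
    define T' where "T' = {v \<in> T. target B (length v) (lab X v)}"
    have "\<exists>\<xi>. \<xi> 0 = [] \<and> (\<forall>n. \<xi> n \<in> T' \<and> (\<exists>i. \<xi> (Suc n) = \<xi> n @ [i]))"
    proof (rule Koenig[of T'])
      fix v i assume v: "v @ [i] \<in> T'"
      have "trunc (length v) (lab X (v @ [i])) = lab X v"
        by (auto simp: trunc_def lab_def fun_eq_iff)
      with v target_trunc[of B "length v" "lab X (v @ [i])"] leafless_treeD(2)[OF T]
      show "v \<in> T'" by (auto simp: T'_def)
    next
      fix v show "finite {i. v @ [i] \<in> T'}"
        using leafless_treeD(3)[OF T, of v] by (rule rev_finite_subset) (auto simp: T'_def)
    next
      fix n show "\<exists>v\<in>T'. length v = n"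
        using r[rule_format, of n] by (auto simp: T'_def reach_def)
    qed
    then obtain \<xi> where \<xi>: "\<xi> 0 = []" "\<And>n. \<xi> n \<in> T'" "\<And>n. \<exists>i. \<xi> (Suc n) = \<xi> n @ [i]"
      by blast
    have "target B n (trunc n (\<lambda>k. X (\<xi> (Suc k))))" for n
      using \<xi>(2)[of n] by (simp add: T'_def lab[OF \<xi>(1,3)] len[OF \<xi>(1,3)])
    then have "(\<lambda>n. X (\<xi> (Suc n))) \<in> B" by (rule mem_closed_if_trunc[OF B])
    moreover have "root_path T \<xi>" using \<xi> by (simp add: root_path_iff T'_def)
    ultimately show "\<exists>\<xi>. root_path T \<xi> \<and> (\<lambda>n. X (\<xi> (Suc n))) \<in> B" by blast
  qed
qed

text \<open>The events of reaching level \<open>n\<close> decrease to the path event, so continuity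
  from above applies.\<close>

lemma hit_tendsto_path_prob:
  assumes F: "real_distribution F" and T: "leafless_tree T" and B: "closed B"
  shows "(\<lambda>n. hit F n T (target B n)) \<longlonglongrightarrow> path_prob T B F"
proof -
  interpret F: real_distribution F by fact
  let ?P = "\<Pi>\<^sub>M v\<in>T. F"
  interpret P: prob_space ?P by (intro prob_space_PiM F.prob_space_axioms)
  have pre: "take (Suc k) v \<in> T" if "v \<in> T" for v k
    using take_mem_tree[OF leafless_treeD(2)[OF T] that] .
  have sets_eq: "sets ?P = sets (\<Pi>\<^sub>M v\<in>T. borel)" "sets (labels F) = sets (\<Pi>\<^sub>M v\<in>UNIV. borel)"
    by (auto intro!: sets_PiM_cong)
  define E where "E n = {X \<in> space ?P. reach n T (target B n) X}" for n
  have R: "Measurable.pred ?P (reach n T b)" if "Measurable.pred seqs b" for n b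
    using pred_reach[OF that, of T T n] pre by (simp cong: measurable_cong_sets add: sets_eq)
  have E: "E n \<in> sets ?P" for n using R[OF pred_target] by (simp add: E_def pred_def)
  have restr: "reach n T b (restrict X T) \<longleftrightarrow> reach n T b X" for n b X
  proof -
    have "lab (restrict X T) v = lab X v" if "v \<in> T" for v
      using pre[OF that] by (auto simp: lab_def)
    then show ?thesis by (auto simp: reach_def)
  qed
  have "measure ?P (E n) = hit F n T (target B n)" for n
  proof -
    \<comment> \<open>\<open>path_prob\<close> lives on labels of \<open>T\<close> only,
      \<open>hit\<close> on labels of all sequences. Restriction to \<open>T\<close> carries one
      product law to the other.\<close>
    have d: "distr (labels F) ?P (\<lambda>X. \<lambda>v\<in>T. X v) = ?P"
      using distr_PiM_reindex[of UNIV "\<lambda>_. F" "\<lambda>v. v" T] F.prob_space_axioms by auto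
    have mr: "(\<lambda>X. \<lambda>v\<in>T. X v) \<in> measurable (labels F) ?P"
      by (rule measurable_restrict) auto
    have "measure ?P (E n) = measure (labels F) ((\<lambda>X. \<lambda>v\<in>T. X v) -` E n \<inter> space (labels F))"
      by (subst d[symmetric], rule measure_distr[OF mr E])
    also have "(\<lambda>X. \<lambda>v\<in>T. X v) -` E n \<inter> space (labels F) = {X \<in> space (labels F). reach n T (target B n) X}"
      by (auto simp: E_def restr space_PiM)
    also have "measure (labels F) \<dots> = hit F n T (target B n)"
      by (rule prob_reach[OF F T pred_target])
    finally show ?thesis .
  qed
  moreover have "(\<lambda>n. measure ?P (E n)) \<longlonglongrightarrow> measure ?P (\<Inter>n. E n)"
  proof (rule P.finite_Lim_measure_decseq)
    show "range E \<subseteq> sets ?P" using E by auto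
    show "decseq E"
      using reach_Suc_imp_reach[OF T] by (intro decseq_SucI) (auto simp: E_def)
  qed
  moreover have "(\<Inter>n. E n) = {X \<in> space ?P. \<exists>\<xi>. root_path T \<xi> \<and> (\<lambda>n. X (\<xi> (Suc n))) \<in> B}"
    by (auto simp: E_def ex_path_iff_reach[OF T B])
  ultimately show ?thesis by (simp add: path_prob_def)
qed

text \<open>The two comparison constants with the common \<open>ref\<close> are the same for all
  levels, so a zero limit for \<open>T\<close> forces one for \<open>T'\<close>.\<close>

lemma polar_imp_polar:
  assumes m: "m > 1" and F: "real_distribution F" and B: "closed B"
    and T: "leafless_tree T" "regular_growth m T" and T': "leafless_tree T'" "regular_growth m T'"
    and pol: "polar T B F"
  shows "polar T' B F"
proof -
  obtain K where K: "\<And>F n b. real_distribution F \<Longrightarrow> Measurable.pred seqs b \<Longrightarrow> ref F m n b \<le> K * hit F n T b"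
    using hit_comparable_ref[OF m T] by metis
  obtain K' where K': "K' > 0" "\<And>F n b. real_distribution F \<Longrightarrow> Measurable.pred seqs b \<Longrightarrow> hit F n T' b \<le> K' * ref F m n b"
    using hit_comparable_ref[OF m T'] by metis
  have "(\<lambda>n. K' * (K * hit F n T (target B n))) \<longlonglongrightarrow> K' * (K * path_prob T B F)"
    by (intro tendsto_mult tendsto_const hit_tendsto_path_prob F T B)
  then have lim0: "(\<lambda>n. K' * (K * hit F n T (target B n))) \<longlonglongrightarrow> 0"
    using pol by (simp add: polar_def)
  have "(\<lambda>n. hit F n T' (target B n)) \<longlonglongrightarrow> 0"
  proof (rule tendsto_sandwich[OF _ _ tendsto_const lim0])
    have "hit F n T' (target B n) \<le> K' * (K * hit F n T (target B n))" for n
      using K'(2)[OF F pred_target, of n B n] mult_left_mono[OF K[OF F pred_target, of n B n], of K'] K'(1)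
      by linarith
    then show "\<forall>\<^sub>F n in sequentially. hit F n T' (target B n) \<le> K' * (K * hit F n T (target B n))" by simp
    show "\<forall>\<^sub>F n in sequentially. 0 \<le> hit F n T' (target B n)"
      using hit_range(1)[OF F pred_target] by simp
  qed
  then show ?thesis
    using hit_tendsto_path_prob[OF F T'(1) B] LIMSEQ_unique by (auto simp: polar_def)
qed

section \<open>Sums over generations of a Galton-Watson tree\<close>

text \<open>The counterpart of \<open>lsum\<close> on families of offspring numbers, where the
  subtrees are independent by construction; \<open>lsum_tree_of\<close> translates back.\<close>

primrec psum :: "nat \<Rightarrow> ((nat list \<Rightarrow> nat) \<Rightarrow> 'a::comm_monoid_add) \<Rightarrow> (nat list \<Rightarrow> nat) \<Rightarrow> 'a" where
  "psum 0 g = g"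
| "psum (Suc k) g = (\<lambda>N. \<Sum>i<N []. psum k g (\<lambda>u. N (i # u)))"

lemma psum_Suc_graft: "psum (Suc k) g (graft x y) = (\<Sum>i<x. psum k g (y i))"
  by simp

lemma psum_nonneg:
  fixes g :: "_ \<Rightarrow> real"
  shows "(\<And>N. 0 \<le> g N) \<Longrightarrow> 0 \<le> psum k g N"
  by (induction k arbitrary: N) (auto intro!: sum_nonneg)

lemma psum_mono:
  fixes f g :: "_ \<Rightarrow> 'a::ordered_comm_monoid_add"
  shows "(\<And>N. f N \<le> g N) \<Longrightarrow> psum k f N \<le> psum k g N"
  by (induction k arbitrary: N) (auto intro!: sum_mono)

lemma psum_add: "psum k (\<lambda>N. f N + g N) N = psum k f N + psum k g N"
  by (induction k arbitrary: N) (auto simp: sum.distrib)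

lemma psum_cmult: "psum k (\<lambda>N. c * g N) N = c * psum k g N" for c :: "'a::semiring_0"
  by (induction k arbitrary: N) (auto simp: sum_distrib_left)

lemma psum_ennreal: "(\<And>N. 0 \<le> g N) \<Longrightarrow> psum k (\<lambda>N. ennreal (g N)) N = ennreal (psum k g N)"
  by (induction k arbitrary: N) (auto simp: psum_nonneg)

text \<open>For \<open>a\<close> the indicator of large terms: if none occurs in generation
  \<open>k\<close>, the truncated sum is the original one.\<close>

lemma psum_eq_where_zero:
  fixes a h :: "_ \<Rightarrow> ennreal"
  assumes "\<And>N. a N = 0 \<Longrightarrow> h N = ennreal (f N)" "\<And>N. 0 \<le> f N" "psum k a N = 0"
  shows "psum k h N = ennreal (psum k f N)"
  using assms(3) by (induction k arbitrary: N) (auto simp: assms(1,2) psum_nonneg)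

text \<open>The sum counts vertices. The gap between 0 and 1 is what lets a finite total over all
  generations imply that the count is eventually zero.\<close>

lemma psum_indicator_cases: "psum k (indicator A) N = (0::ennreal) \<or> 1 \<le> psum k (indicator A :: _ \<Rightarrow> ennreal) N"
proof (induction k arbitrary: N)
  case (Suc k)
  show ?case
  proof (cases "\<exists>i<N []. psum k (indicator A) (\<lambda>u. N (i # u)) \<noteq> (0::ennreal)")
    case True
    then obtain i where i: "i < N []" "psum k (indicator A) (\<lambda>u. N (i # u)) \<noteq> (0::ennreal)" by blast
    then have "1 \<le> psum k (indicator A :: _ \<Rightarrow> ennreal) (\<lambda>u. N (i # u))" using Suc by blast
    also have "\<dots> \<le> psum (Suc k) (indicator A) N"
      using i by (auto intro!: member_le_sum)
    finally show ?thesis ..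
  qed simp
qed (auto simp: indicator_def)

lemma integral_sum_square_iid:
  fixes f :: "'a \<Rightarrow> real" and n :: nat
  assumes M: "prob_space M" and f: "f \<in> borel_measurable M" "integrable M (\<lambda>x. (f x)\<^sup>2)" "(\<integral>x. f x \<partial>M) = 0"
  shows "integrable (\<Pi>\<^sub>M i\<in>UNIV. M) (\<lambda>y. (\<Sum>i<n. f (y i))\<^sup>2)"
    and "(\<integral>y. (\<Sum>i<n. f (y i))\<^sup>2 \<partial>(\<Pi>\<^sub>M i\<in>UNIV. M)) = n * (\<integral>x. (f x)\<^sup>2 \<partial>M)"
    and "(\<integral>y. (\<Sum>i<n. f (y i)) \<partial>(\<Pi>\<^sub>M i\<in>UNIV. M)) = 0"
proof -
  interpret M: prob_space M by fact
  interpret product_prob_space "\<lambda>_. M" "UNIV :: nat set" by unfold_locales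
  let ?S = "\<Pi>\<^sub>M i\<in>(UNIV :: nat set). M"
  note [measurable] = f(1)
  have f_int: "integrable M f" by (rule M.square_integrable_imp_integrable[OF f(1,2)])
  have comp: "distr ?S M (\<lambda>y. y i) = M" for i using PiM_component[of i] by simp
  have int: "integrable ?S (\<lambda>y. g (y i)) \<longleftrightarrow> integrable M g" "(\<integral>y. g (y i) \<partial>?S) = (\<integral>x. g x \<partial>M)"
    if "g \<in> borel_measurable M" for g :: "'a \<Rightarrow> real" and i
    using integrable_distr_eq[of "\<lambda>y. y i" ?S M g] integral_distr[of "\<lambda>y. y i" ?S M g] that comp[of i] by auto
  have "P.indep_vars (\<lambda>_. M) (\<lambda>i y. y i) UNIV"
    by (subst P.indep_vars_iff_distr_eq_PiM) (auto simp: comp distr_id2 restrict_UNIV)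
  then have ind: "P.indep_vars (\<lambda>_. borel) (\<lambda>i y. f (y i)) UNIV"
    by (rule P.indep_vars_compose2) simp
  have cross: "integrable ?S (\<lambda>y. f (y i) * f (y j)) \<and> (\<integral>y. f (y i) * f (y j) \<partial>?S) = (if i = j then \<integral>x. (f x)\<^sup>2 \<partial>M else 0)" for i j
  proof (cases "i = j")
    case True
    then show ?thesis using int[of "\<lambda>x. (f x)\<^sup>2" i] f by (simp add: power2_eq_square)
  next
    case False
    have "P.indep_vars (\<lambda>_. borel) (\<lambda>i y. f (y i)) {i, j}"
      using ind by (rule P.indep_vars_subset) simp
    note this' = P.indep_vars_lebesgue_integral[OF _ this] P.indep_vars_integrable[OF _ this]
    show ?thesis using this' False int[of f] f_int f by simp
  qed
  have sq: "(\<Sum>i<n. f (y i))\<^sup>2 = (\<Sum>i<n. \<Sum>j<n. f (y i) * f (y j))" for y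
    by (simp add: power2_eq_square sum_product)
  show "integrable ?S (\<lambda>y. (\<Sum>i<n. f (y i))\<^sup>2)"
    unfolding sq using cross by (intro Bochner_Integration.integrable_sum) blast
  show "(\<integral>y. (\<Sum>i<n. f (y i))\<^sup>2 \<partial>?S) = n * (\<integral>x. (f x)\<^sup>2 \<partial>M)"
  proof -
    have "(\<integral>y. (\<Sum>i<n. f (y i))\<^sup>2 \<partial>?S) = (\<Sum>i<n. \<Sum>j<n. \<integral>y. f (y i) * f (y j) \<partial>?S)"
      unfolding sq using cross by (subst Bochner_Integration.integral_sum; (intro Bochner_Integration.integrable_sum)?)
        (auto intro!: sum.cong Bochner_Integration.integral_sum)
    also have "\<dots> = (\<Sum>i<n. \<Sum>j<n. if i = j then \<integral>x. (f x)\<^sup>2 \<partial>M else 0)"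
      by (intro sum.cong refl conjunct2[OF cross])
    also have "\<dots> = n * (\<integral>x. (f x)\<^sup>2 \<partial>M)" by simp
    finally show ?thesis .
  qed
  have "(\<integral>y. (\<Sum>i<n. f (y i)) \<partial>?S) = (\<Sum>i<n. \<integral>y. f (y i) \<partial>?S)"
    using int(1)[of f] f_int f(1) by (intro Bochner_Integration.integral_sum) blast
  also have "\<dots> = 0" using int(2)[OF f(1)] f(3) by simp
  finally show "(\<integral>y. (\<Sum>i<n. f (y i)) \<partial>?S) = 0" .
qed

lemma nn_integral_PiM_component:
  assumes M: "prob_space M" and [measurable]: "f \<in> borel_measurable M"
  shows "(\<integral>\<^sup>+y. f (y i) \<partial>(\<Pi>\<^sub>M i\<in>UNIV. M)) = (\<integral>\<^sup>+x. f x \<partial>M)"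
proof -
  interpret M: prob_space M by fact
  interpret product_prob_space "\<lambda>_. M" "UNIV :: 'b set" by unfold_locales
  have "distr (\<Pi>\<^sub>M i\<in>(UNIV :: 'b set). M) M (\<lambda>y. y i) = M" using PiM_component[of i] by simp
  then show ?thesis
    using nn_integral_distr[of "\<lambda>y. y i" "\<Pi>\<^sub>M i\<in>(UNIV :: 'b set). M" M f] by simp
qed

locale offspring =
  fixes q :: "nat pmf" and m :: real
  assumes mean: "(\<lambda>n. real n * pmf q n) sums m"
    and no_death: "pmf q 0 = 0"
    and nondegenerate: "pmf q 1 \<noteq> 1"
    and second_moment: "summable (\<lambda>n. (real n)\<^sup>2 * pmf q n)"
begin

abbreviation \<Omega> :: "(nat list \<Rightarrow> nat) measure" where
  "\<Omega> \<equiv> labels (measure_pmf q)"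

abbreviation \<Sigma> :: "(nat \<Rightarrow> nat list \<Rightarrow> nat) measure" where
  "\<Sigma> \<equiv> label_seqs (measure_pmf q)"

sublocale \<Omega>: prob_space \<Omega>
  by (intro prob_space_PiM prob_space_measure_pmf)

sublocale \<Sigma>: prob_space \<Sigma>
  by (intro prob_space_PiM prob_space_measure_pmf)

lemma space_\<Omega> [simp]: "space \<Omega> = UNIV" "space \<Sigma> = UNIV"
  by (auto simp: space_PiM)

lemma nn_integral_offspring: "(\<integral>\<^sup>+n. ennreal (real n) \<partial>measure_pmf q) = ennreal m"
proof -
  have "(\<integral>\<^sup>+n. ennreal (real n) \<partial>measure_pmf q) = (\<Sum>n. ennreal (real n * pmf q n))"
    by (simp add: nn_integral_measure_pmf nn_integral_count_space_nat ennreal_mult mult.commute)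
  also have "\<dots> = ennreal m"
    using mean by (intro suminf_ennreal_eq) auto
  finally show ?thesis .
qed

lemma integrable_offspring: "integrable (measure_pmf q) (\<lambda>n. real n)" "(\<integral>n. real n \<partial>measure_pmf q) = m"
proof -
  have m: "0 \<le> m" using sums_le[OF _ sums_zero mean] by simp
  have h: "has_bochner_integral (measure_pmf q) (\<lambda>n. real n) m"
    using nn_integral_offspring m by (intro has_bochner_integral_nn_integral) auto
  show "integrable (measure_pmf q) (\<lambda>n. real n)" "(\<integral>n. real n \<partial>measure_pmf q) = m"
    using h by (auto simp: has_bochner_integral_iff)
qed

lemma integrable_offspring_square: "integrable (measure_pmf q) (\<lambda>n. (real n)\<^sup>2)"
proof (rule integrableI_bounded)
  have "(\<integral>\<^sup>+n. ennreal (norm ((real n)\<^sup>2)) \<partial>measure_pmf q) = (\<Sum>n. ennreal ((real n)\<^sup>2 * pmf q n))"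
    by (simp add: nn_integral_measure_pmf nn_integral_count_space_nat ennreal_mult mult.commute)
  also have "\<dots> = ennreal (\<Sum>n. (real n)\<^sup>2 * pmf q n)"
    using second_moment by (intro suminf_ennreal_eq summable_sums) auto
  finally show "(\<integral>\<^sup>+n. ennreal (norm ((real n)\<^sup>2)) \<partial>measure_pmf q) < \<infinity>" by simp
qed simp

lemma AE_offspring_pos: "AE n in measure_pmf q. n \<ge> 1"
  unfolding AE_measure_pmf_iff
proof
  fix n assume "n \<in> set_pmf q"
  then have "n \<noteq> 0" using no_death by (metis set_pmf_iff)
  then show "n \<ge> 1" by simp
qed

lemma offspring_eq_1: "\<not> (AE n in measure_pmf q. n = 1)"
proof
  assume "AE n in measure_pmf q. n = 1"
  then have "set_pmf q \<subseteq> {1}" by (auto simp: AE_measure_pmf_iff)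
  then have "q = return_pmf 1" by (simp only: set_pmf_subset_singleton)
  then have "pmf q 1 = 1" by simp
  then show False using nondegenerate by contradiction
qed

lemma mean_gt_1: "m > 1"
proof (rule ccontr)
  assume "\<not> m > 1"
  have int: "integrable (measure_pmf q) (\<lambda>n. real n - 1)" using integrable_offspring by simp
  have nn: "AE n in measure_pmf q. 0 \<le> real n - 1" using AE_offspring_pos by eventually_elim auto
  have "(\<integral>n. real n - 1 \<partial>measure_pmf q) = m - 1" using integrable_offspring by simp
  then have "(\<integral>n. real n - 1 \<partial>measure_pmf q) = 0"
    using \<open>\<not> m > 1\<close> integral_nonneg_AE[OF nn] by simp
  then have "AE n in measure_pmf q. real n - 1 = 0"
    using integral_nonneg_eq_0_iff_AE[OF int nn] by simp
  then have "AE n in measure_pmf q. n = 1" by eventually_elim auto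
  then show False using offspring_eq_1 by blast
qed

lemma measurable_coordinate [measurable]: "(\<lambda>N. N v) \<in> measurable \<Omega> (count_space UNIV)"
proof -
  have "(\<lambda>N. N v) \<in> measurable \<Omega> (measure_pmf q)" by (rule measurable_component_singleton) simp
  then show ?thesis
    by (subst measurable_cong_sets[OF refl, of "count_space UNIV" "measure_pmf q"]) simp_all
qed

lemma measurable_shift [measurable]: "(\<lambda>N u. N (i # u)) \<in> measurable \<Omega> \<Omega>"
  by (rule measurable_PiM_single') (simp_all add: space_PiM measurable_coordinate)

lemma measurable_psum [measurable]:
  fixes g :: "_ \<Rightarrow> 'b::{second_countable_topology, topological_comm_monoid_add}"
  assumes g: "g \<in> borel_measurable \<Omega>" shows "psum k g \<in> borel_measurable \<Omega>"
proof (induction k)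
  case (Suc k)
  have "(\<lambda>N. \<Sum>i<n. psum k g (\<lambda>u. N (i # u))) \<in> borel_measurable \<Omega>" for n
    by (intro borel_measurable_sum measurable_compose[OF measurable_shift Suc])
  from measurable_compose_countable[OF this measurable_coordinate[of "[]"]] show ?case by simp
qed (simp add: g)

lemma nn_integral_psum:
  assumes g [measurable]: "g \<in> borel_measurable \<Omega>"
  shows "(\<integral>\<^sup>+N. psum k g N \<partial>\<Omega>) = ennreal (m ^ k) * (\<integral>\<^sup>+N. g N \<partial>\<Omega>)"
proof (induction k)
  case (Suc k)
  have "(\<integral>\<^sup>+N. psum (Suc k) g N \<partial>\<Omega>) = (\<integral>\<^sup>+x. \<integral>\<^sup>+y. psum (Suc k) g (graft x y) \<partial>\<Sigma> \<partial>measure_pmf q)"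
    by (rule nn_integral_labels[OF prob_space_measure_pmf]) measurable
  also have "\<dots> = (\<integral>\<^sup>+x. ennreal (real x) * (\<integral>\<^sup>+N. psum k g N \<partial>\<Omega>) \<partial>measure_pmf q)"
  proof (intro nn_integral_cong)
    fix x
    have "(\<integral>\<^sup>+y. psum (Suc k) g (graft x y) \<partial>\<Sigma>) = (\<Sum>i<x. \<integral>\<^sup>+y. psum k g (y i) \<partial>\<Sigma>)"
      unfolding psum_Suc_graft by (rule nn_integral_sum) measurable
    also have "\<dots> = (\<Sum>i<x. \<integral>\<^sup>+N. psum k g N \<partial>\<Omega>)"
      by (intro sum.cong refl nn_integral_PiM_component \<Omega>.prob_space_axioms) measurable
    finally show "(\<integral>\<^sup>+y. psum (Suc k) g (graft x y) \<partial>\<Sigma>) = ennreal (real x) * (\<integral>\<^sup>+N. psum k g N \<partial>\<Omega>)"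
      by (simp add: ennreal_of_nat_eq_real_of_nat)
  qed
  also have "\<dots> = ennreal m * (\<integral>\<^sup>+N. psum k g N \<partial>\<Omega>)"
    by (subst nn_integral_multc) (auto simp: nn_integral_offspring)
  also have "\<dots> = ennreal (m ^ Suc k) * (\<integral>\<^sup>+N. g N \<partial>\<Omega>)"
    using mean_gt_1 by (simp add: Suc ennreal_mult mult.assoc)
  finally show ?case .
qed simp

text \<open>Given \<open>x\<close> children, the sum is one of \<open>x\<close> independent centred
  terms, so the cross terms vanish and the second moment is multiplied by \<open>x\<close>;
  averaging gives one factor \<open>m\<close> per generation.\<close>

lemma psum_centered:
  fixes g :: "_ \<Rightarrow> real"
  assumes g [measurable]: "g \<in> borel_measurable \<Omega>" and sq: "integrable \<Omega> (\<lambda>N. (g N)\<^sup>2)" and zero: "(\<integral>N. g N \<partial>\<Omega>) = 0"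
  shows "integrable \<Omega> (\<lambda>N. (psum k g N)\<^sup>2) \<and> (\<integral>N. (psum k g N)\<^sup>2 \<partial>\<Omega>) = m ^ k * (\<integral>N. (g N)\<^sup>2 \<partial>\<Omega>)
    \<and> (\<integral>N. psum k g N \<partial>\<Omega>) = 0"
proof (induction k)
  case (Suc k)
  let ?f = "psum k g"
  note iid = integral_sum_square_iid[OF \<Omega>.prob_space_axioms measurable_psum[OF g, of k]]
  define e where "e = (\<integral>N. (?f N)\<^sup>2 \<partial>\<Omega>)"
  have e: "0 \<le> e" by (simp add: e_def integral_nonneg)
  have "(\<integral>\<^sup>+N. ennreal ((psum (Suc k) g N)\<^sup>2) \<partial>\<Omega>)
     = (\<integral>\<^sup>+x. \<integral>\<^sup>+y. ennreal ((psum (Suc k) g (graft x y))\<^sup>2) \<partial>\<Sigma> \<partial>measure_pmf q)"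
    by (rule nn_integral_labels[OF prob_space_measure_pmf]) measurable
  also have "\<dots> = (\<integral>\<^sup>+x. ennreal (real x * e) \<partial>measure_pmf q)"
    unfolding psum_Suc_graft e_def using Suc
    by (intro nn_integral_cong) (subst nn_integral_eq_integral, auto simp: iid)
  also have "\<dots> = ennreal m * ennreal e"
    using e by (simp add: ennreal_mult nn_integral_multc nn_integral_offspring)
  also have "\<dots> = ennreal (m * e)" using mean_gt_1 e by (simp add: ennreal_mult)
  finally have nn: "(\<integral>\<^sup>+N. ennreal ((psum (Suc k) g N)\<^sup>2) \<partial>\<Omega>) = ennreal (m * e)" .
  have "has_bochner_integral \<Omega> (\<lambda>N. (psum (Suc k) g N)\<^sup>2) (m * e)"
    using nn mean_gt_1 e measurable_psum[OF g, of "Suc k"] 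
    by (intro has_bochner_integral_nn_integral) (auto simp del: psum.simps)
  then have sq': "integrable \<Omega> (\<lambda>N. (psum (Suc k) g N)\<^sup>2)" "(\<integral>N. (psum (Suc k) g N)\<^sup>2 \<partial>\<Omega>) = m * e"
    by (simp_all add: has_bochner_integral_iff del: psum.simps)
  have "integrable \<Omega> (psum (Suc k) g)"
    by (rule \<Omega>.square_integrable_imp_integrable[OF measurable_psum[OF g] sq'(1)])
  then have "(\<integral>N. psum (Suc k) g N \<partial>\<Omega>) = (\<integral>x. \<integral>y. psum (Suc k) g (graft x y) \<partial>\<Sigma> \<partial>measure_pmf q)"
    by (rule integral_labels[OF prob_space_measure_pmf])
  also have "\<dots> = 0"
    unfolding psum_Suc_graft using Suc by (simp add: iid(3))
  finally show ?case using sq' Suc by (simp add: e_def del: psum.simps)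
qed (use sq zero in simp)

end

section \<open>Second moment estimates for the normalized generation sizes\<close>

context offspring
begin

abbreviation gsize :: "nat \<Rightarrow> (nat list \<Rightarrow> nat) \<Rightarrow> real" where
  "gsize n \<equiv> psum n (\<lambda>_. 1)"

abbreviation excess :: "nat \<Rightarrow> (nat list \<Rightarrow> nat) \<Rightarrow> real" where
  "excess n \<equiv> psum n (\<lambda>N. real (N []) - m)"

lemma gsize_Suc: "gsize (Suc n) N = m * gsize n N + excess n N"
proof (induction n arbitrary: N)
  case (Suc n)
  have "gsize (Suc (Suc n)) N = (\<Sum>i<N []. gsize (Suc n) (\<lambda>u. N (i # u)))" by simp
  also have "\<dots> = (\<Sum>i<N []. m * gsize n (\<lambda>u. N (i # u)) + excess n (\<lambda>u. N (i # u)))"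
    by (intro sum.cong refl Suc)
  also have "\<dots> = m * gsize (Suc n) N + excess (Suc n) N"
    by (simp add: sum.distrib sum_distrib_left)
  finally show ?case .
qed simp

text \<open>The normalized generation size as a martingale written as the sum of its
  increments.\<close>

lemma gsize_eq: "gsize n N / m ^ n = 1 + (\<Sum>j<n. excess j N / m ^ Suc j)"
proof (induction n)
  case (Suc n)
  have "gsize (Suc n) N / m ^ Suc n = gsize n N / m ^ n + excess n N / m ^ Suc n"
    unfolding gsize_Suc using mean_gt_1 by (simp add: field_simps)
  with Suc show ?case by simp
qed simp

lemma measurable_gsize [measurable]: "gsize n \<in> borel_measurable \<Omega>"
  by (rule measurable_psum) simp

lemma measurable_excess [measurable]: "excess n \<in> borel_measurable \<Omega>"
  by (rule measurable_psum) simp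

text \<open>The excess in generation \<open>j\<close> has second moment of order \<open>m ^ j = t ^ (4 * j)\<close>. Dividing its square by
  \<open>t ^ (6 * j)\<close> keeps the expectations summable, and the complementary weights
  \<open>t ^ (3 * j) / m ^ Suc j\<close> in the Cauchy-Schwarz inequality are still square summable.\<close>

definition t :: real where "t = root 4 m"

lemma t: "t > 1" "t ^ 4 = m"
  using mean_gt_1 by (auto simp: t_def)

lemma weight_le: "(t ^ (3 * j) / m ^ Suc j)\<^sup>2 \<le> (1 / t\<^sup>2) ^ j"
proof -
  have m: "m ^ Suc j = t ^ (4 * Suc j)" by (simp only: power_mult t(2))
  have "(t ^ (3 * j) / m ^ Suc j)\<^sup>2 = t ^ (3 * j * 2) / t ^ (4 * Suc j * 2)"
    by (simp only: m power_divide power_mult[symmetric])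
  also have "\<dots> \<le> t ^ (3 * j * 2) / t ^ (3 * j * 2 + 2 * j)"
    using t(1) by (intro divide_left_mono power_increasing) auto
  also have "\<dots> = t ^ (3 * j * 2) / (t ^ (3 * j * 2) * (t\<^sup>2) ^ j)"
    by (simp only: power_add power_mult)
  also have "\<dots> = (1 / t\<^sup>2) ^ j"
    using t(1) by (simp add: power_one_over divide_simps)
  finally show ?thesis .
qed

lemma summable_weight: "summable (\<lambda>j. (1 / t\<^sup>2) ^ j)"
  using t by (intro summable_geometric) (auto simp: power_less_one_iff)

lemma integrable_root_excess:
  "integrable \<Omega> (\<lambda>N. (real (N []) - m)\<^sup>2)" "(\<integral>N. real (N []) - m \<partial>\<Omega>) = 0"
proof -
  interpret product_prob_space "\<lambda>_. measure_pmf q" "UNIV :: nat list set" by unfold_locales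
  have d: "distr \<Omega> (measure_pmf q) (\<lambda>N. N []) = measure_pmf q" using PiM_component[of "[]"] by simp
  have meas: "(\<lambda>N. N []) \<in> measurable \<Omega> (measure_pmf q)" by (rule measurable_component_singleton) simp
  have "integrable (measure_pmf q) (\<lambda>n. (real n)\<^sup>2 - 2 * m * real n + m\<^sup>2)"
    using integrable_offspring integrable_offspring_square by simp
  then have "integrable (measure_pmf q) (\<lambda>n. (real n - m)\<^sup>2)"
    by (simp add: power2_diff algebra_simps)
  then have "integrable (distr \<Omega> (measure_pmf q) (\<lambda>N. N [])) (\<lambda>n. (real n - m)\<^sup>2)" by (simp only: d)
  then show "integrable \<Omega> (\<lambda>N. (real (N []) - m)\<^sup>2)"
    by (rule integrable_distr[OF meas])
  have "(\<integral>N. real (N []) - m \<partial>\<Omega>) = (\<integral>n. real n - m \<partial>distr \<Omega> (measure_pmf q) (\<lambda>N. N []))"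
    by (rule integral_distr[OF meas, symmetric]) simp
  also have "\<dots> = 0" unfolding d using integrable_offspring by simp
  finally show "(\<integral>N. real (N []) - m \<partial>\<Omega>) = 0" .
qed

lemma excess_moments:
  "integrable \<Omega> (\<lambda>N. (excess j N)\<^sup>2)"
  "(\<integral>N. (excess j N)\<^sup>2 \<partial>\<Omega>) = m ^ j * (\<integral>N. (real (N []) - m)\<^sup>2 \<partial>\<Omega>)"
  using psum_centered[of "\<lambda>N. real (N []) - m" j] integrable_root_excess by auto

definition dev :: "(nat list \<Rightarrow> nat) \<Rightarrow> ennreal" where
  "dev N = (\<Sum>j. ennreal ((excess j N)\<^sup>2 / t ^ (6 * j)))"

text \<open>An explicit bound for the maximal function of the squared martingale:
  \<open>(1 + S)^2 \<le> 2 + 2 * S^2\<close> for the sum \<open>S\<close> of the increments, and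
  \<open>S^2\<close> is bounded by Cauchy-Schwarz through the weighted sum \<open>dev\<close>,
  uniformly in the number of increments.\<close>

definition majorant :: "(nat list \<Rightarrow> nat) \<Rightarrow> ennreal" where
  "majorant N = 2 + ennreal (2 * (\<Sum>j. (1 / t\<^sup>2) ^ j)) * dev N"

lemma measurable_dev [measurable]: "dev \<in> borel_measurable \<Omega>"
  unfolding dev_def by measurable

lemma measurable_majorant [measurable]: "majorant \<in> borel_measurable \<Omega>"
  unfolding majorant_def by measurable

lemma gsize_square_le_majorant: "ennreal ((gsize n N / m ^ n)\<^sup>2) \<le> majorant N"
proof -
  define A where "A = (\<Sum>j<n. (excess j N)\<^sup>2 / t ^ (6 * j))"
  define W where "W = (\<Sum>j. (1 / t\<^sup>2) ^ j)"
  define S where "S = (\<Sum>j<n. excess j N / m ^ Suc j)"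
  have A: "0 \<le> A" using t by (auto simp: A_def intro!: sum_nonneg)
  have W: "0 \<le> W" using t by (auto simp: W_def intro!: suminf_nonneg summable_weight)
  have "S = (\<Sum>j<n. excess j N / t ^ (3 * j) * (t ^ (3 * j) / m ^ Suc j))"
    using t by (simp add: S_def)
  then have "S\<^sup>2 \<le> (\<Sum>j<n. (excess j N / t ^ (3 * j))\<^sup>2) * (\<Sum>j<n. (t ^ (3 * j) / m ^ Suc j)\<^sup>2)"
    by (simp only: Cauchy_Schwarz_ineq_sum)
  also have "(\<Sum>j<n. (excess j N / t ^ (3 * j))\<^sup>2) = A"
    by (simp add: A_def power_divide mult.commute flip: power_mult)
  also have "A * (\<Sum>j<n. (t ^ (3 * j) / m ^ Suc j)\<^sup>2) \<le> A * W"
  proof (intro mult_left_mono A)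
    have "(\<Sum>j<n. (t ^ (3 * j) / m ^ Suc j)\<^sup>2) \<le> (\<Sum>j<n. (1 / t\<^sup>2) ^ j)"
      by (intro sum_mono weight_le)
    also have "\<dots> \<le> W" unfolding W_def by (intro sum_le_suminf summable_weight) auto
    finally show "(\<Sum>j<n. (t ^ (3 * j) / m ^ Suc j)\<^sup>2) \<le> W" .
  qed
  finally have S: "S\<^sup>2 \<le> A * W" .
  have "(gsize n N / m ^ n)\<^sup>2 = (1 + S)\<^sup>2" by (simp only: gsize_eq S_def)
  also have "\<dots> \<le> 2 + 2 * S\<^sup>2"
    using zero_le_power2[of "1 - S"] by (simp add: power2_eq_square algebra_simps)
  also have "\<dots> \<le> 2 + 2 * W * A" using S by (simp add: mult.commute)
  finally have "ennreal ((gsize n N / m ^ n)\<^sup>2) \<le> ennreal (2 + 2 * W * A)" by (rule ennreal_leI)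
  also have "\<dots> = 2 + ennreal (2 * W) * ennreal A"
    using W A by (simp add: ennreal_plus ennreal_mult)
  also have "ennreal A \<le> dev N"
  proof -
    have "ennreal A = (\<Sum>j<n. ennreal ((excess j N)\<^sup>2 / t ^ (6 * j)))"
      unfolding A_def using t by (intro sum_ennreal[symmetric]) auto
    also have "\<dots> \<le> dev N" unfolding dev_def by (rule sum_le_suminf) auto
    finally show ?thesis .
  qed
  finally show ?thesis by (simp add: majorant_def W_def add_left_mono mult_left_mono)
qed

lemma nn_integral_majorant: "(\<integral>\<^sup>+N. majorant N \<partial>\<Omega>) < \<infinity>"
proof -
  let ?v = "\<integral>N. (real (N []) - m)\<^sup>2 \<partial>\<Omega>"
  have v: "0 \<le> ?v" by (simp add: integral_nonneg)
  have "(\<integral>\<^sup>+N. dev N \<partial>\<Omega>) = (\<Sum>j. \<integral>\<^sup>+N. ennreal ((excess j N)\<^sup>2 / t ^ (6 * j)) \<partial>\<Omega>)"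
    unfolding dev_def by (rule nn_integral_suminf) measurable
  also have "\<dots> = (\<Sum>j. ennreal (?v * (1 / t\<^sup>2) ^ j))"
  proof (intro arg_cong[where f = suminf] ext)
    fix j
    have "(\<integral>\<^sup>+N. ennreal ((excess j N)\<^sup>2 / t ^ (6 * j)) \<partial>\<Omega>) = ennreal (\<integral>N. (excess j N)\<^sup>2 / t ^ (6 * j) \<partial>\<Omega>)"
      using excess_moments(1)[of j] t by (intro nn_integral_eq_integral) auto
    also have "(\<integral>N. (excess j N)\<^sup>2 / t ^ (6 * j) \<partial>\<Omega>) = t ^ (4 * j) * ?v / t ^ (6 * j)"
      using excess_moments(2)[of j] by (simp add: power_mult t(2))
    also have "\<dots> = ?v * (1 / t\<^sup>2) ^ j"
    proof -
      have "t ^ (6 * j) = t ^ (4 * j + 2 * j)" by simp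
      also have "\<dots> = t ^ (4 * j) * (t\<^sup>2) ^ j" by (simp only: power_add power_mult)
      finally show ?thesis using t(1) by (simp add: power_one_over divide_simps)
    qed
    finally show "(\<integral>\<^sup>+N. ennreal ((excess j N)\<^sup>2 / t ^ (6 * j)) \<partial>\<Omega>) = ennreal (?v * (1 / t\<^sup>2) ^ j)" .
  qed
  also have "\<dots> = ennreal (\<Sum>j. ?v * (1 / t\<^sup>2) ^ j)"
    using v t by (intro suminf_ennreal_eq summable_sums summable_mult summable_weight) auto
  finally have "(\<integral>\<^sup>+N. dev N \<partial>\<Omega>) < \<infinity>" by simp
  then show ?thesis
    unfolding majorant_def
    by (subst nn_integral_add) (auto simp: nn_integral_cmult ennreal_mult_less_top \<Omega>.emeasure_space_1[simplified])
qed

lemma AE_majorant_finite: "AE N in \<Omega>. majorant N < \<infinity>"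
  using nn_integral_noteq_infinite[of majorant \<Omega>] nn_integral_majorant by (auto simp: less_top)

text \<open>Finiteness of \<open>dev\<close> already makes the series of increments absolutely
  convergent: each increment is a product of a term of \<open>dev\<close> (before squaring) and a
  weight, and both are square summable.\<close>

lemma gsize_convergent:
  assumes "majorant N < \<infinity>"
  shows "convergent (\<lambda>n. gsize n N / m ^ n)"
proof -
  have "0 < (\<Sum>j. (1 / t\<^sup>2) ^ j)" using t by (intro suminf_pos summable_weight) auto
  then have "dev N \<noteq> top"
    using assms by (auto simp: majorant_def ennreal_mult_top)
  then have "summable (\<lambda>j. (excess j N)\<^sup>2 / t ^ (6 * j))"
    unfolding dev_def using t by (intro summable_suminf_not_top) auto
  then have sm: "summable (\<lambda>j. (excess j N)\<^sup>2 / t ^ (6 * j) + (1 / t\<^sup>2) ^ j)"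
    by (intro summable_add summable_weight)
  have "summable (\<lambda>j. excess j N / m ^ Suc j)"
  proof (rule summable_comparison_test'[OF sm, of 0])
    fix j
    define a where "a = excess j N / t ^ (3 * j)"
    define b where "b = t ^ (3 * j) / m ^ Suc j"
    have "norm (excess j N / m ^ Suc j) = \<bar>a * b\<bar>" using t by (simp add: a_def b_def)
    also have "\<dots> \<le> a\<^sup>2 + b\<^sup>2"
    proof -
      have "2 * \<bar>a\<bar> * \<bar>b\<bar> \<le> a\<^sup>2 + b\<^sup>2" using sum_squares_bound[of "\<bar>a\<bar>" "\<bar>b\<bar>"] by simp
      moreover have "0 \<le> \<bar>a\<bar> * \<bar>b\<bar>" by simp
      ultimately show ?thesis unfolding abs_mult by linarith
    qed
    also have "a\<^sup>2 = (excess j N)\<^sup>2 / t ^ (6 * j)"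
      by (simp add: a_def power_divide mult.commute flip: power_mult)
    also have "b\<^sup>2 \<le> (1 / t\<^sup>2) ^ j" unfolding b_def by (rule weight_le)
    finally show "norm (excess j N / m ^ Suc j) \<le> (excess j N)\<^sup>2 / t ^ (6 * j) + (1 / t\<^sup>2) ^ j" by simp
  qed
  then have "(\<lambda>n. 1 + (\<Sum>j<n. excess j N / m ^ Suc j)) \<longlonglongrightarrow> 1 + (\<Sum>j. excess j N / m ^ Suc j)"
    by (intro tendsto_intros summable_LIMSEQ)
  then show ?thesis unfolding gsize_eq by (rule convergentI)
qed

section \<open>Lower bound on the growth: zero-one law and nondegeneracy of the limit\<close>

lemma gsize_ge_1: "(\<And>v. 1 \<le> N v) \<Longrightarrow> 1 \<le> gsize n N"
proof (induction n arbitrary: N)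
  case (Suc n)
  have "1 \<le> gsize n (\<lambda>u. N (0 # u))" using Suc by simp
  also have "\<dots> \<le> (\<Sum>i<N []. gsize n (\<lambda>u. N (i # u)))"
    using Suc.prems[of "[]"] by (intro member_le_sum) (auto simp: psum_nonneg)
  finally show ?case by simp
qed simp

lemma AE_no_death: "AE N in \<Omega>. \<forall>v. 1 \<le> N v"
proof -
  have "AE N in \<Omega>. 1 \<le> N v" for v
    by (rule AE_PiM_component[where P = "\<lambda>n. 1 \<le> n"]) (use AE_offspring_pos prob_space_measure_pmf in simp_all)
  then show ?thesis by (simp add: AE_all_countable)
qed

text \<open>The failure of the lower bound in \<open>regular_growth\<close>; equivalently, the
  normalized generation sizes have infimum 0.\<close>

definition slow :: "(nat list \<Rightarrow> nat) \<Rightarrow> bool" where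
  "slow N \<longleftrightarrow> (\<forall>C::nat. \<exists>n. real C * gsize n N < m ^ n)"

lemma measurable_slow [measurable]: "Measurable.pred \<Omega> slow"
  unfolding slow_def[abs_def] by measurable

lemma sets_slow: "Collect slow \<in> sets \<Omega>"
  using measurable_slow by (simp add: pred_def)

text \<open>If one child's subtree does not grow slowly, neither does the whole tree, as its
  generations contain those of the subtree one step later.\<close>

lemma slow_graft: "slow (graft x y) \<Longrightarrow> i < x \<Longrightarrow> slow (y i)"
proof (rule ccontr)
  assume s: "slow (graft x y)" "i < x" and "\<not> slow (y i)"
  then obtain C :: nat where C: "\<And>n. m ^ n \<le> C * gsize n (y i)"
    by (auto simp: slow_def not_less)
  have "C \<ge> 1" using C[of 0] by (cases C) auto
  \<comment> \<open>The shift by one generation costs a factor \<open>m\<close>, rounded up to stay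
    natural. Generation 0 is covered by \<open>C \<ge> 1\<close>.\<close>
  define C' where "C' = nat \<lceil>m\<rceil> * C"
  have mC: "m * C \<le> C'" unfolding C'_def of_nat_mult by (intro mult_right_mono) linarith+
  obtain n where n: "C' * gsize n (graft x y) < m ^ n" using s(1) by (auto simp: slow_def)
  show False
  proof (cases n)
    case 0
    have "1 * 1 \<le> m * C" using mean_gt_1 \<open>C \<ge> 1\<close> by (intro mult_mono) auto
    then show False using n 0 mC by simp
  next
    case (Suc k)
    have "m ^ n \<le> m * (C * gsize k (y i))" using C[of k] mean_gt_1 Suc by simp
    also have "\<dots> \<le> C' * gsize k (y i)"
      using mult_right_mono[OF mC, of "gsize k (y i)"] by (simp add: mult.assoc psum_nonneg)
    also have "gsize k (y i) \<le> gsize n (graft x y)"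
      unfolding Suc psum_Suc_graft using \<open>i < x\<close> by (intro member_le_sum) (auto simp: psum_nonneg)
    then have "C' * gsize k (y i) \<le> C' * gsize n (graft x y)" by (intro mult_left_mono) auto
    finally show False using n by simp
  qed
qed

text \<open>By \<open>slow_graft\<close> the probability \<open>s\<close> of slow growth is at most its image under the offspring
  generating function, which lies strictly below \<open>s\<close> for \<open>0 < s < 1\<close>.\<close>

lemma slow_zero_one: "measure \<Omega> {N \<in> space \<Omega>. slow N} \<in> {0, 1}"
proof -
  define s where "s = measure \<Omega> {N \<in> space \<Omega>. slow N}"
  interpret product_prob_space "\<lambda>_. \<Omega>" "UNIV :: nat set" by unfold_locales
  have s01: "0 \<le> s" "s \<le> 1" by (auto simp: s_def)
  have "ennreal s = (\<integral>\<^sup>+x. emeasure \<Sigma> {y \<in> space \<Sigma>. slow (graft x y)} \<partial>measure_pmf q)"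
    unfolding s_def by (subst emeasure_labels_Collect[OF prob_space_measure_pmf measurable_slow, symmetric])
      (simp add: \<Omega>.emeasure_eq_measure)
  also have "\<dots> \<le> (\<integral>\<^sup>+x. ennreal (s ^ x) \<partial>measure_pmf q)"
  proof (intro nn_integral_mono)
    fix x
    have "{y \<in> space \<Sigma>. \<forall>i\<in>{..<x}. y i \<in> {N \<in> space \<Omega>. slow N}} \<in> sets \<Sigma>"
      by measurable
    then have "emeasure \<Sigma> {y \<in> space \<Sigma>. slow (graft x y)} \<le> emeasure \<Sigma> {y \<in> space \<Sigma>. \<forall>i\<in>{..<x}. y i \<in> {N \<in> space \<Omega>. slow N}}"
      by (intro emeasure_mono) (auto intro: slow_graft)
    also have "\<dots> = (\<Prod>i<x. emeasure \<Omega> {N \<in> space \<Omega>. slow N})"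
      by (rule emeasure_PiM_Collect) (auto simp: sets_slow)
    also have "\<dots> = ennreal (s ^ x)"
      using s01 by (simp add: s_def \<Omega>.emeasure_eq_measure ennreal_power)
    finally show "emeasure \<Sigma> {y \<in> space \<Sigma>. slow (graft x y)} \<le> ennreal (s ^ x)" .
  qed
  also have "\<dots> = ennreal (\<integral>x. s ^ x \<partial>measure_pmf q)"
    using s01 by (intro nn_integral_eq_integral measure_pmf.integrable_const_bound[where B = 1])
      (auto simp: power_le_one)
  finally have le: "s \<le> (\<integral>x. s ^ x \<partial>measure_pmf q)"
    using s01 by (simp add: ennreal_le_iff integral_nonneg)
  have ip: "integrable (measure_pmf q) (\<lambda>x. s ^ x)"
    using s01 by (intro measure_pmf.integrable_const_bound[where B = 1]) (auto simp: power_le_one)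
  have int: "integrable (measure_pmf q) (\<lambda>x. s - s ^ x)" using ip by simp
  have nn: "AE x in measure_pmf q. 0 \<le> s - s ^ x"
    using AE_offspring_pos
  proof eventually_elim
    case (elim x)
    then show ?case using power_decreasing[of 1 x s] s01 by simp
  qed
  have "(\<integral>x. s - s ^ x \<partial>measure_pmf q) = 0"
    using integral_nonneg_AE[OF nn] le ip by simp
  then have eq: "AE x in measure_pmf q. s - s ^ x = 0"
    using integral_nonneg_eq_0_iff_AE[OF int nn] by simp
  have "s = 0 \<or> s = 1"
  proof (rule ccontr)
    assume "\<not> (s = 0 \<or> s = 1)"
    then have s: "0 < s" "s < 1" using s01 by auto
    have "AE x in measure_pmf q. x = 1"
      using eq AE_offspring_pos
    proof eventually_elim
      case (elim x)
      show "x = 1"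
      proof (rule ccontr)
        assume "x \<noteq> 1"
        then have "s ^ x < s ^ 1" using elim s by (intro power_strict_decreasing) auto
        then show False using elim by simp
      qed
    qed
    then show False using offspring_eq_1 by blast
  qed
  then show ?thesis by (auto simp: s_def)
qed

lemma expectation_gsize: "integrable \<Omega> (gsize n)" "(\<integral>N. gsize n N \<partial>\<Omega>) = m ^ n"
proof -
  have "(\<integral>\<^sup>+N. ennreal (gsize n N) \<partial>\<Omega>) = (\<integral>\<^sup>+N. psum n (\<lambda>_. ennreal 1) N \<partial>\<Omega>)"
    by (subst psum_ennreal) auto
  also have "\<dots> = ennreal (m ^ n)"
    by (subst nn_integral_psum) (auto simp: \<Omega>.emeasure_space_1[simplified])
  finally have "has_bochner_integral \<Omega> (gsize n) (m ^ n)"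
    using mean_gt_1 by (intro has_bochner_integral_nn_integral) (auto simp: psum_nonneg)
  then show "integrable \<Omega> (gsize n)" "(\<integral>N. gsize n N \<partial>\<Omega>) = m ^ n"
    by (auto simp: has_bochner_integral_iff)
qed

lemma slow_tendsto_0:
  assumes "majorant N < \<infinity>" "slow N" "\<And>v. 1 \<le> N v"
  shows "(\<lambda>n. gsize n N / m ^ n) \<longlonglongrightarrow> 0"
proof -
  obtain L where L: "(\<lambda>n. gsize n N / m ^ n) \<longlonglongrightarrow> L"
    using gsize_convergent[OF assms(1)] by (auto simp: convergent_def)
  have "L \<ge> 0"
    using mean_gt_1 by (intro LIMSEQ_le_const[OF L]) (auto simp: psum_nonneg)
  moreover have "\<not> L > 0"
  proof
    assume "L > 0"
    then have "eventually (\<lambda>n. gsize n N / m ^ n > L / 2) sequentially"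
      using order_tendstoD(1)[OF L, of "L / 2"] by simp
    then obtain n0 where n0: "\<And>n. n \<ge> n0 \<Longrightarrow> gsize n N / m ^ n > L / 2"
      by (auto simp: eventually_sequentially)
    \<comment> \<open>\<open>2 / L\<close> serves the generations from \<open>n0\<close> on, where
      the ratio exceeds \<open>L / 2\<close>; \<open>m ^ n0\<close> serves the earlier ones, which
      have at least one vertex.\<close>
    obtain C :: nat where C: "max (2 / L) (m ^ n0) \<le> real C" using real_arch_simple by blast
    obtain n where n: "C * gsize n N < m ^ n" using assms(2) by (auto simp: slow_def)
    have g: "1 \<le> gsize n N" using gsize_ge_1[of N n] assms(3) by simp
    have pos: "m ^ n > 0" using mean_gt_1 by simp
    show False
    proof (cases "n \<ge> n0")
      case True
      have "m ^ n * (L / 2) < gsize n N" using n0[OF True] pos by (simp add: field_simps)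
      then have "(2 / L) * (m ^ n * (L / 2)) < (2 / L) * gsize n N" using \<open>L > 0\<close> by (intro mult_strict_left_mono) auto
      also have "\<dots> \<le> C * gsize n N" using C g by (intro mult_right_mono) auto
      finally show False using n \<open>L > 0\<close> by simp
    next
      case False
      then have "m ^ n \<le> m ^ n0 * 1" using mean_gt_1 by (simp add: power_increasing)
      also have "\<dots> \<le> C * gsize n N" using C g by (intro mult_mono) auto
      finally show False using n by simp
    qed
  qed
  ultimately show ?thesis using L by (cases "L = 0") auto
qed

text \<open>If slow growth had probability 1, the normalized sizes would tend to 0 almost surely.
  They have mean 1 and are dominated by \<open>1 + majorant\<close>, so their means would tend to 0
  as well. The zero-one law leaves probability 0.\<close>

lemma AE_not_slow: "AE N in \<Omega>. \<not> slow N"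
proof -
  have "measure \<Omega> {N \<in> space \<Omega>. slow N} \<noteq> 1"
  proof
    assume "measure \<Omega> {N \<in> space \<Omega>. slow N} = 1"
    then have slow: "AE N in \<Omega>. slow N"
      by (subst (asm) \<Omega>.prob_Collect_eq_1) (auto simp: sets_slow)
    have lim: "(\<lambda>n. \<integral>N. gsize n N / m ^ n \<partial>\<Omega>) \<longlonglongrightarrow> (\<integral>N. 0 \<partial>\<Omega>)"
    proof (rule integral_dominated_convergence)
      show "AE N in \<Omega>. (\<lambda>n. gsize n N / m ^ n) \<longlonglongrightarrow> 0"
        using AE_majorant_finite slow AE_no_death by eventually_elim (auto intro: slow_tendsto_0)
      have "integrable \<Omega> (\<lambda>N. enn2real (majorant N))"
      proof (rule integrableI_bounded)
        have "(\<integral>\<^sup>+N. ennreal (norm (enn2real (majorant N))) \<partial>\<Omega>) \<le> (\<integral>\<^sup>+N. majorant N \<partial>\<Omega>)"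
          by (intro nn_integral_mono) (simp add: ennreal_enn2real_if)
        then show "(\<integral>\<^sup>+N. ennreal (norm (enn2real (majorant N))) \<partial>\<Omega>) < \<infinity>"
          using nn_integral_majorant by (rule le_less_trans)
      qed simp
      then show "integrable \<Omega> (\<lambda>N. 1 + enn2real (majorant N))" by simp
      fix n
      show "AE N in \<Omega>. norm (gsize n N / m ^ n) \<le> 1 + enn2real (majorant N)"
        using AE_majorant_finite
      proof eventually_elim
        case (elim N)
        let ?x = "gsize n N / m ^ n"
        have "?x\<^sup>2 \<le> enn2real (majorant N)"
          using enn2real_mono[OF gsize_square_le_majorant, of N n] elim by simp
        moreover have "\<bar>?x\<bar> \<le> 1 + ?x\<^sup>2"
        proof -
          have "(\<bar>?x\<bar> - 1)\<^sup>2 = ?x\<^sup>2 - 2 * \<bar>?x\<bar> + 1" by (simp only: power2_diff power2_abs) simp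
          then show ?thesis using zero_le_power2[of "\<bar>?x\<bar> - 1"] zero_le_power2[of ?x] by linarith
        qed
        ultimately show ?case by simp
      qed
    qed auto
    have E: "(\<integral>N. gsize n N / m ^ n \<partial>\<Omega>) = 1" for n
      using expectation_gsize(2)[of n] mean_gt_1 by simp
    have "(\<lambda>n. 1 :: real) \<longlonglongrightarrow> 0" using lim unfolding E by simp
    from LIMSEQ_unique[OF this tendsto_const] show False by simp
  qed
  then have "measure \<Omega> {N \<in> space \<Omega>. slow N} = 0" using slow_zero_one by auto
  then show ?thesis by (subst (asm) \<Omega>.prob_Collect_eq_0) (auto simp: sets_slow)
qed

end

section \<open>A strong law bound for sums over generations\<close>

lemma eventually_zero_if_suminf_finite:
  fixes f :: "nat \<Rightarrow> ennreal"
  assumes f: "\<And>k. f k = 0 \<or> 1 \<le> f k" and fin: "suminf f \<noteq> top"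
  shows "\<exists>k0. \<forall>k\<ge>k0. f k = 0"
proof -
  have "finite {k. f k \<noteq> 0}"
  proof (rule ccontr)
    assume inf: "infinite {k. f k \<noteq> 0}"
    obtain r where r: "suminf f = ennreal r" "0 \<le> r" using fin by (cases "suminf f") auto
    obtain n :: nat where n: "r < n" using reals_Archimedean2 by blast
    obtain B where B: "finite B" "card B = n" "B \<subseteq> {k. f k \<noteq> 0}"
      using infinite_arbitrarily_large[OF inf] by blast
    have "ennreal n = (\<Sum>k\<in>B. 1)" using B by (simp add: ennreal_of_nat_eq_real_of_nat)
    also have "\<dots> \<le> (\<Sum>k\<in>B. f k)" using B f by (intro sum_mono) blast
    also have "\<dots> \<le> suminf f" using B by (intro sum_le_suminf) auto
    finally have "real n \<le> r" using r by simp
    then show False using n by simp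
  qed
  then obtain k0 where "\<forall>k\<in>{k. f k \<noteq> 0}. k < k0"
    using finite_nat_set_iff_bounded by auto
  then show ?thesis by (meson leD mem_Collect_eq)
qed

text \<open>The powers form a geometric progression, so their sum is at most
  \<open>m / (m - 1)\<close> times the largest one, which is below \<open>r\<close>.\<close>

lemma sum_powers_below:
  fixes m r :: real
  assumes "m > 1" "0 \<le> r"
  shows "(\<Sum>k<n. if m ^ k < r then m ^ k else 0) \<le> m / (m - 1) * r"
proof (induction n)
  case (Suc n)
  show ?case
  proof (cases "m ^ n < r")
    case True
    have "(\<Sum>k<Suc n. if m ^ k < r then m ^ k else 0) \<le> (\<Sum>k<Suc n. m ^ k)"
      using assms by (intro sum_mono) auto
    also have "\<dots> = (m ^ Suc n - 1) / (m - 1)" using assms by (subst geometric_sum) auto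
    also have "\<dots> \<le> m * m ^ n / (m - 1)" using assms by (intro divide_right_mono) auto
    also have "\<dots> = m / (m - 1) * m ^ n" by simp
    also have "\<dots> \<le> m / (m - 1) * r" using assms True by (intro mult_left_mono) auto
    finally show ?thesis .
  qed (use Suc in simp)
qed (use assms in simp)

text \<open>Each nonzero term is a multiple of the drop from \<open>k\<close> to \<open>k + 1\<close> of \<open>min r (r\<^sup>2 / m\<^sup>k)\<close>.\<close>

lemma sum_powers_above:
  fixes m r :: real
  assumes m: "m > 1" and r: "0 \<le> r"
  shows "(\<Sum>k<n. if r \<le> m ^ k then r\<^sup>2 / m ^ k else 0) \<le> m / (m - 1) * r"
proof -
  define u where "u k = min r (r\<^sup>2 / m ^ k)" for k
  have step: "(if r \<le> m ^ k then r\<^sup>2 / m ^ k else 0) \<le> m / (m - 1) * (u k - u (Suc k))" for k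
  proof (cases "r \<le> m ^ k")
    case True
    have pos: "0 < m ^ k" using m by simp
    have "r * r \<le> r * m ^ k" using True r by (intro mult_left_mono)
    then have a: "r\<^sup>2 / m ^ k \<le> r" using pos by (simp add: divide_simps power2_eq_square)
    have b: "r\<^sup>2 / m ^ Suc k \<le> r\<^sup>2 / m ^ k" using m by (intro divide_left_mono power_increasing) auto
    have "u k - u (Suc k) = r\<^sup>2 / m ^ k - r\<^sup>2 / m ^ Suc k" using a b by (simp add: u_def)
    also have "\<dots> = (m - 1) / m * (r\<^sup>2 / m ^ k)" using m by (simp add: field_simps)
    finally have "m / (m - 1) * (u k - u (Suc k)) = r\<^sup>2 / m ^ k" using m by simp
    then show ?thesis using True by simp
  next
    case False
    have "r\<^sup>2 / m ^ Suc k \<le> r\<^sup>2 / m ^ k" using m by (intro divide_left_mono power_increasing) auto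
    then have "u (Suc k) \<le> u k" by (auto simp: u_def)
    then show ?thesis using False m by simp
  qed
  have "(\<Sum>k<n. if r \<le> m ^ k then r\<^sup>2 / m ^ k else 0) \<le> (\<Sum>k<n. m / (m - 1) * (u k - u (Suc k)))"
    by (intro sum_mono step)
  also have "\<dots> = m / (m - 1) * (u 0 - u n)"
    by (simp only: sum_distrib_left[symmetric] sum_lessThan_telescope')
  also have "\<dots> \<le> m / (m - 1) * r"
  proof (intro mult_left_mono)
    have "0 \<le> u n" using m r by (simp add: u_def)
    moreover have "u 0 \<le> r" by (simp add: u_def)
    ultimately show "u 0 - u n \<le> r" by simp
  qed (use m in simp)
  finally show ?thesis .
qed

context offspring
begin

text \<open>A strong law for the terms in a generation, as an upper bound only. Terms above \<open>m ^ k\<close> occur in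
  finitely many generations by Borel-Cantelli, and the rest are controlled by their variance.\<close>

lemma AE_psum_bounded:
  assumes h [measurable]: "h \<in> borel_measurable \<Omega>" and fin: "(\<integral>\<^sup>+N. h N \<partial>\<Omega>) < \<infinity>"
    and growth: "AE N in \<Omega>. \<exists>C. \<forall>n. gsize n N \<le> C * m ^ n"
  shows "AE N in \<Omega>. \<exists>C. \<forall>k. psum k h N \<le> ennreal (C * m ^ k)"
proof -
  define c where "c = m / (m - 1)"
  have c: "0 \<le> c" using mean_gt_1 by (simp add: c_def)
  have mk: "0 < m ^ k" "1 \<le> m ^ k" for k using mean_gt_1 by auto
  have cfin: "(\<integral>\<^sup>+N. ennreal c * h N \<partial>\<Omega>) < \<infinity>"
    using fin by (simp add: nn_integral_cmult ennreal_mult_less_top)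
  \<comment> \<open>The expected number of vertices of generation \<open>k\<close> with a term above
    \<open>m ^ k\<close> is \<open>m ^ k\<close> times the probability of \<open>A k\<close>. By
    \<open>sum_powers_below\<close> these expectations add up to at most \<open>c\<close> times the
    mean of \<open>h\<close>.\<close>
  define A where "A k = {N. ennreal (m ^ k) < h N}" for k
  have A [measurable]: "A k \<in> sets \<Omega>" for k
  proof -
    have "{N \<in> space \<Omega>. ennreal (m ^ k) < h N} \<in> sets \<Omega>" by measurable
    then show ?thesis by (simp add: A_def)
  qed
  have "(\<integral>\<^sup>+N. (\<Sum>k. psum k (indicator (A k)) N) \<partial>\<Omega>) = (\<Sum>k. \<integral>\<^sup>+N. psum k (indicator (A k)) N \<partial>\<Omega>)"
    by (rule nn_integral_suminf) measurable
  also have "\<dots> = (\<Sum>k. \<integral>\<^sup>+N. ennreal (m ^ k) * indicator (A k) N \<partial>\<Omega>)"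
    by (simp add: nn_integral_psum nn_integral_cmult)
  also have "\<dots> = (\<integral>\<^sup>+N. (\<Sum>k. ennreal (m ^ k) * indicator (A k) N) \<partial>\<Omega>)"
    by (rule nn_integral_suminf[symmetric]) measurable
  also have "\<dots> \<le> (\<integral>\<^sup>+N. ennreal c * h N \<partial>\<Omega>)"
  proof (intro nn_integral_mono)
    fix N
    show "(\<Sum>k. ennreal (m ^ k) * indicator (A k) N) \<le> ennreal c * h N"
    proof (cases "h N")
      case (real r)
      have "(\<Sum>k<n. ennreal (m ^ k) * indicator (A k) N) \<le> ennreal c * h N" for n
      proof -
        have "(\<Sum>k<n. ennreal (m ^ k) * indicator (A k) N) = (\<Sum>k<n. ennreal (if m ^ k < r then m ^ k else 0))"
          using real mk by (intro sum.cong refl) (auto simp: A_def indicator_def ennreal_less_iff less_imp_le)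
        also have "\<dots> = ennreal (\<Sum>k<n. if m ^ k < r then m ^ k else 0)"
          using mk by (intro sum_ennreal) (auto intro: less_imp_le)
        also have "\<dots> \<le> ennreal (c * r)"
          unfolding c_def using sum_powers_below[OF mean_gt_1 real(1)] by (rule ennreal_leI)
        finally show ?thesis using real c by (simp add: ennreal_mult)
      qed
      then show ?thesis by (intro suminf_le_const summableI)
    next
      case top
      have "c > 0" using mean_gt_1 by (simp add: c_def)
      then show ?thesis using top by (simp add: ennreal_mult_top)
    qed
  qed
  finally have "(\<integral>\<^sup>+N. (\<Sum>k. psum k (indicator (A k)) N) \<partial>\<Omega>) \<noteq> \<infinity>"
    using cfin by auto
  then have AE1: "AE N in \<Omega>. (\<Sum>k. psum k (indicator (A k)) N) \<noteq> (\<infinity> :: ennreal)"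
    by (intro nn_integral_noteq_infinite) measurable
  define f where "f k N = (if h N \<le> ennreal (m ^ k) then enn2real (h N) else 0)" for k N
  have f [measurable]: "f k \<in> borel_measurable \<Omega>" for k unfolding f_def by measurable
  have fr: "0 \<le> f k N" "f k N \<le> m ^ k" for k N
    using enn2real_mono[of "h N" "ennreal (m ^ k)"] mk[of k] by (auto simp: f_def)
  have fh: "ennreal (f k N) \<le> h N" for k N
    by (auto simp: f_def ennreal_enn2real_if)
  have f_int: "integrable \<Omega> (f k)" for k
    using fr by (intro \<Omega>.integrable_const_bound[where B = "m ^ k"]) auto
  have f2_int: "integrable \<Omega> (\<lambda>N. (f k N)\<^sup>2)" for k
    using fr by (intro \<Omega>.integrable_const_bound[where B = "(m ^ k)\<^sup>2"]) (auto intro!: power_mono)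
  define e where "e k = (\<integral>N. f k N \<partial>\<Omega>)" for k
  have e: "0 \<le> e k" for k using fr by (simp add: e_def integral_nonneg)
  have eH: "e k \<le> enn2real (\<integral>\<^sup>+N. h N \<partial>\<Omega>)" for k
  proof -
    have "ennreal (e k) = (\<integral>\<^sup>+N. ennreal (f k N) \<partial>\<Omega>)"
      unfolding e_def using f_int fr by (intro nn_integral_eq_integral[symmetric]) auto
    also have "\<dots> \<le> (\<integral>\<^sup>+N. h N \<partial>\<Omega>)" by (intro nn_integral_mono fh)
    finally show ?thesis using enn2real_mono[of "ennreal (e k)"] fin e by auto
  qed
  define g where "g k N = f k N - e k" for k N
  have g [measurable]: "g k \<in> borel_measurable \<Omega>" for k unfolding g_def by measurable
  have g_var: "integrable \<Omega> (\<lambda>N. (g k N)\<^sup>2)" "(\<integral>N. (g k N)\<^sup>2 \<partial>\<Omega>) \<le> (\<integral>N. (f k N)\<^sup>2 \<partial>\<Omega>)" "(\<integral>N. g k N \<partial>\<Omega>) = 0" for k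
  proof -
    have eq: "(g k N)\<^sup>2 = (f k N)\<^sup>2 - 2 * e k * f k N + (e k)\<^sup>2" for N
      by (simp add: g_def power2_diff)
    show "integrable \<Omega> (\<lambda>N. (g k N)\<^sup>2)" unfolding eq using f_int f2_int by simp
    have "(\<integral>N. (g k N)\<^sup>2 \<partial>\<Omega>) = (\<integral>N. (f k N)\<^sup>2 \<partial>\<Omega>) - (e k)\<^sup>2"
      unfolding eq using f_int[of k] f2_int[of k] \<Omega>.prob_space by (simp add: e_def[symmetric] power2_eq_square)
    then show "(\<integral>N. (g k N)\<^sup>2 \<partial>\<Omega>) \<le> (\<integral>N. (f k N)\<^sup>2 \<partial>\<Omega>)" by simp
    show "(\<integral>N. g k N \<partial>\<Omega>) = 0"
      unfolding g_def using f_int[of k] \<Omega>.prob_space by (simp add: e_def)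
  qed
  note pg = psum_centered[OF g g_var(1) g_var(3)]
  \<comment> \<open>The second moment of the centred sum over generation \<open>k\<close> is
    \<open>m ^ k\<close> times that of one term. Division by the square of \<open>m ^ k\<close>
    leaves at most the mean of \<open>(f k)^2 / m ^ k\<close>, and \<open>sum_powers_above\<close>
    bounds the sum over \<open>k\<close> pointwise by \<open>c * h\<close>.\<close>
  have "(\<integral>\<^sup>+N. (\<Sum>k. ennreal ((psum k (g k) N)\<^sup>2 / (m ^ k)\<^sup>2)) \<partial>\<Omega>) = (\<Sum>k. \<integral>\<^sup>+N. ennreal ((psum k (g k) N)\<^sup>2 / (m ^ k)\<^sup>2) \<partial>\<Omega>)"
    by (rule nn_integral_suminf) measurable
  also have "\<dots> \<le> (\<Sum>k. \<integral>\<^sup>+N. ennreal ((f k N)\<^sup>2 / m ^ k) \<partial>\<Omega>)"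
  proof (intro suminf_le summableI)
    fix k
    have "(\<integral>\<^sup>+N. ennreal ((psum k (g k) N)\<^sup>2 / (m ^ k)\<^sup>2) \<partial>\<Omega>) = ennreal (\<integral>N. (psum k (g k) N)\<^sup>2 / (m ^ k)\<^sup>2 \<partial>\<Omega>)"
      using pg[of k k] by (intro nn_integral_eq_integral) auto
    also have "(\<integral>N. (psum k (g k) N)\<^sup>2 / (m ^ k)\<^sup>2 \<partial>\<Omega>) = (\<integral>N. (g k N)\<^sup>2 \<partial>\<Omega>) / m ^ k"
      using pg[of k k] mk[of k] by (simp add: power2_eq_square)
    also have "ennreal \<dots> \<le> ennreal ((\<integral>N. (f k N)\<^sup>2 \<partial>\<Omega>) / m ^ k)"
      using mk[of k] g_var(2)[of k] by (intro ennreal_leI divide_right_mono) auto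
    also have "\<dots> = ennreal (\<integral>N. (f k N)\<^sup>2 / m ^ k \<partial>\<Omega>)" by simp
    also have "\<dots> = (\<integral>\<^sup>+N. ennreal ((f k N)\<^sup>2 / m ^ k) \<partial>\<Omega>)"
      using f2_int[of k] mk[of k] by (intro nn_integral_eq_integral[symmetric]) auto
    finally show "(\<integral>\<^sup>+N. ennreal ((psum k (g k) N)\<^sup>2 / (m ^ k)\<^sup>2) \<partial>\<Omega>) \<le> \<dots>" .
  qed
  also have "\<dots> = (\<integral>\<^sup>+N. (\<Sum>k. ennreal ((f k N)\<^sup>2 / m ^ k)) \<partial>\<Omega>)"
    by (rule nn_integral_suminf[symmetric]) measurable
  also have "\<dots> \<le> (\<integral>\<^sup>+N. ennreal c * h N \<partial>\<Omega>)"
  proof (intro nn_integral_mono)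
    fix N
    show "(\<Sum>k. ennreal ((f k N)\<^sup>2 / m ^ k)) \<le> ennreal c * h N"
    proof (cases "h N")
      case (real r)
      have "(\<Sum>k<n. ennreal ((f k N)\<^sup>2 / m ^ k)) \<le> ennreal c * h N" for n
      proof -
        have "(\<Sum>k<n. ennreal ((f k N)\<^sup>2 / m ^ k)) = (\<Sum>k<n. ennreal (if r \<le> m ^ k then r\<^sup>2 / m ^ k else 0))"
          using real mk(1)[THEN less_imp_le] by (intro sum.cong refl) (auto simp: f_def)
        also have "\<dots> = ennreal (\<Sum>k<n. if r \<le> m ^ k then r\<^sup>2 / m ^ k else 0)"
          using mk(1) by (intro sum_ennreal) (auto intro!: divide_nonneg_pos)
        also have "\<dots> \<le> ennreal (c * r)"
          unfolding c_def using sum_powers_above[OF mean_gt_1 real(1)] by (rule ennreal_leI)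
        finally show ?thesis using real c by (simp add: ennreal_mult)
      qed
      then show ?thesis by (intro suminf_le_const summableI)
    next
      case top
      then show ?thesis by (simp add: f_def top_unique)
    qed
  qed
  finally have "(\<integral>\<^sup>+N. (\<Sum>k. ennreal ((psum k (g k) N)\<^sup>2 / (m ^ k)\<^sup>2)) \<partial>\<Omega>) \<noteq> \<infinity>"
    using cfin by auto
  then have AE2: "AE N in \<Omega>. (\<Sum>k. ennreal ((psum k (g k) N)\<^sup>2 / (m ^ k)\<^sup>2)) \<noteq> \<infinity>"
    by (intro nn_integral_noteq_infinite) measurable
  have "AE N in \<Omega>. psum k h N \<noteq> \<infinity>" for k
  proof (intro nn_integral_noteq_infinite)
    show "(\<integral>\<^sup>+N. psum k h N \<partial>\<Omega>) \<noteq> \<infinity>"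
      using fin by (simp add: nn_integral_psum ennreal_mult_eq_top_iff)
  qed measurable
  then have AE3: "AE N in \<Omega>. \<forall>k. psum k h N \<noteq> \<infinity>" by (simp add: AE_all_countable)
  show ?thesis
    using AE1 AE2 AE3 growth
  proof eventually_elim
    case (elim N)
    obtain k0 where k0: "\<And>k. k \<ge> k0 \<Longrightarrow> psum k (indicator (A k)) N = (0::ennreal)"
      using eventually_zero_if_suminf_finite[of "\<lambda>k. psum k (indicator (A k)) N", OF psum_indicator_cases] elim(1)
      by auto
    define V where "V = (\<Sum>k. ennreal ((psum k (g k) N)\<^sup>2 / (m ^ k)\<^sup>2))"
    have "V \<noteq> \<infinity>" unfolding V_def by (rule elim(2))
    then obtain v where v: "0 \<le> v" "V = ennreal v" by (cases V) auto
    obtain C where C: "\<And>n. gsize n N \<le> C * m ^ n" using elim(4) by blast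
    have C1: "1 \<le> C" using C[of 0] by simp
    define H where "H = enn2real (\<integral>\<^sup>+N. h N \<partial>\<Omega>)"
    have H: "0 \<le> H" by (simp add: H_def)
    \<comment> \<open>Before \<open>k0\<close> large terms may occur; these finitely many sums are
      finite by \<open>AE3\<close> and go into the constant.\<close>
    define C0 where "C0 = (\<Sum>k<k0. enn2real (psum k h N))"
    have C0: "0 \<le> C0" by (auto simp: C0_def intro: sum_nonneg)
    have large: "psum k h N \<le> ennreal ((1 + v + H * C) * m ^ k)" if "k \<ge> k0" for k
    proof -
      have "psum k h N = ennreal (psum k (f k) N)"
      proof (rule psum_eq_where_zero[OF _ _ k0[OF that]])
        fix N assume "indicator (A k) N = (0::ennreal)"
        then have "h N \<le> ennreal (m ^ k)" by (auto simp: A_def indicator_def split: if_splits)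
        moreover from this have "h N < top" by (rule le_less_trans) simp
        ultimately show "h N = ennreal (f k N)" by (simp add: f_def)
      qed (rule fr)
      \<comment> \<open>The centred part is bounded through \<open>V\<close>; the means contribute
        at most \<open>H\<close> per vertex, and this is where the assumed bound on the generation
        sizes enters.\<close>
      also have "psum k (f k) N = psum k (\<lambda>N. g k N + e k * 1) N" by (simp add: g_def)
      also have "\<dots> = psum k (g k) N + e k * gsize k N" by (simp only: psum_add psum_cmult)
      also have "\<dots> \<le> (1 + v) * m ^ k + H * (C * m ^ k)"
      proof (intro add_mono mult_mono)
        define x where "x = psum k (g k) N / m ^ k"
        define w where "w k = ennreal ((psum k (g k) N)\<^sup>2 / (m ^ k)\<^sup>2)" for k
        have "ennreal (x\<^sup>2) = sum w {k}" by (simp add: w_def x_def power_divide)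
        also have "\<dots> \<le> suminf w" by (rule sum_le_suminf[OF summableI]) auto
        also have "\<dots> = V" by (simp only: V_def w_def[abs_def])
        finally have "ennreal (x\<^sup>2) \<le> V" .
        then have "x\<^sup>2 \<le> v" using v by simp
        moreover have "2 * x \<le> 1 + x\<^sup>2" using sum_squares_bound[of 1 x] by simp
        ultimately have "x \<le> 1 + v" using v(1) by linarith
        then show "psum k (g k) N \<le> (1 + v) * m ^ k" using mk[of k] by (simp add: x_def divide_simps)
      qed (use eH C H in \<open>auto simp: H_def psum_nonneg\<close>)
      finally show ?thesis using mk by (simp add: ennreal_leI algebra_simps)
    qed
    show ?case
    proof (intro exI[of _ "1 + v + H * C + C0"] allI)
      fix k
      show "psum k h N \<le> ennreal ((1 + v + H * C + C0) * m ^ k)"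
      proof (cases "k \<ge> k0")
        case True
        have "(1 + v + H * C) * m ^ k \<le> (1 + v + H * C + C0) * m ^ k"
          using C0 mk(1)[of k] by (intro mult_right_mono) auto
        then show ?thesis using large[OF True] order_trans ennreal_leI by blast
      next
        case False
        have "enn2real (psum k h N) \<le> C0"
          unfolding C0_def using False by (intro member_le_sum) auto
        also have "\<dots> \<le> (1 + v + H * C + C0) * 1" using v H C1 by simp
        also have "\<dots> \<le> (1 + v + H * C + C0) * m ^ k"
          using v H C1 C0 mk(2)[of k] by (intro mult_left_mono) auto
        finally have "ennreal (enn2real (psum k h N)) \<le> ennreal ((1 + v + H * C + C0) * m ^ k)"
          by (rule ennreal_leI)
        then show ?thesis using elim(3) by (simp add: less_top)
      qed
    qed
  qed
qed

lemma gsize_le_if_majorant_finite: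
  assumes "majorant N < \<infinity>"
  shows "\<exists>C. \<forall>n. gsize n N \<le> C * m ^ n"
proof -
  obtain r where r: "majorant N = ennreal r" "0 \<le> r" using assms by (cases "majorant N") auto
  have "gsize n N \<le> (1 + r) * m ^ n" for n
  proof -
    define x where "x = gsize n N / m ^ n"
    have "x\<^sup>2 \<le> r" using gsize_square_le_majorant[of n N] r by (simp add: x_def)
    moreover have "2 * x \<le> 1 + x\<^sup>2" using sum_squares_bound[of 1 x] by simp
    ultimately have "x \<le> 1 + r" using r(2) by linarith
    moreover have "0 < m ^ n" using mean_gt_1 by simp
    ultimately show ?thesis by (simp add: x_def divide_simps)
  qed
  then show ?thesis by blast
qed

lemma AE_psum_majorant: "AE N in \<Omega>. \<exists>C. \<forall>k. psum k majorant N \<le> ennreal (C * m ^ k)"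
proof (rule AE_psum_bounded[OF measurable_majorant nn_integral_majorant])
  show "AE N in \<Omega>. \<exists>C. \<forall>n. gsize n N \<le> C * m ^ n"
    using AE_majorant_finite by eventually_elim (rule gsize_le_if_majorant_finite)
qed

end

section \<open>Galton-Watson trees grow regularly\<close>

lemma ch_tree_of: "ch (tree_of N) = {..<N []}"
  using snoc_in_tree_of_iff[of "[]" _ N] by (auto simp: ch_def Nil_in_tree_of)

lemma sub_tree_of: "i < N [] \<Longrightarrow> sub (tree_of N) i = tree_of (\<lambda>u. N (i # u))"
  by (auto simp: sub_def tree_of_def less_Suc_eq_0_disj)

lemma lsum_tree_of: "lsum k g (tree_of N) = psum k (\<lambda>N. g (tree_of N)) N"
  by (induction k arbitrary: N) (simp_all add: ch_tree_of sub_tree_of)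

lemma leafless_tree_tree_of:
  assumes "\<And>v. 1 \<le> N v" shows "leafless_tree (tree_of N)"
proof -
  have "v @ [0] \<in> tree_of N" if "v \<in> tree_of N" for v
    using that assms[of v] by (simp add: snoc_in_tree_of_iff)
  then show ?thesis
    by (auto simp: leafless_tree_def Nil_in_tree_of snoc_in_tree_of_iff)
qed

section \<open>Measurability of functionals of trees\<close>

lemma pred_mem_tree [measurable]: "Measurable.pred tree_space (\<lambda>T. v \<in> T)"
  by (auto simp: pred_def tree_space_def)

lemma measurable_sub [measurable]: "(\<lambda>T. sub T i) \<in> measurable tree_space tree_space"
proof -
  have "(\<lambda>T. sub T i) -` A \<inter> space tree_space \<in> sets tree_space" if "A \<in> range (\<lambda>v. {T. v \<in> T})" for A
  proof -
    from that obtain v where "A = {T. v \<in> T}" by auto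
    then have "(\<lambda>T. sub T i) -` A \<inter> space tree_space = {T \<in> space tree_space. i # v \<in> T}"
      by (auto simp: sub_def)
    also have "\<dots> \<in> sets tree_space" by measurable
    finally show ?thesis .
  qed
  then show ?thesis
    by (subst (2) tree_space_def) (intro measurable_sigma_sets[OF sets_measure_of]; auto)
qed

lemma pred_finite_ch [measurable]: "Measurable.pred tree_space (\<lambda>T. finite {i. v @ [i] \<in> T})"
proof -
  have "(\<lambda>T. finite {i. v @ [i] \<in> T}) = (\<lambda>T. \<exists>n. \<forall>i. v @ [i] \<in> T \<longrightarrow> i < n)"
    by (auto simp: finite_nat_set_iff_bounded)
  then show ?thesis by simp
qed

lemma measurable_lsum [measurable]:
  assumes "g \<in> borel_measurable tree_space" shows "lsum k g \<in> borel_measurable tree_space"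
proof (induction k)
  case (Suc k)
  \<comment> \<open>The random index set is replaced by a series over all naturals. For an infinite
    set of children the finite sum is 0 by convention, hence the case distinction.\<close>
  have "lsum (Suc k) g = (\<lambda>T. if finite {i. [] @ [i] \<in> T}
      then (\<Sum>i. if [i] \<in> T then lsum k g (sub T i) else 0) else 0)"
  proof
    fix T
    show "lsum (Suc k) g T = (if finite {i. [] @ [i] \<in> T}
      then (\<Sum>i. if [i] \<in> T then lsum k g (sub T i) else 0) else 0)"
    proof (cases "finite (ch T)")
      case True
      then have "(\<Sum>i. if [i] \<in> T then lsum k g (sub T i) else 0) = (\<Sum>i\<in>ch T. if [i] \<in> T then lsum k g (sub T i) else 0)"
        by (intro suminf_finite) (auto simp: ch_def)
      then show ?thesis using True by (simp add: ch_def)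
    qed (simp add: ch_def)
  qed
  also have "\<dots> \<in> borel_measurable tree_space"
    using measurable_compose[OF measurable_sub Suc] by measurable
  finally show ?case .
qed (use assms in simp)

lemma sets_regular_tree: "{T \<in> space tree_space. leafless_tree T \<and> regular_growth m T} \<in> sets tree_space"
  unfolding leafless_tree_def regular_growth_def Ball_def Bex_def by measurable

text \<open>For the energy bound, the squared size of generation \<open>j = n - k\<close> of each
  subtree is at most \<open>(m ^ j)^2\<close> times its majorant. Summed over generation
  \<open>k\<close>, the majorants give at most a multiple of \<open>m ^ k\<close>; with the factor
  \<open>m ^ k\<close> of the definition, the total order is \<open>m ^ (2 * n)\<close>.\<close>

lemma (in offspring) AE_regular_tree:
  "AE T in galton_watson q. leafless_tree T \<and> regular_growth m T"
  unfolding galton_watson_def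
proof (subst AE_distr_iff[OF measurable_tree_of sets_regular_tree])
  show "AE N in \<Omega>. leafless_tree (tree_of N) \<and> regular_growth m (tree_of N)"
    using AE_no_death AE_not_slow AE_psum_majorant
  proof eventually_elim
    case (elim N)
    obtain C1 :: nat where C1: "\<And>n. m ^ n \<le> C1 * gsize n N"
      using elim(2) by (auto simp: slow_def not_less)
    obtain C2 where C2: "\<And>k. psum k majorant N \<le> ennreal (C2 * m ^ k)" using elim(3) by blast
    obtain C3 :: nat where C3: "max 1 C2 \<le> C3" using real_arch_simple by blast
    define C where "C = C1 + C3"
    have "regular_growth m (tree_of N)"
      unfolding regular_growth_def
    proof (intro exI[of _ C] conjI allI impI)
      show "0 < C" using C3 by (simp add: C_def)
      fix n
      have "C1 * gsize n N \<le> C * gsize n N"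
        by (intro mult_right_mono) (auto simp: C_def psum_nonneg)
      then show "m ^ n \<le> C * gen_size n (tree_of N)"
        using C1[of n] by (simp add: lsum_tree_of)
      fix k assume k: "k \<le> n"
      define j where "j = n - k"
      have m: "0 < m" using mean_gt_1 by simp
      have "ennreal (psum k (\<lambda>N. (gsize j N)\<^sup>2) N) = psum k (\<lambda>N. ennreal ((gsize j N)\<^sup>2)) N"
        by (rule psum_ennreal[symmetric]) simp
      also have "\<dots> \<le> psum k (\<lambda>N. ennreal ((m ^ j)\<^sup>2) * majorant N) N"
      proof (rule psum_mono)
        fix N
        have "(gsize j N)\<^sup>2 = (m ^ j)\<^sup>2 * (gsize j N / m ^ j)\<^sup>2" using m by (simp add: power_divide)
        then have "ennreal ((gsize j N)\<^sup>2) = ennreal ((m ^ j)\<^sup>2) * ennreal ((gsize j N / m ^ j)\<^sup>2)"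
          by (simp add: ennreal_mult)
        also have "\<dots> \<le> ennreal ((m ^ j)\<^sup>2) * majorant N"
          by (intro mult_left_mono gsize_square_le_majorant) simp
        finally show "ennreal ((gsize j N)\<^sup>2) \<le> ennreal ((m ^ j)\<^sup>2) * majorant N" .
      qed
      also have "\<dots> = ennreal ((m ^ j)\<^sup>2) * psum k majorant N" by (rule psum_cmult)
      also have "\<dots> \<le> ennreal ((m ^ j)\<^sup>2) * ennreal (C * m ^ k)"
      proof (intro mult_left_mono order_trans[OF C2] ennreal_leI mult_right_mono)
        show "C2 \<le> C" using C3 by (simp add: C_def)
      qed (use m in auto)
      also have "\<dots> = ennreal ((m ^ j)\<^sup>2 * (C * m ^ k))" using m by (simp add: ennreal_mult)
      finally have "psum k (\<lambda>N. (gsize j N)\<^sup>2) N \<le> (m ^ j)\<^sup>2 * (C * m ^ k)"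
        using m by (simp add: ennreal_le_iff)
      then have "psum k (\<lambda>N. (gsize j N)\<^sup>2) N * m ^ k \<le> (m ^ j)\<^sup>2 * (C * m ^ k) * m ^ k"
        using m by (intro mult_right_mono) auto
      also have "\<dots> = C * (m ^ (j + k))\<^sup>2" by (simp add: power_add power2_eq_square)
      also have "\<dots> = C * m ^ (2 * n)" using k by (simp add: j_def power_even_eq)
      finally show "flow_energy n (tree_of N) k * m ^ k \<le> C * m ^ (2 * n)"
        by (simp add: lsum_tree_of j_def)
    qed
    moreover have "leafless_tree (tree_of N)" using elim(1) by (intro leafless_tree_tree_of) simp
    ultimately show ?case by simp
  qed
qed

lemma AE_pair_conj:
  assumes "prob_space M" "prob_space N" and P: "AE x in M. P x" and Q: "AE y in N. Q y"
  shows "AE (x, y) in M \<Otimes>\<^sub>M N. P x \<and> Q y"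
proof -
  interpret M: prob_space M by fact
  interpret N: prob_space N by fact
  obtain A where A: "{x \<in> space M. \<not> P x} \<subseteq> A" "A \<in> sets M" "emeasure M A = 0" using P by (rule AE_E)
  obtain B where B: "{y \<in> space N. \<not> Q y} \<subseteq> B" "B \<in> sets N" "emeasure N B = 0" using Q by (rule AE_E)
  show ?thesis
  proof (rule AE_I)
    show "{p \<in> space (M \<Otimes>\<^sub>M N). \<not> (case p of (x, y) \<Rightarrow> P x \<and> Q y)} \<subseteq> A \<times> space N \<union> space M \<times> B"
      using A(1) B(1) by (auto simp: space_pair_measure)
    have "emeasure (M \<Otimes>\<^sub>M N) (A \<times> space N \<union> space M \<times> B) \<le> emeasure (M \<Otimes>\<^sub>M N) (A \<times> space N) + emeasure (M \<Otimes>\<^sub>M N) (space M \<times> B)"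
      using A B by (intro emeasure_subadditive) auto
    also have "\<dots> = 0" using A B by (simp add: N.emeasure_pair_measure_Times)
    finally show "emeasure (M \<Otimes>\<^sub>M N) (A \<times> space N \<union> space M \<times> B) = 0" by simp
    show "A \<times> space N \<union> space M \<times> B \<in> sets (M \<Otimes>\<^sub>M N)" using A B by auto
  qed
qed

theorem theorem1p1:
  fixes q q' :: "nat pmf" and m :: real
  assumes "(\<lambda>n. real n * pmf q n) sums m"
    and "(\<lambda>n. real n * pmf q' n) sums m"
    and "pmf q 0 = 0" and "pmf q' 0 = 0"
    and "pmf q 1 \<noteq> 1" and "pmf q' 1 \<noteq> 1"
    and "summable (\<lambda>n. (real n)\<^sup>2 * pmf q n)"
    and "summable (\<lambda>n. (real n)\<^sup>2 * pmf q' n)"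
  shows "AE (\<Gamma>, \<Gamma>') in galton_watson q \<Otimes>\<^sub>M galton_watson q'. equipolar \<Gamma> \<Gamma>'"
proof -
  interpret q: offspring q m using assms by unfold_locales auto
  interpret q': offspring q' m using assms by unfold_locales auto
  have "AE (\<Gamma>, \<Gamma>') in galton_watson q \<Otimes>\<^sub>M galton_watson q'.
      (leafless_tree \<Gamma> \<and> regular_growth m \<Gamma>) \<and> (leafless_tree \<Gamma>' \<and> regular_growth m \<Gamma>')"
    by (intro AE_pair_conj prob_space_galton_watson q.AE_regular_tree q'.AE_regular_tree)
  then show ?thesis
  proof eventually_elim
    case (elim p)
    \<comment> \<open>\<open>polar_imp_polar\<close> is applied in both directions, to all
      \<open>F\<close> and closed \<open>B\<close> outside a single null set.\<close>
    then show ?case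
      using polar_imp_polar[OF q.mean_gt_1] by (cases p) (auto simp: equipolar_def)
  qed
qed

end
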